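(* Let $p>2$. Suppose that $u$ is a weak supersolution of $\partial_t(u^{p-1})+\mathcal{L}u=0$ in $\Omega\times(0,T)$ with $u\ge\rho>0$ in $\mathbb{R}^n\times(t_0,t_0+r^{ps})$, where $t_0\in(0,T-r^{ps})$. Then for any $\theta\in[\frac12,1)$ there exist positive constants $\mu=\mu(\kappa,p)$ and $C=C(n,p,q,s,\Lambda)\ge1$ such that $$\Big(\fint_{U^{+}(x_0,t_0,\theta r)}u(x,t)^q\,dx\,dt\Big)^{\frac1q}\le\Big(\frac{C}{(1-\theta)^\mu}\fint_{U^{+}(x_0,t_0,r)}u(x,t)^{\bar q}\,dx\,dt\Big)^{\frac1{\bar q}}$$ for all $0<\bar q<q<q_0$, where $q_0=\kappa(p-1)$, with $\kappa=\frac{n+sp}{n}$ if $sp<n$ and $\kappa=\frac32$ if $sp\ge n$. Here $x_0\in\mathbb{R}^n$, $r>0$, and $U^{+}(x_0,t_0,\varrho)=B_\varrho(x_0)\times(t_0,t_0+\varrho^{sp})$.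
   Context: Setting: $\Omega\subset\mathbb{R}^n$ is a bounded smooth domain, $T>0$, $s\in(0,1)$, $\Lambda\ge1$. The kernel $K(x,y,t)$ is symmetric in $x$ and $y$ and satisfies $\frac{\Lambda^{-1}}{|x-y|^{n+ps}}\le K(x,y,t)\le\frac{\Lambda}{|x-y|^{n+ps}}$ uniformly in $t\in(0,T)$. The operator is $\mathcal{L}u(x,t)=\mathrm{P.V.}\int_{\mathbb{R}^n}|u(x,t)-u(y,t)|^{p-2}(u(x,t)-u(y,t))K(x,y,t)\,dy$. Function spaces: $W^{s,p}(\Omega)$ is the space of $u\in L^p(\Omega)$ with $\int_\Omega\int_\Omega\frac{|u(x)-u(y)|^p}{|x-y|^{n+sp}}\,dx\,dy<\infty$, with norm the $p$-th root of $\|u\|_{L^p(\Omega)}^p$ plus this double integral; $W_0^{s,p}(\Omega)=\{u\in W^{s,p}(\mathbb{R}^n):u=0\text{ on }\mathbb{R}^n\setminus\Omega\}$; the local and parabolic (Bochner) versions are defined in the usual way. Weak supersolution: a function $u\in L^\infty(0,T;L^\infty(\mathbb{R}^n))$ with $u>0$ in $\mathbb{R}^n\times(0,T)$ is a weak supersolution of $\partial_t(u^{p-1})+\mathcal{L}u=0$ in $\Omega\times(0,T)$ if $u\in C_{\mathrm{loc}}(0,T;L^p_{\mathrm{loc}}(\Omega))\cap L^p_{\mathrm{loc}}(0,T;W^{s,p}_{\mathrm{loc}}(\Omega))$ and for every $\Omega'\times[t_1,t_2]\Subset\Omega\times(0,T)$ and every nonnegative $\phi\in W^{1,p}_{\mathrm{loc}}(0,T;L^p(\Omega'))\cap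 L^p_{\mathrm{loc}}(0,T;W^{s,p}_0(\Omega'))$ one has $$\int_{\Omega'}u(x,t_2)^{p-1}\phi(x,t_2)\,dx-\int_{\Omega'}u(x,t_1)^{p-1}\phi(x,t_1)\,dx-\int_{t_1}^{t_2}\int_{\Omega'}u^{p-1}\partial_t\phi\,dx\,dt$$ $$+\int_{t_1}^{t_2}\int_{\mathbb{R}^n}\int_{\mathbb{R}^n}|u(x,t)-u(y,t)|^{p-2}(u(x,t)-u(y,t))(\phi(x,t)-\phi(y,t))K(x,y,t)\,dx\,dy\,dt\ge0.$$ $B_r(x_0)$ is the open ball of radius $r$ and center $x_0$ in $\mathbb{R}^n$; $\fint$ denotes the integral average; $\rho$ is a constant. $\mu(\kappa,p)$ and $C(n,p,q,s,\Lambda)$ mean constants depending on the listed quantities.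
   Formalization: The ball B_r(x_0) is additionally assumed to lie in Ω; for arbitrary x_0 in R^n and r>0 the claim is false, since outside Ω u is only a bounded positive function and can have a narrow high spike there. *)

theory Defs
  imports "HOL-Analysis.Analysis"
begin

text \<open>
  Conventions. The space \<open>R^n\<close> is \<^typ>\<open>real ^ 'n\<close> with \<open>n = CARD('n)\<close>. Elements of Lebesgue,
  Sobolev and Bochner spaces are represented by functions; pointwise relations between such
  elements (positivity, boundedness, vanishing outside a set) hold almost everywhere. A function of
  space and time is written in curried form \<open>u x t\<close>.
\<close>


section \<open>Smooth domains\<close>

primrec Ck_on :: "nat \<Rightarrow> 'a::euclidean_space set \<Rightarrow> ('a \<Rightarrow> real) \<Rightarrow> bool" where
  "Ck_on 0 S f \<longleftrightarrow> continuous_on S f"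
| "Ck_on (Suc k) S f \<longleftrightarrow> f differentiable_on S \<and>
     (\<forall>b\<in>Basis. Ck_on k S (\<lambda>x. frechet_derivative f (at x) b))"

text \<open>Intended for open \<open>S\<close>, where \<open>at x\<close> and \<open>at x within S\<close> agree.\<close>

definition smooth_on :: "'a::euclidean_space set \<Rightarrow> ('a \<Rightarrow> real) \<Rightarrow> bool" where
  "smooth_on S f \<longleftrightarrow> (\<forall>k. Ck_on k S f)"

text \<open>
  Near each boundary point \<open>\<Omega>\<close> is, up to relabelling and reflecting coordinates, the region above
  the graph of a smooth function of the other \<open>n - 1\<close> coordinates. The function \<open>\<gamma>\<close> of \<open>n - 1\<close>
  variables is encoded as a function on \<open>R^n\<close> that does not depend on the coordinate \<open>i\<close>.
\<close>

definition smooth_boundary :: "(real ^ 'n) set \<Rightarrow> bool" where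
  "smooth_boundary \<Omega> \<longleftrightarrow>
     (\<forall>z\<in>frontier \<Omega>. \<exists>\<epsilon>>0. \<exists>i. \<exists>\<sigma>\<in>{-1, 1}. \<exists>\<gamma>.
        smooth_on UNIV \<gamma> \<and> (\<forall>x y. (\<forall>j. j \<noteq> i \<longrightarrow> x $ j = y $ j) \<longrightarrow> \<gamma> x = \<gamma> y) \<and>
        \<Omega> \<inter> ball z \<epsilon> = {x \<in> ball z \<epsilon>. \<sigma> * x $ i > \<gamma> x})"

definition bounded_smooth_domain :: "(real ^ 'n) set \<Rightarrow> bool" where
  "bounded_smooth_domain \<Omega> \<longleftrightarrow>
     open \<Omega> \<and> connected \<Omega> \<and> \<Omega> \<noteq> {} \<and> bounded \<Omega> \<and> smooth_boundary \<Omega>"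

definition compactly_inside :: "(real ^ 'n) set \<Rightarrow> (real ^ 'n) set \<Rightarrow> bool" where
  "compactly_inside A \<Omega> \<longleftrightarrow> open A \<and> compact (closure A) \<and> closure A \<subseteq> \<Omega>"


section \<open>Function spaces\<close>

definition Lp :: "real \<Rightarrow> (real ^ 'n) set \<Rightarrow> (real ^ 'n \<Rightarrow> real) set" where
  "Lp p A = {f. set_borel_measurable lebesgue A f \<and> set_integrable lebesgue A (\<lambda>x. \<bar>f x\<bar> powr p)}"

definition Lp_norm :: "real \<Rightarrow> (real ^ 'n) set \<Rightarrow> (real ^ 'n \<Rightarrow> real) \<Rightarrow> real" where
  "Lp_norm p A f = (LINT x:A|lebesgue. \<bar>f x\<bar> powr p) powr (1 / p)"

definition gagliardo :: "real \<Rightarrow> real \<Rightarrow> (real ^ 'n \<Rightarrow> real) \<Rightarrow> (real ^ 'n) \<times> (real ^ 'n) \<Rightarrow> real" where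
  "gagliardo s p f = (\<lambda>(x, y). \<bar>f x - f y\<bar> powr p / norm (x - y) powr (real CARD('n) + s * p))"

definition Wsp :: "real \<Rightarrow> real \<Rightarrow> (real ^ 'n) set \<Rightarrow> (real ^ 'n \<Rightarrow> real) set" where
  "Wsp s p A = {f \<in> Lp p A. set_integrable lebesgue (A \<times> A) (gagliardo s p f)}"

definition Wsp_norm :: "real \<Rightarrow> real \<Rightarrow> (real ^ 'n) set \<Rightarrow> (real ^ 'n \<Rightarrow> real) \<Rightarrow> real" where
  "Wsp_norm s p A f =
     (Lp_norm p A f powr p + (LINT z:A \<times> A|lebesgue. gagliardo s p f z)) powr (1 / p)"

definition Wsp0 :: "real \<Rightarrow> real \<Rightarrow> (real ^ 'n) set \<Rightarrow> (real ^ 'n \<Rightarrow> real) set" where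
  "Wsp0 s p A = {f \<in> Wsp s p UNIV. AE x in lebesgue. x \<notin> A \<longrightarrow> f x = 0}"

text \<open>
  The Bochner space \<open>L^p_loc(0,T; X)\<close>, where \<open>X\<close> with norm \<open>N\<close> is a separable space of
  functions on \<open>A\<close>; strong measurability amounts to joint measurability on \<open>A \<times> (0,T)\<close>.
\<close>

definition Lp_loc_time ::
  "real \<Rightarrow> real \<Rightarrow> (real ^ 'n) set \<Rightarrow> (real ^ 'n \<Rightarrow> real) set \<Rightarrow> ((real ^ 'n \<Rightarrow> real) \<Rightarrow> real) \<Rightarrow>
   (real ^ 'n \<Rightarrow> real \<Rightarrow> real) set" where
  "Lp_loc_time p T A X N =
     {u. set_borel_measurable lebesgue (A \<times> {0<..<T}) (\<lambda>(x, t). u x t) \<and>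
         (\<forall>a b. 0 < a \<and> a < b \<and> b < T \<longrightarrow>
            (AE t in lebesgue. t \<in> {a..b} \<longrightarrow> (\<lambda>x. u x t) \<in> X) \<and>
            set_integrable lebesgue {a..b} (\<lambda>t. N (\<lambda>x. u x t) powr p))}"

text \<open>
  \<open>C_loc(0,T; L^p(A))\<close>. Here \<open>u\<close> is required to be the continuous representative, so that the slice
  at \<^emph>\<open>every\<close> time is meaningful.
\<close>

definition C_loc_time_Lp ::
  "real \<Rightarrow> real \<Rightarrow> (real ^ 'n) set \<Rightarrow> (real ^ 'n \<Rightarrow> real \<Rightarrow> real) set" where
  "C_loc_time_Lp p T A =
     {u. \<forall>\<tau>\<in>{0<..<T}. (\<lambda>x. u x \<tau>) \<in> Lp p A \<and>
           ((\<lambda>t. Lp_norm p A (\<lambda>x. u x t - u x \<tau>)) \<longlongrightarrow> 0) (at \<tau> within {0<..<T})}"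

definition time_cutoff :: "real \<Rightarrow> (real \<Rightarrow> real) set" where
  "time_cutoff T =
     {\<eta>. smooth_on UNIV \<eta> \<and> compact (closure {t. \<eta> t \<noteq> 0}) \<and> closure {t. \<eta> t \<noteq> 0} \<subseteq> {0<..<T}}"

text \<open>
  \<open>\<psi>\<close> is the weak time derivative of \<open>\<phi>\<close> on \<open>(0,T)\<close>; the identity between \<open>L^p(A)\<close>-valued
  integrals is read in \<open>L^p(A)\<close>, i.e. for almost every \<open>x \<in> A\<close>.
\<close>

definition has_weak_time_derivative ::
  "real \<Rightarrow> (real ^ 'n) set \<Rightarrow> (real ^ 'n \<Rightarrow> real \<Rightarrow> real) \<Rightarrow> (real ^ 'n \<Rightarrow> real \<Rightarrow> real) \<Rightarrow> bool" where
  "has_weak_time_derivative T A \<phi> \<psi> \<longleftrightarrow>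
     (\<forall>\<eta>\<in>time_cutoff T. AE x in lebesgue. x \<in> A \<longrightarrow>
        (LINT t:{0<..<T}|lebesgue. \<phi> x t * deriv \<eta> t) =
        - (LINT t:{0<..<T}|lebesgue. \<psi> x t * \<eta> t))"

text \<open>
  \<open>\<phi> \<in> W^{1,p}_loc(0,T; L^p(A))\<close> with time derivative \<open>\<psi>\<close>, where \<open>\<phi>\<close> is the continuous
  representative.
\<close>

definition W1p_loc_time_Lp ::
  "real \<Rightarrow> real \<Rightarrow> (real ^ 'n) set \<Rightarrow> (real ^ 'n \<Rightarrow> real \<Rightarrow> real) \<Rightarrow> (real ^ 'n \<Rightarrow> real \<Rightarrow> real) \<Rightarrow> bool" where
  "W1p_loc_time_Lp p T A \<phi> \<psi> \<longleftrightarrow>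
     \<phi> \<in> Lp_loc_time p T A (Lp p A) (Lp_norm p A) \<and>
     \<psi> \<in> Lp_loc_time p T A (Lp p A) (Lp_norm p A) \<and>
     has_weak_time_derivative T A \<phi> \<psi> \<and> \<phi> \<in> C_loc_time_Lp p T A"


section \<open>The equation\<close>

text \<open>The bounds are not imposed on the diagonal, where the quotient \<open>\<Lambda> / 0\<close> would be \<open>0\<close>.\<close>

definition admissible_kernel ::
  "real \<Rightarrow> real \<Rightarrow> real \<Rightarrow> real \<Rightarrow> (real ^ 'n \<Rightarrow> real ^ 'n \<Rightarrow> real \<Rightarrow> real) \<Rightarrow> bool" where
  "admissible_kernel s p \<Lambda> T K \<longleftrightarrow>
     set_borel_measurable lebesgue (UNIV \<times> UNIV \<times> {0<..<T}) (\<lambda>(x, y, t). K x y t) \<and>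
     (\<forall>t\<in>{0<..<T}. \<forall>x y. K x y t = K y x t) \<and>
     (\<forall>t\<in>{0<..<T}. \<forall>x y. x \<noteq> y \<longrightarrow>
        inverse \<Lambda> / norm (x - y) powr (real CARD('n) + p * s) \<le> K x y t \<and>
        K x y t \<le> \<Lambda> / norm (x - y) powr (real CARD('n) + p * s))"

text \<open>
  The left-hand side of the defining inequality of supersolutions, with \<open>\<psi>\<close> in the role of
  \<open>\<partial>\<^sub>t \<phi>\<close>. The nonlocal integral is absolutely convergent for the \<open>u\<close>, \<open>\<phi>\<close> admitted below, and is
  written as one integral over \<open>R^n \<times> R^n \<times> [t1,t2]\<close>.
\<close>

definition weak_form ::
  "real \<Rightarrow> (real ^ 'n \<Rightarrow> real ^ 'n \<Rightarrow> real \<Rightarrow> real) \<Rightarrow> (real ^ 'n) set \<Rightarrow> real \<Rightarrow> real \<Rightarrow>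
   (real ^ 'n \<Rightarrow> real \<Rightarrow> real) \<Rightarrow> (real ^ 'n \<Rightarrow> real \<Rightarrow> real) \<Rightarrow> (real ^ 'n \<Rightarrow> real \<Rightarrow> real) \<Rightarrow> real" where
  "weak_form p K A t1 t2 u \<phi> \<psi> =
     (LINT x:A|lebesgue. u x t2 powr (p - 1) * \<phi> x t2)
     - (LINT x:A|lebesgue. u x t1 powr (p - 1) * \<phi> x t1)
     - (LINT (x, t):A \<times> {t1..t2}|lebesgue. u x t powr (p - 1) * \<psi> x t)
     + (LINT (x, y, t):UNIV \<times> UNIV \<times> {t1..t2}|lebesgue.
          \<bar>u x t - u y t\<bar> powr (p - 2) * (u x t - u y t) * (\<phi> x t - \<phi> y t) * K x y t)"

text \<open>
  The first two lines express \<open>u \<in> L^\<infinity>(0,T; L^\<infinity>(R^n))\<close>, understood as essential boundedness of a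
  measurable function on \<open>R^n \<times> (0,T)\<close>.
\<close>

definition weak_supersolution ::
  "real \<Rightarrow> real \<Rightarrow> real \<Rightarrow> (real ^ 'n) set \<Rightarrow> (real ^ 'n \<Rightarrow> real ^ 'n \<Rightarrow> real \<Rightarrow> real) \<Rightarrow>
   (real ^ 'n \<Rightarrow> real \<Rightarrow> real) \<Rightarrow> bool" where
  "weak_supersolution s p T \<Omega> K u \<longleftrightarrow>
     set_borel_measurable lebesgue (UNIV \<times> {0<..<T}) (\<lambda>(x, t). u x t) \<and>
     (\<exists>M. AE (x, t) in lebesgue. t \<in> {0<..<T} \<longrightarrow> \<bar>u x t\<bar> \<le> M) \<and>
     (AE (x, t) in lebesgue. t \<in> {0<..<T} \<longrightarrow> 0 < u x t) \<and>
     (\<forall>A. compactly_inside A \<Omega> \<longrightarrow>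
        u \<in> C_loc_time_Lp p T A \<and> u \<in> Lp_loc_time p T A (Wsp s p A) (Wsp_norm s p A)) \<and>
     (\<forall>A t1 t2 \<phi> \<psi>.
        compactly_inside A \<Omega> \<and> 0 < t1 \<and> t1 < t2 \<and> t2 < T \<and>
        W1p_loc_time_Lp p T A \<phi> \<psi> \<and>
        \<phi> \<in> Lp_loc_time p T UNIV (Wsp0 s p A) (Wsp_norm s p UNIV) \<and>
        (AE (x, t) in lebesgue. t \<in> {0<..<T} \<longrightarrow> 0 \<le> \<phi> x t)
        \<longrightarrow> 0 \<le> weak_form p K A t1 t2 u \<phi> \<psi>)"


section \<open>The reverse H\<ouml>lder inequality\<close>

definition Uplus :: "real \<Rightarrow> real \<Rightarrow> real ^ 'n \<Rightarrow> real \<Rightarrow> real \<Rightarrow> ((real ^ 'n) \<times> real) set" where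
  "Uplus s p x0 t0 R = ball x0 R \<times> {t0<..<t0 + R powr (s * p)}"

definition integral_average :: "'a::euclidean_space set \<Rightarrow> ('a \<Rightarrow> real) \<Rightarrow> real" where
  "integral_average S f = (LINT z:S|lebesgue. f z) / measure lebesgue S"

definition kappa :: "nat \<Rightarrow> real \<Rightarrow> real \<Rightarrow> real" where
  "kappa n s p = (if s * p < real n then (real n + s * p) / real n else 3 / 2)"

end

theory Submission
  imports Defs
begin

text \<open>
  Test the equation with \<open>u powr (- e) * \<eta> powr p\<close>, where \<open>e = p - 1 - a\<close> and \<open>0 < a < p - 1\<close>. For
  a supersolution the time term then controls \<open>\<integral> u powr a * \<eta> powr p\<close> at earlier times by its values
  at later times, which is why the cylinders share their bottom. The nonlocal term controls the
  Gagliardo energy of \<open>v = \<eta> * u powr (a / p)\<close>, with constants uniform as \<open>a\<close> tends to \<open>0\<close>. Together with the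
  pointwise fractional Nash inequality
  \<open>v x powr (p * K) \<le> C * (\<integral> v powr p) powr (K - 1) * \<integral> \<bar>v x - v y\<bar> powr p / \<bar>x - y\<bar> powr (n + s * p) dy\<close>,
  \<open>K = 1 + s * p / n\<close>, this bounds the \<open>L^(a K)\<close> average of \<open>u\<close> by its \<open>L^a\<close> average on a larger cylinder.
  Finitely many such steps lead from an exponent in \<open>(qb / K, qb]\<close> to \<open>q\<close>; as long as \<open>a \<le> q / K < p - 1\<close>
  the constant of one step does not depend on \<open>a\<close>, and the accumulated powers form a geometric series.

  In the weak formulation it suffices to use test functions that are constant in time. Inserting
  \<open>u (t + h) powr (- e) * \<eta> powr p\<close> on \<open>[t, t + h]\<close>, integrating over \<open>t\<close> and letting \<open>h\<close> tend to \<open>0\<close> replaces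
  the usual regularisation in time.
\<close>

section \<open>Pointwise inequalities\<close>

text \<open>As \<open>qb\<close> may be arbitrarily small, the number of iteration steps is
  unbounded, and only an energy estimate whose constants survive \<open>a\<close> tending to 0 is
  useful. This is why the pointwise inequality is multiplied by \<open>a\<close> from the start: it
  cancels the factor \<open>1 / a\<close> of the time term, and what remains depends on the distance
  \<open>e = p - 1 - a\<close> from the critical exponent, which stays bounded below by
  \<open>p - 1 - q / K\<close>. The second obstacle is the missing time derivative. The test
  function is frozen at the later end of each short interval, the end for which concavity gives a
  usable sign. Slices of a Borel representative agree with \<open>u\<close> only at almost every
  time, so every statement about single times holds off a null set of times, and endpoints are
  recovered by averaging or monotone limits. The bounds \<open>\<rho>\<close> and \<open>M\<close>
  make negative powers bounded and integrals finite but enter none of the quantitative constants. A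
  Nash inequality in place of a Sobolev embedding treats \<open>s * p < n\<close> and
  \<open>s * p \<ge> n\<close> alike, with gain \<open>K = 1 + s * p / n\<close> in both cases, and
  \<open>kappa \<le> K\<close>.\<close>

lemma powr_le_affine:
  fixes z l :: real
  assumes "0 < z" "0 \<le> l" "l \<le> 1"
  shows "z powr l \<le> 1 + l * (z - 1)"
proof -
  have "exp ((1 - l) *\<^sub>R 0 + l *\<^sub>R ln z) \<le> (1 - l) * exp 0 + l * exp (ln z)"
    by (rule convex_onD[OF exp_convex]) (use assms in auto)
  then show ?thesis
    using assms by (simp add: powr_def algebra_simps)
qed

text \<open>Convexity of the \<open>p\<close>-th power for the splitting
  \<open>a + d = (1 - l) * (a / (1 - l)) + l * (d / l)\<close>. The weight \<open>l\<close> is kept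
  free because \<open>pointwise_energy_ordered\<close> lets it depend on the ratio of two values of
  \<open>u\<close>.\<close>

lemma powr_add_le_weighted:
  fixes a d l p :: real
  assumes "0 \<le> a" "0 \<le> d" "0 < l" "l < 1" "1 \<le> p"
  shows "(a + d) powr p \<le> (1 - l) powr (1 - p) * a powr p + l powr (1 - p) * d powr p"
proof -
  have mono: "1 \<le> x powr (1 - p)" if "0 < x" "x < 1" for x :: real
    using powr_mono'[of "1 - p" 0 x] that assms by simp
  consider "a = 0" | "d = 0" | "0 < a" "0 < d" using assms by linarith
  then show ?thesis
  proof cases
    case 1
    with mult_right_mono[OF mono[of l], of "d powr p"] assms show ?thesis by simp
  next
    case 2
    with mult_right_mono[OF mono[of "1 - l"], of "a powr p"] assms show ?thesis by simp
  next
    case 3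
    have "((1 - l) *\<^sub>R (a / (1 - l)) + l *\<^sub>R (d / l)) powr p
        \<le> (1 - l) * (a / (1 - l)) powr p + l * (d / l) powr p"
      by (rule convex_onD[OF powr_convex]) (use assms 3 in auto)
    moreover have "x * (y / x) powr p = x powr (1 - p) * y powr p" if "0 < x" "0 < y" for x y :: real
      using that by (simp add: powr_divide powr_diff)
    ultimately show ?thesis using assms 3 by simp
  qed
qed

lemma powr_add_le:
  fixes a d p :: real
  assumes "0 \<le> a" "0 \<le> d" "1 \<le> p"
  shows "(a + d) powr p \<le> 2 powr (p - 1) * (a powr p + d powr p)"
proof -
  have "(1/2::real) powr (1 - p) = 2 powr (p - 1)"
    by (simp add: powr_divide powr_minus_divide[symmetric] powr_diff)
  then show ?thesis
    using powr_add_le_weighted[of a d "1/2" p] assms by (simp add: algebra_simps)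
qed

text \<open>A Young inequality with constants 1: the smaller of \<open>X\<close> and
  \<open>Y\<close> is replaced by the larger.\<close>

lemma mult_powr_le_add:
  fixes X Y p :: real
  assumes "0 \<le> X" "0 \<le> Y" "1 \<le> p"
  shows "X powr (p - 1) * Y \<le> X powr p + Y powr p"
proof (cases "X \<le> Y")
  case True
  have "X powr (p - 1) * Y \<le> Y powr (p - 1) * Y"
    by (intro mult_right_mono powr_mono2) (use True assms in auto)
  also have "\<dots> = Y powr p" using assms True
    by (cases "Y = 0") (auto simp: powr_diff)
  finally show ?thesis by (smt (verit) powr_ge_zero)
next
  case False
  have "X powr (p - 1) * Y \<le> X powr (p - 1) * X"
    by (intro mult_left_mono) (use False assms in auto)
  also have "\<dots> = X powr p" using assms False
    by (auto simp: powr_diff)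
  finally show ?thesis by (smt (verit) powr_ge_zero)
qed

text \<open>With \<open>y = 1 - z powr (a / p)\<close> there are two bounds,
  \<open>y \<le> 1 - z\<close> and \<open>y \<le> (a / p) * (- ln z)\<close>. The first is used for
  \<open>p - 1\<close> factors of \<open>y powr p\<close>, the second for the remaining one; the
  latter supplies the factor \<open>a\<close> on the right. Only half of the exponent
  \<open>- e\<close> is spent here, since \<open>z powr (- e / 2)\<close> is reserved for the cutoff
  in \<open>pointwise_energy_ordered\<close>.\<close>

lemma one_minus_powr_le:
  fixes z a e p :: real
  assumes "0 < z" "z \<le> 1" "0 < a" "a \<le> p" "1 \<le> p" "0 < e"
  shows "p * e / 2 * (1 - z powr (a / p)) powr p
      \<le> a * ((1 - z) powr (p - 1) * (z powr (- e) - z powr (- e / 2)))"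
proof -
  define y where "y = 1 - z powr (a / p)"
  have z1: "z powr x \<le> 1" if "0 \<le> x" for x using powr_le1[of x z] that assms by simp
  have y0: "0 \<le> y" using z1[of "a / p"] assms by (simp add: y_def)
  have "z powr 1 \<le> z powr (a / p)"
    by (rule powr_mono') (use assms in auto)
  then have y1: "y \<le> 1 - z" using assms by (simp add: y_def)
  have "1 + a / p * ln z \<le> exp (a / p * ln z)" by (rule exp_ge_add_one_self)
  then have y2: "y \<le> a / p * - ln z" using assms by (simp add: y_def powr_def algebra_simps)
  have "1 + e / 2 * - ln z \<le> exp (e / 2 * - ln z)" by (rule exp_ge_add_one_self)
  then have "1 + e / 2 * - ln z \<le> z powr (- e / 2)" using assms by (simp add: powr_def)
  then have l: "e / 2 * - ln z \<le> z powr (- e / 2) - 1" by simp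
  have w: "1 \<le> z powr (- e / 2)"
    using z1[of "e/2"] assms by (simp add: powr_minus_divide)
  have "z powr (- e) = z powr (- e / 2) * z powr (- e / 2)"
    by (simp flip: powr_add)
  then have l2: "e / 2 * - ln z \<le> z powr (- e) - z powr (- e / 2)"
    using l w mult_right_mono[OF w, of "z powr (- e / 2) - 1"] by (simp add: algebra_simps)
  have "y powr p \<le> (1 - z) powr (p - 1) * y"
  proof -
    have "y powr p = y powr (p - 1) * y" using y0 by (cases "y = 0") (auto simp: powr_diff)
    also have "\<dots> \<le> (1 - z) powr (p - 1) * y"
      by (intro mult_right_mono powr_mono2) (use y0 y1 assms in auto)
    finally show ?thesis .
  qed
  also have "\<dots> \<le> (1 - z) powr (p - 1) * (a / p * - ln z)"
    by (intro mult_left_mono y2) auto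
  finally have "p * e / 2 * y powr p \<le> p * e / 2 * ((1 - z) powr (p - 1) * (a / p * - ln z))"
    by (intro mult_left_mono) (use assms in auto)
  also have "\<dots> = a * ((1 - z) powr (p - 1) * (e / 2 * - ln z))"
    using assms by (simp add: field_simps)
  also have "\<dots> \<le> a * ((1 - z) powr (p - 1) * (z powr (- e) - z powr (- e / 2)))"
    by (intro mult_left_mono l2) (use assms in auto)
  finally show ?thesis by (simp add: y_def)
qed

text \<open>The nonlinearity of the fractional p-Laplacian, odd in \<open>c\<close>.\<close>

definition cdn :: "real \<Rightarrow> real \<Rightarrow> real" where
  "cdn p c = \<bar>c\<bar> powr (p - 2) * c"

lemma cdn_nonneg: "0 \<le> c \<Longrightarrow> cdn p c = c powr (p - 1)"
  by (cases "c = 0") (auto simp: cdn_def powr_diff field_simps power2_eq_square)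

lemma cdn_minus: "cdn p (- c) = - cdn p c"
  by (simp add: cdn_def)

lemma abs_cdn: "\<bar>cdn p c\<bar> = \<bar>c\<bar> powr (p - 1)"
proof (cases "0 \<le> c")
  case False
  then have "\<bar>cdn p (- c)\<bar> = \<bar>c\<bar> powr (p - 1)" using cdn_nonneg[of "- c" p] by simp
  then show ?thesis by (simp add: cdn_minus)
qed (simp add: cdn_nonneg)

text \<open>Both sides are homogeneous of degree \<open>a\<close> in \<open>(A, B)\<close>, so only
  the ratio \<open>z = B / A\<close> in (0, 1] matters. The two cutoff values are decoupled by
  comparing \<open>s powr p\<close> with \<open>t powr p\<close> at a weight proportional to
  \<open>1 - z\<close>; the price, a factor \<open>z powr (- e / 2)\<close>, is covered by
  \<open>one_minus_powr_le\<close>.\<close>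

lemma pointwise_energy_ordered:
  fixes A B p a e s t :: real
  assumes "0 < B" "B \<le> A" "2 < p" "0 < a" "0 < e" "a + e = p - 1" "0 \<le> s" "0 \<le> t"
  shows "a * ((A - B) powr (p - 1) * (A powr (- e) * s powr p - B powr (- e) * t powr p))
    \<le> - (p * e * 2 powr (- p)) * \<bar>s * A powr (a / p) - t * B powr (a / p)\<bar> powr p
      + (p * e / 2 + a * (2 * (p - 1) / e) powr (p - 1)) * \<bar>s - t\<bar> powr p * A powr a"
proof -
  define z where "z = B / A"
  have z: "0 < z" "z \<le> 1" using assms by (auto simp: z_def)
  have A0: "0 < A" using assms by linarith
  define d where "d = \<bar>s - t\<bar>"
  \<comment> \<open>Chosen such that \<open>l0 * (1 - p) = - e / 2\<close>, hence
    \<open>(1 - l) powr (1 - p)\<close> costs at most half of the exponent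
    \<open>- e\<close>.\<close>
  define l0 where "l0 = e / (2 * (p - 1))"
  have l0: "0 < l0" "l0 \<le> 1/2" using assms by (auto simp: l0_def field_simps)
  define X where "X = (1 - z) powr (p - 1)"
  have l0p: "l0 powr (1 - p) = (2 * (p - 1) / e) powr (p - 1)"
  proof -
    have "l0 = inverse (2 * (p - 1) / e)" by (simp add: l0_def)
    then have "l0 = (2 * (p - 1) / e) powr (-1)" using assms by (simp add: powr_minus)
    then have "l0 powr (1 - p) = ((2 * (p - 1) / e) powr (-1)) powr (1 - p)" by (simp only:)
    then show ?thesis by (simp only: powr_powr) simp
  qed
  have main: "X * (s powr p - z powr (- e) * t powr p)
      \<le> - (X * (z powr (- e) - z powr (- e / 2)) * t powr p) + l0 powr (1 - p) * d powr p"
  proof (cases "z = 1")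
    case True
    then show ?thesis using assms by (simp add: X_def)
  next
    case False
    \<comment> \<open>This weight makes the factor \<open>(1 - z) powr (p - 1)\<close> cancel the blow-up of \<open>l powr (1 - p)\<close>.\<close>
    define l where "l = l0 * (1 - z)"
    have z1: "0 < 1 - z" "1 - z < 1" using False z by auto
    have l: "0 < l" "l < 1"
      using l0 z1 mult_strict_mono[of l0 1 "1 - z" 1] by (auto simp: l_def)
    have "s powr p \<le> (t + d) powr p"
      by (rule powr_mono2) (use assms in \<open>auto simp: d_def\<close>)
    also have "\<dots> \<le> (1 - l) powr (1 - p) * t powr p + l powr (1 - p) * d powr p"
      by (rule powr_add_le_weighted) (use assms l in \<open>auto simp: d_def\<close>)
    also have "(1 - l) powr (1 - p) \<le> z powr (- e / 2)"
    proof -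
      have "z powr l0 \<le> 1 - l" using powr_le_affine[of z l0] z l0 by (simp add: l_def algebra_simps)
      then have "(1 - l) powr (1 - p) \<le> (z powr l0) powr (1 - p)"
        by (intro powr_mono2') (use assms z in auto)
      also have "l0 * (1 - p) = - e / 2" using assms(3) by (simp add: l0_def field_simps)
      then have "(z powr l0) powr (1 - p) = z powr (- e / 2)"
        by (simp only: powr_powr)
      finally show ?thesis .
    qed
    finally have "s powr p \<le> z powr (- e / 2) * t powr p + l powr (1 - p) * d powr p"
      by (simp add: mult_right_mono)
    then have "X * s powr p \<le> X * (z powr (- e / 2) * t powr p + l powr (1 - p) * d powr p)"
      by (intro mult_left_mono) (auto simp: X_def)
    moreover have "X * l powr (1 - p) = l0 powr (1 - p)"
      using z1 l0 by (simp add: X_def l_def powr_mult flip: powr_add)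
    then have "X * (z powr (- e / 2) * t powr p + l powr (1 - p) * d powr p)
        = X * (z powr (- e / 2) * t powr p) + l0 powr (1 - p) * d powr p"
      by (simp only: distrib_left mult.assoc[symmetric])
    ultimately have "X * s powr p \<le> X * (z powr (- e / 2) * t powr p) + l0 powr (1 - p) * d powr p"
      by simp
    then show ?thesis by (simp only: left_diff_distrib right_diff_distrib mult.assoc)
  qed
  \<comment> \<open>Write \<open>s - t * z powr (a / p)\<close> as
    \<open>t * (1 - z powr (a / p))\<close> plus \<open>s - t\<close>. The factor
    \<open>2 powr (p - 1)\<close> of this splitting, against the coefficient \<open>1 / 2\<close> in
    \<open>one_minus_powr_le\<close>, explains the constant \<open>2 powr (- p)\<close>.\<close>
  have "\<bar>s - t * z powr (a / p)\<bar> powr p \<le> (t * (1 - z powr (a / p)) + d) powr p"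
  proof (rule powr_mono2)
    have "z powr (a/p) \<le> 1" using powr_le1[of "a/p" z] z assms by auto
    then have "0 \<le> t * (1 - z powr (a / p))" using assms by auto
    then show "\<bar>s - t * z powr (a / p)\<bar> \<le> t * (1 - z powr (a / p)) + d"
      by (auto simp: d_def algebra_simps)
  qed (use assms in auto)
  also have "\<dots> \<le> 2 powr (p - 1) * ((t * (1 - z powr (a / p))) powr p + d powr p)"
    by (rule powr_add_le) (use assms z powr_le1[of "a/p" z] in \<open>auto simp: d_def\<close>)
  finally have "p * e * 2 powr (- p) * \<bar>s - t * z powr (a / p)\<bar> powr p \<le>
      p * e * 2 powr (- p) * (2 powr (p - 1) * ((t * (1 - z powr (a / p))) powr p + d powr p))"
    by (rule mult_left_mono) (use assms in auto)
  also have "\<dots> = t powr p * (p * e / 2 * (1 - z powr (a / p)) powr p) + p * e / 2 * d powr p"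
  proof -
    have m: "(t * (1 - z powr (a / p))) powr p = t powr p * (1 - z powr (a / p)) powr p"
      by (rule powr_mult)
    show ?thesis unfolding m by (simp add: powr_diff powr_minus_divide field_simps)
  qed
  also have "\<dots> \<le> t powr p * (a * (X * (z powr (- e) - z powr (- e / 2)))) + p * e / 2 * d powr p"
    unfolding X_def by (intro add_right_mono mult_left_mono one_minus_powr_le) (use assms z in auto)
  finally have 2: "p * e * 2 powr (- p) * \<bar>s - t * z powr (a / p)\<bar> powr p
     \<le> t powr p * (a * (X * (z powr (- e) - z powr (- e / 2)))) + p * e / 2 * d powr p" .
  have "a * (X * (s powr p - z powr (- e) * t powr p)) \<le>
    a * (- (X * (z powr (- e) - z powr (- e / 2)) * t powr p) + l0 powr (1 - p) * d powr p)"
    by (intro mult_left_mono main) (use assms in auto)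
  with 2 have "a * (X * (s powr p - z powr (- e) * t powr p)) \<le>
     - (p * e * 2 powr (- p)) * \<bar>s - t * z powr (a / p)\<bar> powr p + (p * e / 2 + a * l0 powr (1-p)) * d powr p"
    by (simp add: algebra_simps)
  then have "A powr a * (a * (X * (s powr p - z powr (- e) * t powr p))) \<le>
     A powr a * (- (p * e * 2 powr (- p)) * \<bar>s - t * z powr (a / p)\<bar> powr p + (p * e / 2 + a * l0 powr (1-p)) * d powr p)"
    by (rule mult_left_mono) auto
  also have "A powr a * (a * (X * (s powr p - z powr (- e) * t powr p)))
     = a * ((A - B) powr (p - 1) * (A powr (- e) * s powr p - B powr (- e) * t powr p))"
  proof -
    have "A - B = A * (1 - z)" "B = A * z" using A0 by (auto simp: z_def field_simps)
    then have "(A - B) powr (p - 1) = A powr (p - 1) * (1 - z) powr (p - 1)"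
      "B powr (- e) = A powr (- e) * z powr (- e)"
      by (simp_all only: powr_mult)
    moreover have "A powr a = A powr (p - 1) * A powr (- e)"
      using assms(6) by (simp flip: powr_add) (metis add_diff_cancel_right')
    ultimately show ?thesis by (simp only: X_def) (simp add: algebra_simps)
  qed
  also have "A powr a * (- (p * e * 2 powr (- p)) * \<bar>s - t * z powr (a / p)\<bar> powr p + (p * e / 2 + a * l0 powr (1-p)) * d powr p)
    = - (p * e * 2 powr (- p)) * \<bar>s * A powr (a / p) - t * B powr (a / p)\<bar> powr p
      + (p * e / 2 + a * (2 * (p - 1) / e) powr (p - 1)) * \<bar>s - t\<bar> powr p * A powr a"
  proof -
    have B: "B powr (a / p) = A powr (a / p) * z powr (a / p)"
      using A0 z by (simp add: z_def flip: powr_mult)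
    have "s * A powr (a / p) - t * B powr (a / p) = A powr (a / p) * (s - t * z powr (a / p))"
      by (simp add: B algebra_simps)
    then have "\<bar>s * A powr (a / p) - t * B powr (a / p)\<bar> powr p
       = A powr a * \<bar>s - t * z powr (a / p)\<bar> powr p"
      using assms by (simp add: abs_mult powr_mult powr_powr)
    then show ?thesis by (simp add: l0p d_def algebra_simps)
  qed
  finally show ?thesis .
qed

text \<open>\<open>iA\<close> and \<open>iB\<close> stand for the indicators of a ball outside of
  which the cutoff vanishes; they localise the error term. Beyond the ordered case an argument is
  needed only if the larger value sits outside the ball: then its cutoff value is 0, the left side
  is nonpositive, and the negative energy term is outweighed by the error term because
  \<open>p * e * 2 powr (- p) \<le> C\<close>.\<close>

lemma pointwise_energy:
  fixes A B p a e s t iA iB :: real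
  assumes "0 < A" "0 < B" "2 < p" "0 < a" "0 < e" "a + e = p - 1" "0 \<le> s" "0 \<le> t"
    and "iA \<in> {0, 1}" "iB \<in> {0, 1}" "iA = 0 \<Longrightarrow> s = 0" "iB = 0 \<Longrightarrow> t = 0"
  shows "a * (cdn p (A - B) * (A powr (- e) * s powr p - B powr (- e) * t powr p))
    \<le> - (p * e * 2 powr (- p)) * \<bar>s * A powr (a / p) - t * B powr (a / p)\<bar> powr p
      + (p * e / 2 + a * (2 * (p - 1) / e) powr (p - 1)) * \<bar>s - t\<bar> powr p
          * (iA * A powr a + iB * B powr a)"
proof -
  define C where "C = p * e / 2 + a * (2 * (p - 1) / e) powr (p - 1)"
  have C: "p * e * 2 powr (- p) \<le> C"
  proof -
    have "2 powr (- p) \<le> 2 powr (-1 :: real)" by (rule powr_mono) (use assms in auto)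
    then have "2 powr (-p) \<le> (1/2::real)" by (simp add: powr_minus)
    then have "p * e * 2 powr (- p) \<le> p * e * (1 / 2)"
      by (intro mult_left_mono) (use assms in auto)
    then show ?thesis using assms by (simp add: C_def add_increasing2)
  qed
  have C0: "0 \<le> C" by (rule order_trans[OF _ C]) (use assms in auto)
  have *: "a * ((A - B) powr (p - 1) * (A powr (- e) * s powr p - B powr (- e) * t powr p))
    \<le> - (p * e * 2 powr (- p)) * \<bar>s * A powr (a / p) - t * B powr (a / p)\<bar> powr p
      + C * \<bar>s - t\<bar> powr p * (iA * A powr a + iB * B powr a)"
    if "0 < B" "B \<le> A" "0 \<le> s" "0 \<le> t" "iA \<in> {0, 1}" "iB \<in> {0, 1}" "iA = 0 \<Longrightarrow> s = 0" "iB = 0 \<Longrightarrow> t = 0"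
    for A B s t iA iB :: real
  proof (cases "iA = 1")
    case True
    have "C * \<bar>s - t\<bar> powr p * A powr a \<le> C * \<bar>s - t\<bar> powr p * (iA * A powr a + iB * B powr a)"
      by (intro mult_left_mono) (use True that C0 in auto)
    with pointwise_energy_ordered[OF that(1,2) assms(3-6) that(3,4)] show ?thesis
      by (simp add: C_def)
  next
    case False
    then have [simp]: "iA = 0" "s = 0" using that by auto
    have "a * ((A - B) powr (p - 1) * (A powr (- e) * s powr p - B powr (- e) * t powr p)) \<le> 0"
      using assms that by (simp add: mult_nonneg_nonpos)
    moreover have "\<bar>s * A powr (a / p) - t * B powr (a / p)\<bar> powr p = t powr p * B powr a"
      using assms that by (simp add: abs_mult powr_mult powr_powr)
    moreover have "0 \<le> (C - p * e * 2 powr (- p)) * (t powr p * B powr a)"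
      using C by auto
    moreover have "C * \<bar>s - t\<bar> powr p * (iA * A powr a + iB * B powr a) = C * (t powr p * B powr a)"
      using that by (cases "t = 0") auto
    ultimately show ?thesis by (simp only: left_diff_distrib mult_minus_left)
  qed
  show ?thesis
  proof (cases "B \<le> A")
    case True
    then show ?thesis using *[of B A s t iA iB] assms by (simp add: cdn_nonneg C_def)
  next
    case False
    then have "cdn p (A - B) = - ((B - A) powr (p - 1))"
      using cdn_minus[of p "B - A"] by (simp add: cdn_nonneg)
    then show ?thesis using *[of A B t s iB iA] assms False
      by (simp add: C_def abs_minus_commute algebra_simps)
  qed
qed

section \<open>Truncated kernels and the fractional Nash inequality\<close>

lemma nn_integral_lborel_scale:
  fixes f :: "'a::euclidean_space \<Rightarrow> ennreal"
  assumes [measurable]: "f \<in> borel_measurable borel" and c: "c \<noteq> 0"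
  shows "(\<integral>\<^sup>+x. f x \<partial>lborel) = ennreal (\<bar>c\<bar> ^ DIM('a)) * (\<integral>\<^sup>+x. f (t + c *\<^sub>R x) \<partial>lborel)"
  by (subst lborel_affine[OF c, of t])
     (simp add: nn_integral_density nn_integral_distr nn_integral_cmult)

type_synonym 'n points = "(real ^ 'n) \<times> (real ^ 'n)"

text \<open>On the diagonal the quotient is 0 by the convention \<open>1 / 0 = 0\<close>, which lets
  kernel bounds be stated without exception.\<close>

definition fker :: "real \<Rightarrow> real \<Rightarrow> real ^ 'n \<Rightarrow> real" where
  "fker s p z = 1 / norm z powr (real CARD('n) + p * s)"

text \<open>At \<open>z = x - y\<close> a majorant of
  \<open>\<bar>\<eta> x - \<eta> y\<bar> powr p * fker s p (x - y)\<close> for a cutoff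
  \<open>\<eta>\<close> with values in [0, 1] and Lipschitz constant \<open>1 / d\<close>; the
  truncation makes it integrable near 0.\<close>

definition cutker :: "real \<Rightarrow> real \<Rightarrow> real \<Rightarrow> real ^ 'n \<Rightarrow> real" where
  "cutker s p d z = (min 1 (norm z / d)) powr p * fker s p z"

lemma fker_nonneg [simp]: "0 \<le> fker s p z" by (simp add: fker_def)
lemma cutker_nonneg [simp]: "0 \<le> cutker s p d z" by (simp add: cutker_def)

lemma fker_0 [simp]: "fker s p 0 = 0" by (simp add: fker_def)

lemma fker_minus: "fker s p (x - y) = fker s p (y - x)"
  by (simp add: fker_def norm_minus_commute)

lemma cutker_minus: "cutker s p d (x - y) = cutker s p d (y - x)"
  by (simp add: cutker_def fker_minus[of s p x] norm_minus_commute)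

lemma fker_measurable [measurable]: "fker s p \<in> borel_measurable borel"
  unfolding fker_def by measurable

lemma cutker_measurable [measurable]: "cutker s p d \<in> borel_measurable borel"
  unfolding cutker_def by measurable

lemma summable_powr_neg: 
  fixes a c :: real assumes "0 < a" shows "summable (\<lambda>k. c * 2 powr (- (real k * a)))"
proof -
  have "summable (\<lambda>k. c * (2 powr (- a)) ^ k)"
    by (intro summable_mult summable_geometric) (use assms powr_less_mono[of "-a" 0 "2::real"] in auto)
  also have "(\<lambda>k. c * (2 powr (- a)) ^ k) = (\<lambda>k. c * 2 powr (- (real k * a)))"
    by (intro ext) (simp add: powr_power mult.commute)
  finally show ?thesis .
qed

text \<open>The index \<open>k\<close> is the dyadic shell of \<open>z\<close>, counted outwards in
  the first alternative and inwards in the second. Near 0 the truncated kernel is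
  \<open>norm z powr (p - \<beta>)\<close> with an exponent of either sign; the factor
  \<open>2 powr \<bar>p - \<beta>\<bar>\<close> pays for evaluating it at the wrong end of a
  shell.\<close>

lemma cutker_1_le:
  fixes z :: "real ^ 'n"
  assumes "0 < s" "0 < p" "z \<noteq> 0"
  defines "\<beta> \<equiv> real CARD('n) + p * s"
  shows "\<exists>k. z \<in> ball 0 (2 powr (real k + 1)) \<and> cutker s p 1 z \<le> 2 powr (- (real k * \<beta>))
    \<or> z \<in> ball 0 (2 * 2 powr (- real k)) \<and> cutker s p 1 z \<le> 2 powr \<bar>p - \<beta>\<bar> * 2 powr (- (real k * (p - \<beta>)))"
proof (cases "1 \<le> norm z")
  case True
  define k where "k = nat \<lfloor>log 2 (norm z)\<rfloor>"
  have l0: "0 \<le> log 2 (norm z)" using True by (subst zero_le_log_cancel_iff) auto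
  have k: "real k \<le> log 2 (norm z)" "log 2 (norm z) < real k + 1"
    using l0 by (simp_all add: k_def)
  have "norm z < 2 powr (real k + 1)" using k(2) True by (subst (asm) log_less_iff) auto
  moreover have "2 powr real k \<le> norm z" using k(1) True by (subst (asm) le_log_iff) auto
  then have "(2 powr real k) powr \<beta> \<le> norm z powr \<beta>" by (intro powr_mono2) (use assms in auto)
  then have "cutker s p 1 z \<le> 1 / (2 powr real k) powr \<beta>"
    using True by (auto simp: cutker_def fker_def \<beta>_def[symmetric] intro!: divide_left_mono mult_pos_pos)
  ultimately show ?thesis by (auto intro!: exI[of _ k] simp: powr_powr powr_minus_divide)
next
  case False
  define k where "k = nat \<lfloor>- log 2 (norm z)\<rfloor>"
  have n0: "0 < norm z" using assms by auto
  have l0: "0 \<le> - log 2 (norm z)" using False n0 by auto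
  have k: "real k \<le> - log 2 (norm z)" "- log 2 (norm z) < real k + 1"
    using l0 by (simp_all add: k_def)
  have up: "norm z \<le> 2 powr (- real k)" using k(1) n0
    by (subst log_le_iff[symmetric]) auto
  have lo: "2 powr (- real k - 1) \<le> norm z" using k(2) n0
    by (subst le_log_iff[symmetric]) auto
  have "cutker s p 1 z = norm z powr (p - \<beta>)"
    using False n0 by (simp add: cutker_def fker_def \<beta>_def[symmetric] powr_diff)
  also have "\<dots> \<le> 2 powr \<bar>p - \<beta>\<bar> * 2 powr (- (real k * (p - \<beta>)))"
  proof (cases "0 \<le> p - \<beta>")
    case True
    have "norm z powr (p - \<beta>) \<le> (2 powr (- real k)) powr (p - \<beta>)"
      by (intro powr_mono2) (use up True in auto)
    also have "\<dots> \<le> 2 powr \<bar>p - \<beta>\<bar> * 2 powr (- (real k * (p - \<beta>)))"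
      using ge_one_powr_ge_zero[of 2 "\<bar>p - \<beta>\<bar>"] by (simp add: powr_powr)
    finally show ?thesis .
  next
    case False
    have "norm z powr (p - \<beta>) \<le> (2 powr (- real k - 1)) powr (p - \<beta>)"
      by (intro powr_mono2') (use lo False in auto)
    also have "\<dots> = 2 powr \<bar>p - \<beta>\<bar> * 2 powr (- (real k * (p - \<beta>)))"
      using False by (simp add: powr_powr flip: powr_add) (simp add: algebra_simps)
    finally show ?thesis .
  qed
  finally have "cutker s p 1 z \<le> 2 powr \<bar>p - \<beta>\<bar> * 2 powr (- (real k * (p - \<beta>)))" .
  moreover have "norm z < 2 * 2 powr (- real k)" using up
    by (smt (verit) powr_gt_zero)
  ultimately show ?thesis by auto
qed

text \<open>Summed over dyadic balls, the far part is a geometric series with ratio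
  \<open>2 powr (- (p * s))\<close> and the near part one with ratio
  \<open>2 powr (- (p * (1 - s)))\<close>; the two bounds on \<open>s\<close> make them
  converge.\<close>

lemma nn_integral_cutker_1_finite:
  assumes "0 < s" "s < 1" "0 < p"
  shows "(\<integral>\<^sup>+z. cutker s p 1 (z :: real ^ 'n) \<partial>lborel) < \<infinity>"
proof -
  define N where "N = CARD('n)"
  define \<omega> where "\<omega> = unit_ball_vol (real N)"
  define \<beta> where "\<beta> = real N + p * s"
  define g1 g2 :: "nat \<Rightarrow> real ^ 'n \<Rightarrow> real" where
    "g1 = (\<lambda>k z. 2 powr (- (real k * \<beta>)) * indicator (ball 0 (2 powr (real k + 1))) z)" and
    "g2 = (\<lambda>k z. 2 powr \<bar>p - \<beta>\<bar> * 2 powr (- (real k * (p - \<beta>))) * indicator (ball 0 (2 * 2 powr (- real k))) z)"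
  have g_nonneg: "0 \<le> g1 k z" "0 \<le> g2 k z" for k z by (auto simp: g1_def g2_def)
  have [measurable]: "g1 k \<in> borel_measurable borel" "g2 k \<in> borel_measurable borel" for k
    unfolding g1_def g2_def
    by (rule borel_measurable_times[OF borel_measurable_const borel_measurable_indicator], simp)+
  have pw: "ennreal (cutker s p 1 z) \<le> (\<Sum>k. ennreal (g1 k z + g2 k z))" for z :: "real ^ 'n"
  proof (cases "z = 0")
    case False
    from cutker_1_le[of s p z] False assms obtain k where
      "z \<in> ball 0 (2 powr (real k + 1)) \<and> cutker s p 1 z \<le> 2 powr (- (real k * \<beta>))
    \<or> z \<in> ball 0 (2 * 2 powr (- real k)) \<and> cutker s p 1 z \<le> 2 powr \<bar>p - \<beta>\<bar> * 2 powr (- (real k * (p - \<beta>)))"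
      by (auto simp: \<beta>_def N_def)
    then have "cutker s p 1 z \<le> g1 k z \<or> cutker s p 1 z \<le> g2 k z"
      by (auto simp: g1_def g2_def)
    then have "cutker s p 1 z \<le> g1 k z + g2 k z" using g_nonneg[of k z] by linarith
    then have "ennreal (cutker s p 1 z) \<le> ennreal (g1 k z + g2 k z)" by (rule ennreal_leI)
    also have "\<dots> \<le> (\<Sum>k. ennreal (g1 k z + g2 k z))"
      using sum_le_suminf[of "\<lambda>k. ennreal (g1 k z + g2 k z)" "{k}"] by simp
    finally show ?thesis .
  qed (simp add: cutker_def)
  define c1 c2 where "c1 = \<omega> * 2 ^ N" and "c2 = 2 powr \<bar>p - \<beta>\<bar> * \<omega> * 2 ^ N"
  have om: "0 \<le> \<omega>" by (simp add: \<omega>_def)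
  have I1: "(\<integral>\<^sup>+z. g1 k z \<partial>lborel) = ennreal (c1 * 2 powr (- (real k * (p * s))))" for k
  proof -
    have "(\<integral>\<^sup>+z. g1 k z \<partial>lborel) = ennreal (2 powr (- (real k * \<beta>))) * emeasure lborel (ball (0 :: real ^ 'n) (2 powr (real k + 1)))"
      unfolding g1_def by (simp add: ennreal_mult' nn_integral_cmult_indicator ennreal_indicator)
    also have "\<dots> = ennreal (2 powr (- (real k * \<beta>)) * (\<omega> * (2 powr (real k + 1)) ^ N))"
      by (subst emeasure_ball) (simp_all add: \<omega>_def N_def ennreal_mult')
    also have "2 powr (- (real k * \<beta>)) * (\<omega> * (2 powr (real k + 1)) ^ N) = c1 * 2 powr (- (real k * (p * s)))"
    proof -
      have "2 powr (- (real k * \<beta>)) * (2 powr (real k + 1)) ^ N = 2 powr (real N) * 2 powr (- (real k * (p * s)))"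
        by (simp add: powr_power \<beta>_def algebra_simps flip: powr_add)
      then show ?thesis by (simp add: c1_def powr_realpow)
    qed
    finally show ?thesis .
  qed
  have I2: "(\<integral>\<^sup>+z. g2 k z \<partial>lborel) = ennreal (c2 * 2 powr (- (real k * (p * (1 - s)))))" for k
  proof -
    have "(\<integral>\<^sup>+z. g2 k z \<partial>lborel) = ennreal (2 powr \<bar>p - \<beta>\<bar> * 2 powr (- (real k * (p - \<beta>)))) * emeasure lborel (ball (0 :: real ^ 'n) (2 * 2 powr (- real k)))"
      unfolding g2_def by (simp add: ennreal_mult' nn_integral_cmult_indicator ennreal_indicator)
    also have "\<dots> = ennreal (2 powr \<bar>p - \<beta>\<bar> * 2 powr (- (real k * (p - \<beta>))) * (\<omega> * (2 * 2 powr (- real k)) ^ N))"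
      by (subst emeasure_ball) (simp_all add: \<omega>_def N_def ennreal_mult')
    also have "2 powr \<bar>p - \<beta>\<bar> * 2 powr (- (real k * (p - \<beta>))) * (\<omega> * (2 * 2 powr (- real k)) ^ N) = c2 * 2 powr (- (real k * (p * (1 - s))))"
    proof -
      have "2 powr (- (real k * (p - \<beta>))) * (2 powr (- real k)) ^ N = 2 powr (- (real k * (p * (1 - s))))"
        by (simp add: powr_power \<beta>_def flip: powr_add) (simp add: algebra_simps)
      then show ?thesis by (simp add: c2_def power_mult_distrib)
    qed
    finally show ?thesis .
  qed
  have "(\<integral>\<^sup>+z. cutker s p 1 (z :: real ^ 'n) \<partial>lborel) \<le> (\<integral>\<^sup>+z. (\<Sum>k. ennreal (g1 k z + g2 k z)) \<partial>lborel)"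
    by (intro nn_integral_mono pw)
  also have "\<dots> = (\<Sum>k. \<integral>\<^sup>+z. ennreal (g1 k z + g2 k z) \<partial>lborel)"
    by (rule nn_integral_suminf) measurable
  also have "\<dots> = (\<Sum>k. ennreal (c1 * 2 powr (- (real k * (p * s))) + c2 * 2 powr (- (real k * (p * (1 - s))))))"
    using g_nonneg om by (simp add: ennreal_plus nn_integral_add I1 I2 c1_def c2_def)
  also have "\<dots> < \<infinity>"
  proof -
    have "summable (\<lambda>k. c1 * 2 powr (- (real k * (p * s))) + c2 * 2 powr (- (real k * (p * (1 - s)))))"
      by (intro summable_add summable_powr_neg) (use assms in auto)
    then show ?thesis using om
      by (subst suminf_ennreal2) (auto simp: c1_def c2_def)
  qed
  finally show ?thesis .
qed

text \<open>The dimension enters only through the type, hence the type token.\<close>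

definition cutker_const :: "'n::finite itself \<Rightarrow> real \<Rightarrow> real \<Rightarrow> real" where
  "cutker_const _ s p = enn2real (\<integral>\<^sup>+z. cutker s p 1 (z :: real ^ 'n) \<partial>lborel)"

text \<open>Substituting \<open>y = x - d * z\<close> turns the kernel at scale \<open>d\<close>
  into \<open>d powr (- (n + p * s))\<close> times the one at scale 1, and the Jacobian
  \<open>d ^ n\<close> leaves \<open>d powr (- (p * s))\<close>.\<close>

lemma nn_integral_cutker:
  fixes x :: "real ^ 'n"
  assumes "0 < s" "s < 1" "0 < p" "0 < d"
  shows "(\<integral>\<^sup>+y. cutker s p d (x - y) \<partial>lborel) = ennreal (cutker_const TYPE('n) s p * d powr (- (p * s)))"
proof -
  have "(\<integral>\<^sup>+y. cutker s p d (x - y) \<partial>lborel) = \<bar>- d\<bar> ^ DIM(real ^ 'n) * (\<integral>\<^sup>+z. cutker s p d (x - (x + (- d) *\<^sub>R z)) \<partial>lborel)"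
    using nn_integral_lborel_scale[of "\<lambda>y. ennreal (cutker s p d (x - y))" "- d" x] assms
    by simp
  also have "(\<lambda>z :: real ^ 'n. cutker s p d (x - (x + (- d) *\<^sub>R z))) = (\<lambda>z. d powr (- (real CARD('n) + p * s)) * cutker s p 1 z)"
    using assms by (intro ext) (simp add: cutker_def fker_def powr_mult powr_minus_divide powr_diff powr_add)
  also have "\<bar>- d\<bar> ^ DIM(real ^ 'n) * (\<integral>\<^sup>+z. ennreal (d powr (- (real CARD('n) + p * s)) * cutker s p 1 (z :: real ^ 'n)) \<partial>lborel)
    = \<bar>- d\<bar> ^ DIM(real ^ 'n) * (ennreal (d powr (- (real CARD('n) + p * s))) * ennreal (cutker_const TYPE('n) s p))"
    using nn_integral_cutker_1_finite[where 'n='n, OF assms(1-3)]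
    by (simp add: ennreal_mult' nn_integral_cmult cutker_const_def)
  also have "\<dots> = ennreal (\<bar>- d\<bar> ^ DIM(real ^ 'n) * (d powr (- (real CARD('n) + p * s)) * cutker_const TYPE('n) s p))"
    using assms by (simp add: ennreal_mult' cutker_const_def)
  also have "\<bar>- d\<bar> ^ DIM(real ^ 'n) * (d powr (- (real CARD('n) + p * s)) * cutker_const TYPE('n) s p) = cutker_const TYPE('n) s p * d powr (- (p * s))"
  proof -
    have "d ^ CARD('n) = d powr real CARD('n)" using assms by (simp add: powr_realpow)
    then have "d ^ CARD('n) * d powr (- (real CARD('n) + p * s)) = d powr (- (p * s))"
      by (simp flip: powr_add)
    then show ?thesis using assms by simp
  qed
  finally show ?thesis .
qed

text \<open>Compare \<open>v x\<close> with \<open>v y\<close> for \<open>y\<close> in a ball of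
  radius \<open>R\<close> around \<open>x\<close>, where the kernel is at least
  \<open>R powr (- \<beta>)\<close>, and integrate over the ball. For the chosen \<open>R\<close>
  the term with \<open>v y\<close> takes up at most half of the left side and is absorbed; solving
  for \<open>\<bar>v x\<bar>\<close> gives the inequality.\<close>

lemma pointwise_nash:
  fixes v :: "real ^ 'n \<Rightarrow> real"
  assumes v[measurable]: "v \<in> borel_measurable borel" and "0 < s" "1 \<le> p" "0 < S"
    and S: "(\<integral>\<^sup>+y. \<bar>v y\<bar> powr p \<partial>lborel) \<le> ennreal S"
  defines "\<omega> \<equiv> unit_ball_vol (real CARD('n))" and "K \<equiv> 1 + p * s / real CARD('n)"
  shows "ennreal (\<bar>v x\<bar> powr (p * K)) \<le> ennreal ((2 powr p / \<omega>) powr K * S powr (K - 1))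
     * (\<integral>\<^sup>+y. \<bar>v x - v y\<bar> powr p * fker s p (x - y) \<partial>lborel)"
\<comment> \<open>If the integral is infinite, so is the right side, because its coefficient is
  positive.\<close>
proof (cases "v x = 0 \<or> (\<integral>\<^sup>+y. \<bar>v x - v y\<bar> powr p * fker s p (x - y) \<partial>lborel) = \<infinity>")
  case True
  have "0 < \<omega>" by (simp add: \<omega>_def)
  then have "(2 powr p / \<omega>) powr K * S powr (K - 1) \<noteq> 0" using assms(4) by simp
  then show ?thesis using True by (auto simp: ennreal_mult_eq_top_iff ennreal_top_mult ennreal_mult_top)
next
  case False
  define n where "n = real CARD('n)"
  define \<beta> where "\<beta> = n + p * s"
  have n: "0 < n" by (simp add: n_def)
  have om: "0 < \<omega>" by (simp add: \<omega>_def)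
  define V where "V = \<bar>v x\<bar> powr p"
  have V: "0 < V" using False by (simp add: V_def)
  obtain D where D: "0 \<le> D" "(\<integral>\<^sup>+y. \<bar>v x - v y\<bar> powr p * fker s p (x - y) \<partial>lborel) = ennreal D"
    using False by (cases "\<integral>\<^sup>+y. \<bar>v x - v y\<bar> powr p * fker s p (x - y) \<partial>lborel") auto
  \<comment> \<open>The radius \<open>R\<close> is chosen such that \<open>V * measure (ball x R) = 2 powr p * S\<close>.\<close>
  define q where "q = 2 powr p * S / (\<omega> * V)"
  have q: "0 < q" using om V assms by (simp add: q_def)
  define R where "R = q powr (1 / n)"
  have R: "0 < R" using q by (simp add: R_def)
  have Rn: "R ^ CARD('n) = q" using q n by (simp add: R_def n_def powr_powr flip: powr_realpow)
  have Rb: "R powr \<beta> = q powr K"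
    using n by (simp add: R_def powr_powr K_def \<beta>_def n_def add_divide_distrib)
  have pw: "V * indicator (ball x R) y \<le>
      2 powr (p - 1) * (R powr \<beta> * (\<bar>v x - v y\<bar> powr p * fker s p (x - y)) + \<bar>v y\<bar> powr p)" for y
  proof (cases "y \<in> ball x R")
    case True
    have "V \<le> (\<bar>v x - v y\<bar> + \<bar>v y\<bar>) powr p"
      unfolding V_def by (rule powr_mono2) (use assms in auto)
    also have "\<dots> \<le> 2 powr (p - 1) * (\<bar>v x - v y\<bar> powr p + \<bar>v y\<bar> powr p)"
      by (rule powr_add_le) (use assms in auto)
    also have "\<dots> \<le> 2 powr (p - 1) * (R powr \<beta> * (\<bar>v x - v y\<bar> powr p * fker s p (x - y)) + \<bar>v y\<bar> powr p)"
    proof (cases "x = y")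
      case False
      have "norm (x - y) powr \<beta> \<le> R powr \<beta>"
        by (rule powr_mono2) (use True assms n in \<open>auto simp: \<beta>_def dist_norm\<close>)
      then have "1 \<le> R powr \<beta> * fker s p (x - y)"
        using False by (simp add: fker_def \<beta>_def[unfolded n_def, symmetric])
      then have "\<bar>v x - v y\<bar> powr p * 1 \<le> \<bar>v x - v y\<bar> powr p * (R powr \<beta> * fker s p (x - y))"
        by (rule mult_left_mono) auto
      then show ?thesis by (simp add: mult_ac)
    qed simp
    finally show ?thesis using True by simp
  qed (auto intro!: mult_nonneg_nonneg add_nonneg_nonneg)
  have "ennreal (2 powr p * S) = ennreal (V * (\<omega> * R ^ CARD('n)))"
    using om V by (simp add: Rn q_def)
  also have "\<dots> = ennreal V * emeasure lborel (ball x R)"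
    using V R by (subst emeasure_ball) (simp_all add: \<omega>_def ennreal_mult')
  also have "\<dots> = (\<integral>\<^sup>+y. ennreal (V * indicator (ball x R) y) \<partial>lborel)"
    using V by (simp add: ennreal_mult' nn_integral_cmult_indicator ennreal_indicator)
  also have "\<dots> \<le> (\<integral>\<^sup>+y. ennreal (2 powr (p - 1) * (R powr \<beta> * (\<bar>v x - v y\<bar> powr p * fker s p (x - y)) + \<bar>v y\<bar> powr p)) \<partial>lborel)"
    by (intro nn_integral_mono ennreal_leI pw)
  also have "\<dots> = ennreal (2 powr (p - 1)) * (ennreal (R powr \<beta>) * ennreal D + (\<integral>\<^sup>+y. \<bar>v y\<bar> powr p \<partial>lborel))"
    by (simp add: ennreal_mult' ennreal_plus nn_integral_cmult nn_integral_add D(2)[symmetric])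
  also have "\<dots> \<le> ennreal (2 powr (p - 1)) * (ennreal (R powr \<beta>) * ennreal D + ennreal S)"
    by (intro mult_left_mono add_left_mono S) auto
  also have "\<dots> = ennreal (2 powr (p - 1) * (R powr \<beta> * D + S))"
    using D assms by (simp add: ennreal_mult' ennreal_plus)
  finally have "2 powr p * S \<le> 2 powr (p - 1) * (R powr \<beta> * D + S)"
    using D assms by (subst (asm) ennreal_le_iff) auto
  then have "S \<le> q powr K * D" by (simp add: powr_diff Rb)
  also have "\<dots> = (2 powr p / \<omega>) powr K * S powr K / V powr K * D"
    using om V assms by (simp add: q_def powr_mult powr_divide)
  also have "S powr K = S powr (K - 1) * S" using assms(4) by (simp add: powr_diff)
  finally have "S * V powr K \<le> S * ((2 powr p / \<omega>) powr K * S powr (K - 1) * D)"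
    using V by (simp add: field_simps)
  then have "V powr K \<le> (2 powr p / \<omega>) powr K * S powr (K - 1) * D"
    using assms(4) by (simp only: mult_le_cancel_left_pos)
  also have "V powr K = \<bar>v x\<bar> powr (p * K)" by (simp add: V_def powr_powr)
  finally show ?thesis
    unfolding D(2) using D(1) by (simp add: ennreal_mult'[symmetric])
qed

section \<open>Continuity of translations in L1 of an interval\<close>

lemma integrable_indicator_Icc [simp]: "integrable lborel (indicator {l..u :: real} :: real \<Rightarrow> real)"
  by (rule integrable_real_indicator) (auto simp: emeasure_lborel_Icc_eq)

text \<open>For bounded continuous functions this is dominated convergence, and a measurable
  \<open>g\<close> is an almost everywhere limit of continuous functions. Both
  \<open>g (t + h) - c n (t + h)\<close> and \<open>g t - c n t\<close> are controlled by a single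
  L1 error on the interval enlarged by 1, as soon as \<open>h < 1\<close>.\<close>

lemma translation_L1_tendsto:
  fixes g :: "real \<Rightarrow> real"
  assumes g[measurable]: "g \<in> borel_measurable borel" and B: "\<And>t. \<bar>g t\<bar> \<le> B"
  shows "((\<lambda>h. LINT t:{a..b}|lborel. \<bar>g (t + h) - g t\<bar>) \<longlongrightarrow> 0) (at_right 0)"
proof (rule tendstoI)
  fix e :: real assume e: "0 < e"
  define I where "I = {a - 1..b + 1}"
  have "g \<in> borel_measurable (lebesgue_on UNIV)" using g
    by (simp add: lebesgue_on_UNIV_eq measurable_completion)
  then have "g measurable_on UNIV" by (subst measurable_on_iff_borel_measurable) auto
  then obtain N c0 where N: "negligible N" "\<And>n. continuous_on UNIV (c0 n)"
    "\<And>x. x \<notin> N \<Longrightarrow> (\<lambda>n. c0 n x) \<longlonglongrightarrow> g x"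
    by (auto simp: measurable_on_def)
  \<comment> \<open>Clamping to \<open>[- B, B]\<close> keeps the limit \<open>g\<close> and
    provides an integrable majorant.\<close>
  define c where "c n x = max (- B) (min B (c0 n x))" for n x
  have c_cont: "continuous_on UNIV (c n)" for n
    unfolding c_def by (intro continuous_intros N)
  have cB: "\<bar>c n x\<bar> \<le> \<bar>B\<bar>" for n x using B[of 0] by (auto simp: c_def)
  have [measurable]: "c n \<in> borel_measurable borel" for n
    using c_cont by (rule borel_measurable_continuous_onI)
  have AEc: "AE x in lborel. (\<lambda>n. c n x) \<longlonglongrightarrow> g x"
  proof -
    have "N \<in> null_sets lebesgue" using N(1) by (simp add: negligible_iff_null_sets)
    then have "AE x in lebesgue. x \<notin> N" by (rule AE_not_in)
    then have "AE x in lborel. x \<notin> N" by (simp add: AE_completion_iff)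
    then show ?thesis
    proof eventually_elim
      case (elim x)
      have "(\<lambda>n. c n x) \<longlonglongrightarrow> max (- B) (min B (g x))"
        unfolding c_def by (intro tendsto_intros N elim)
      then show ?case using B[of x] by (auto simp: abs_le_iff max_def min_def split: if_splits)
    qed
  qed
  have fin: "integrable lborel (\<lambda>x. indicator {l..u} x * \<bar>f x\<bar>)"
    if "f \<in> borel_measurable borel" "\<And>x. \<bar>f x\<bar> \<le> M" for f :: "real \<Rightarrow> real" and M l u
  proof (rule Bochner_Integration.integrable_bound)
    show "integrable lborel (\<lambda>x. indicator {l..u} x * M :: real)" by simp
    show "AE x in lborel. norm (indicator {l..u} x * \<bar>f x\<bar>) \<le> norm (indicator {l..u} x * M)"
      using that(2) by (auto simp: indicator_def intro!: AE_I2 order_trans[OF that(2)])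
  qed (use that in measurable)
  have "(\<lambda>n. \<integral>x. indicator I x * \<bar>g x - c n x\<bar> \<partial>lborel) \<longlonglongrightarrow> (\<integral>x. 0 \<partial>(lborel :: real measure))"
  proof (rule integral_dominated_convergence[where w = "\<lambda>x. indicator I x * (2 * \<bar>B\<bar>)"])
    show "AE x in lborel. (\<lambda>n. indicator I x * \<bar>g x - c n x\<bar>) \<longlonglongrightarrow> 0"
      using AEc
    proof eventually_elim
      case (elim x)
      have "(\<lambda>n. indicator I x * \<bar>g x - c n x\<bar>) \<longlonglongrightarrow> indicator I x * \<bar>g x - g x\<bar>"
        by (intro tendsto_intros elim)
      then show ?case by simp
    qed
    show "AE x in lborel. norm (indicator I x * \<bar>g x - c n x\<bar>) \<le> indicator I x * (2 * \<bar>B\<bar>)" for n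
    proof (intro AE_I2)
      fix x show "norm (indicator I x * \<bar>g x - c n x\<bar>) \<le> indicator I x * (2 * \<bar>B\<bar>)"
        using B[of x] cB[of n x] by (auto simp: indicator_def)
    qed
  qed (auto simp: I_def)
  then have "(\<lambda>n. \<integral>x. indicator I x * \<bar>g x - c n x\<bar> \<partial>lborel) \<longlonglongrightarrow> 0" by simp
  then have "eventually (\<lambda>n. (\<integral>x. indicator I x * \<bar>g x - c n x\<bar> \<partial>lborel) < e / 3) sequentially"
    by (rule order_tendstoD) (use e in simp)
  then obtain n where n: "(\<integral>x. indicator I x * \<bar>g x - c n x\<bar> \<partial>lborel) < e / 3"
    by (auto simp: eventually_sequentially)
  have "((\<lambda>h. \<integral>t. indicator {a..b} t * \<bar>c n (t + h) - c n t\<bar> \<partial>lborel) \<longlongrightarrow> 0) (at_right 0)"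
    unfolding tendsto_at_iff_sequentially o_def
  proof (intro allI impI)
    fix X :: "nat \<Rightarrow> real" assume X: "X \<longlonglongrightarrow> 0"
    have "(\<lambda>i. \<integral>t. indicator {a..b} t * \<bar>c n (t + X i) - c n t\<bar> \<partial>lborel) \<longlonglongrightarrow> (\<integral>x. 0 \<partial>(lborel :: real measure))"
    proof (rule integral_dominated_convergence[where w = "\<lambda>x. indicator {a..b} x * (2 * \<bar>B\<bar>)"])
      show "AE t in lborel. (\<lambda>i. indicator {a..b} t * \<bar>c n (t + X i) - c n t\<bar>) \<longlonglongrightarrow> 0"
      proof (intro AE_I2)
        fix t :: real
        have "isCont (c n) (t + 0)" using c_cont by (simp add: continuous_on_eq_continuous_at)
        then have "(\<lambda>i. c n (t + X i)) \<longlonglongrightarrow> c n (t + 0)"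
          by (rule isCont_tendsto_compose) (intro tendsto_intros X)
        then have "(\<lambda>i. indicator {a..b} t * \<bar>c n (t + X i) - c n t\<bar>) \<longlonglongrightarrow> indicator {a..b} t * \<bar>c n t - c n t\<bar>"
          by (intro tendsto_intros) simp
        then show "(\<lambda>i. indicator {a..b} t * \<bar>c n (t + X i) - c n t\<bar>) \<longlonglongrightarrow> 0" by simp
      qed
      show "AE t in lborel. norm (indicator {a..b} t * \<bar>c n (t + X i) - c n t\<bar>) \<le> indicator {a..b} t * (2 * \<bar>B\<bar>)" for i
      proof (intro AE_I2)
        fix t show "norm (indicator {a..b} t * \<bar>c n (t + X i) - c n t\<bar>) \<le> indicator {a..b} t * (2 * \<bar>B\<bar>)"
          using cB[of n t] cB[of n "t + X i"] by (auto simp: indicator_def)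
      qed
    qed auto
    then show "(\<lambda>i. \<integral>t. indicator {a..b} t * \<bar>c n (t + X i) - c n t\<bar> \<partial>lborel) \<longlonglongrightarrow> 0" by simp
  qed
  then have ev: "eventually (\<lambda>h. (\<integral>t. indicator {a..b} t * \<bar>c n (t + h) - c n t\<bar> \<partial>lborel) < e / 3) (at_right 0)"
    by (rule order_tendstoD) (use e in simp)
  have "eventually (\<lambda>h::real. 0 < h \<and> h < 1) (at_right 0)"
    by (auto simp: eventually_at_right_field intro!: exI[of _ 1])
  with ev show "eventually (\<lambda>h. dist (LINT t:{a..b}|lborel. \<bar>g (t + h) - g t\<bar>) 0 < e) (at_right 0)"
  proof eventually_elim
    case (elim h)
    have gc: "\<bar>g x - c n x\<bar> \<le> 2 * \<bar>B\<bar>" for x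
      using B[of x] cB[of n x] by linarith
    have gg: "\<bar>g (x + h) - g x\<bar> \<le> 2 * \<bar>B\<bar>" for x
      using B[of x] B[of "x + h"] by linarith
    have cc: "\<bar>c n (x + h) - c n x\<bar> \<le> 2 * \<bar>B\<bar>" for x
      using cB[of n x] cB[of n "x + h"] by linarith
    note ints = fin[where M = "2 * \<bar>B\<bar>", of "\<lambda>x. g (x + h) - c n (x + h)"] fin[where M = "2 * \<bar>B\<bar>", of "\<lambda>x. g x - c n x"]
      fin[where M = "2 * \<bar>B\<bar>", of "\<lambda>x. c n (x + h) - c n x"]
    have "(LINT t:{a..b}|lborel. \<bar>g (t + h) - g t\<bar>) \<le> (\<integral>t. indicator {a..b} t * \<bar>g (t + h) - c n (t + h)\<bar>
        + indicator {a..b} t * \<bar>c n (t + h) - c n t\<bar> + indicator {a..b} t * \<bar>g t - c n t\<bar> \<partial>lborel)"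
      unfolding set_lebesgue_integral_def
    proof (intro integral_mono Bochner_Integration.integrable_add)
      show "integrable lborel (\<lambda>t. indicat_real {a..b} t *\<^sub>R \<bar>g (t + h) - g t\<bar>)"
        using fin[of "\<lambda>t. g (t + h) - g t" "2 * \<bar>B\<bar>" a b] gg by simp
      show "integrable lborel (\<lambda>t. indicator {a..b} t * \<bar>g (t + h) - c n (t + h)\<bar>)"
        by (rule fin[where M = "2 * \<bar>B\<bar>"]) (use gc in auto)
      show "integrable lborel (\<lambda>t. indicator {a..b} t * \<bar>g t - c n t\<bar>)"
        by (rule fin[where M = "2 * \<bar>B\<bar>"]) (use gc in auto)
      show "integrable lborel (\<lambda>t. indicator {a..b} t * \<bar>c n (t + h) - c n t\<bar>)"
        by (rule fin[where M = "2 * \<bar>B\<bar>"]) (use cc in auto)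
    qed (auto simp: indicator_def)
    also have "\<dots> = (\<integral>t. indicator {a..b} t * \<bar>g (t + h) - c n (t + h)\<bar> \<partial>lborel)
        + (\<integral>t. indicator {a..b} t * \<bar>c n (t + h) - c n t\<bar> \<partial>lborel) + (\<integral>t. indicator {a..b} t * \<bar>g t - c n t\<bar> \<partial>lborel)"
      using ints[of a b] gc cc by simp
    also have "(\<integral>t. indicator {a..b} t * \<bar>g (t + h) - c n (t + h)\<bar> \<partial>lborel)
        = (\<integral>t. indicator {a + h..b + h} t * \<bar>g t - c n t\<bar> \<partial>lborel)"
      by (subst lborel_integral_real_affine[of 1 _ h]) (auto simp: indicator_def add.commute intro!: Bochner_Integration.integral_cong)
    also have "\<dots> \<le> (\<integral>t. indicator I t * \<bar>g t - c n t\<bar> \<partial>lborel)"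
      unfolding I_def by (intro integral_mono fin[where M = "2 * \<bar>B\<bar>"])
         (use elim gc in \<open>auto simp: I_def indicator_def\<close>)
    also have "(\<integral>t. indicator {a..b} t * \<bar>g t - c n t\<bar> \<partial>lborel) \<le> (\<integral>t. indicator I t * \<bar>g t - c n t\<bar> \<partial>lborel)"
      unfolding I_def by (intro integral_mono fin[where M = "2 * \<bar>B\<bar>"])
         (use elim gc in \<open>auto simp: I_def indicator_def\<close>)
    finally have "(LINT t:{a..b}|lborel. \<bar>g (t + h) - g t\<bar>) < e" using n elim by linarith
    moreover have "0 \<le> (LINT t:{a..b}|lborel. \<bar>g (t + h) - g t\<bar>)"
      unfolding set_lebesgue_integral_def by (intro integral_nonneg_AE) auto
    ultimately show ?case by simp
  qed
qed

section \<open>Steklov averages\<close>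

lemma set_integrable_Icc_bounded:
  fixes f :: "real \<Rightarrow> real"
  assumes "f \<in> borel_measurable borel" "\<And>x. \<bar>f x\<bar> \<le> B"
  shows "set_integrable lborel {a..b} f"
  unfolding set_integrable_def
proof (rule Bochner_Integration.integrable_bound)
  show "integrable lborel (\<lambda>x. indicator {a..b} x * B :: real)" by simp
  show "AE x in lborel. norm (indicator {a..b} x *\<^sub>R f x) \<le> norm (indicator {a..b} x * B)"
    using assms(2) by (auto simp: indicator_def intro!: AE_I2 order_trans[OF assms(2)])
qed (use assms in measurable)

lemma set_integral_Icc_const: "a \<le> b \<Longrightarrow> (LINT x:{a..b :: real}|lborel. c) = (b - a) * (c :: real)"
  by (simp add: set_lebesgue_integral_def)

lemma set_integral_Icc_bound:
  fixes f :: "real \<Rightarrow> real"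
  assumes f: "f \<in> borel_measurable borel" "\<And>x. \<bar>f x\<bar> \<le> B" and "a \<le> b"
  shows "\<bar>LINT x:{a..b}|lborel. f x\<bar> \<le> (b - a) * B"
proof -
  have "\<bar>LINT x:{a..b}|lborel. f x\<bar> \<le> (LINT x:{a..b}|lborel. \<bar>f x\<bar>)"
    using set_integral_norm_bound[OF set_integrable_Icc_bounded[OF f]] by simp
  also have "\<dots> \<le> (LINT x:{a..b}|lborel. B)"
    by (intro set_integral_mono set_integrable_Icc_bounded[where B = B]) (use f in auto, smt (verit) f(2))
  also have "\<dots> = (b - a) * B" using assms by (simp add: set_integral_Icc_const)
  finally show ?thesis .
qed

lemma set_integral_shift:
  fixes f :: "real \<Rightarrow> real"
  shows "(LINT x:{a..b}|lborel. f (x + c)) = (LINT x:{a + c..b + c}|lborel. f x)"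
  unfolding set_lebesgue_integral_def
  by (subst (2) lborel_integral_real_affine[of 1 _ c])
     (auto simp: indicator_def add.commute intro!: Bochner_Integration.integral_cong)

lemma set_integral_rectangle_swap:
  fixes G :: "real \<Rightarrow> real \<Rightarrow> real"
  assumes G[measurable]: "case_prod G \<in> borel_measurable borel" and B: "\<And>t s. \<bar>G t s\<bar> \<le> B"
  shows "(LINT t:{a..b}|lborel. LINT s:{c..d}|lborel. G t s) = (LINT s:{c..d}|lborel. LINT t:{a..b}|lborel. G t s)"
proof -
  have [measurable]: "case_prod G \<in> borel_measurable (lborel \<Otimes>\<^sub>M lborel)"
    using G by (simp add: borel_prod lborel_prod)
  have "integrable (lborel \<Otimes>\<^sub>M lborel) (\<lambda>(t, s). indicator {a..b} t * (indicator {c..d} s * G t s))"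
  proof (rule Bochner_Integration.integrable_bound)
    have "integrable (lborel \<Otimes>\<^sub>M lborel) (indicator ({a..b} \<times> {c..d}) :: real \<times> real \<Rightarrow> real)"
      by (rule integrable_real_indicator)
         (auto simp: emeasure_lborel_Icc_eq lborel.emeasure_pair_measure_Times ennreal_mult_less_top)
    then show "integrable (lborel \<Otimes>\<^sub>M lborel) (\<lambda>z. indicator ({a..b} \<times> {c..d}) z * B :: real)"
      by simp
    show "AE z in lborel \<Otimes>\<^sub>M lborel. norm (case z of (t, s) \<Rightarrow> indicator {a..b} t * (indicator {c..d} s * G t s))
        \<le> norm (indicator ({a..b} \<times> {c..d}) z * B)"
      using B by (auto simp: indicator_def intro!: AE_I2 order_trans[OF B])
  qed measurable
  from lborel_pair.Fubini_integral[OF this] show ?thesis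
    by (simp add: set_lebesgue_integral_def mult.left_commute flip: Bochner_Integration.integral_mult_right_zero)
qed

text \<open>The error of a Steklov average is the mean over \<open>u\<close> in
  \<open>[0, h]\<close> of the translation errors \<open>g (t + u) - g t\<close>. Exchanging the
  integrals bounds its L1 norm by the mean of the translation modulus \<open>om u\<close>, which is
  small for \<open>u < \<delta>\<close>.\<close>

lemma steklov_L1_tendsto:
  fixes g :: "real \<Rightarrow> real"
  assumes g[measurable]: "g \<in> borel_measurable borel" and B: "\<And>t. \<bar>g t\<bar> \<le> B" and ab: "a \<le> b"
  shows "((\<lambda>h. LINT t:{a..b}|lborel. \<bar>(LINT \<tau>:{t..t + h}|lborel. g \<tau>) / h - g t\<bar>) \<longlongrightarrow> 0) (at_right 0)"
proof (rule tendstoI)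
  fix e :: real assume e: "0 < e"
  define om where "om h = (LINT t:{a..b}|lborel. \<bar>g (t + h) - g t\<bar>)" for h
  have "eventually (\<lambda>h. om h < e / 2) (at_right 0)"
    using translation_L1_tendsto[OF g B, of a b] unfolding om_def by (rule order_tendstoD) (use e in simp)
  then obtain \<delta> where \<delta>: "0 < \<delta>" "\<And>h. 0 < h \<Longrightarrow> h < \<delta> \<Longrightarrow> om h < e / 2"
    by (auto simp: eventually_at_right_field)
  have om0: "om 0 = 0" by (simp add: om_def)
  have B': "\<bar>g (t + u) - g t\<bar> \<le> 2 * B" for t u using B[of t] B[of "t + u"] by linarith
  have meas: "(\<lambda>h. om h) \<in> borel_measurable borel"
    unfolding om_def set_lebesgue_integral_def by measurable
  have om_le: "\<bar>om h\<bar> \<le> (b - a) * (2 * B)" for h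
    unfolding om_def by (rule set_integral_Icc_bound) (use B' ab in auto)
  have "(LINT t:{a..b}|lborel. \<bar>(LINT \<tau>:{t..t + h}|lborel. g \<tau>) / h - g t\<bar>) \<le> e / 2"
    if h: "0 < h" "h < \<delta>" for h
  proof -
    have eq: "(LINT \<tau>:{t..t + h}|lborel. g \<tau>) / h - g t = (LINT u:{0..h}|lborel. g (t + u) - g t) / h" for t
    proof -
      have "(LINT \<tau>:{t..t + h}|lborel. g \<tau>) = (LINT u:{0..h}|lborel. g (t + u))"
        using set_integral_shift[of 0 h g t] by (simp add: add.commute)
      moreover have "(LINT u:{0..h}|lborel. g (t + u) - g t) = (LINT u:{0..h}|lborel. g (t + u)) - (LINT u:{0..h}|lborel. g t)"
        by (rule set_integral_diff) (auto intro!: set_integrable_Icc_bounded[where B = B] B)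
      ultimately show ?thesis using h by (simp add: field_simps set_integral_Icc_const)
    qed
    have "(LINT t:{a..b}|lborel. \<bar>(LINT \<tau>:{t..t + h}|lborel. g \<tau>) / h - g t\<bar>)
       \<le> (LINT t:{a..b}|lborel. (LINT u:{0..h}|lborel. \<bar>g (t + u) - g t\<bar>) / h)"
      unfolding eq
    proof (intro set_integral_mono set_integrable_Icc_bounded[where B = "2 * B"])
      have b1: "\<bar>LINT u:{0..h}|lborel. g (t + u) - g t\<bar> \<le> h * (2 * B)" for t
        using set_integral_Icc_bound[of "\<lambda>u. g (t + u) - g t" "2 * B" 0 h] B' h by simp
      have b2: "\<bar>LINT u:{0..h}|lborel. \<bar>g (t + u) - g t\<bar>\<bar> \<le> h * (2 * B)" for t
        using set_integral_Icc_bound[of "\<lambda>u. \<bar>g (t + u) - g t\<bar>" "2 * B" 0 h] B' h by simp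
      show "\<bar>\<bar>(LINT u:{0..h}|lborel. g (t + u) - g t) / h\<bar>\<bar> \<le> 2 * B" for t
        using b1[of t] h by (simp add: field_simps abs_mult)
      show "\<bar>(LINT u:{0..h}|lborel. \<bar>g (t + u) - g t\<bar>) / h\<bar> \<le> 2 * B" for t
        using b2[of t] h by (simp add: field_simps abs_mult)
      show "\<bar>(LINT u:{0..h}|lborel. g (t + u) - g t) / h\<bar> \<le> (LINT u:{0..h}|lborel. \<bar>g (t + u) - g t\<bar>) / h" for t
      proof -
        have "set_integrable lborel {0..h} (\<lambda>u. g (t + u) - g t)"
          by (rule set_integrable_Icc_bounded[where B = "2 * B"]) (use B' in auto)
        from set_integral_norm_bound[OF this] show ?thesis
          using h by (simp add: abs_mult divide_right_mono)
      qed
    qed (auto simp: set_lebesgue_integral_def)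
    also have "\<dots> = (LINT t:{a..b}|lborel. LINT u:{0..h}|lborel. \<bar>g (t + u) - g t\<bar>) / h"
      by (rule set_integral_divide_zero)
    also have "\<dots> = (LINT u:{0..h}|lborel. om u) / h"
      unfolding om_def
      by (subst set_integral_rectangle_swap[where B = "2 * B"]) (use B' in \<open>auto simp: borel_prod[symmetric]\<close>)
    also have "\<dots> \<le> (LINT u:{0..h}|lborel. e / 2) / h"
    proof (intro divide_right_mono set_integral_mono)
      show "set_integrable lborel {0..h} om"
        by (rule set_integrable_Icc_bounded[OF meas om_le])
      show "set_integrable lborel {0..h} (\<lambda>_. e / 2)"
        by (rule set_integrable_Icc_bounded[where B = "e/2"]) (use e in auto)
      show "om u \<le> e / 2" if "u \<in> {0..h}" for u
        using \<delta>(2)[of u] that h om0 e by (cases "u = 0") auto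
    qed (use h in auto)
    also have "\<dots> = e / 2" using h by (simp add: set_integral_Icc_const)
    finally show ?thesis .
  qed
  then have "eventually (\<lambda>h. (LINT t:{a..b}|lborel. \<bar>(LINT \<tau>:{t..t + h}|lborel. g \<tau>) / h - g t\<bar>) \<le> e / 2) (at_right 0)"
    using \<delta>(1) by (auto simp: eventually_at_right_field)
  then show "eventually (\<lambda>h. dist (LINT t:{a..b}|lborel. \<bar>(LINT \<tau>:{t..t + h}|lborel. g \<tau>) / h - g t\<bar>) 0 < e) (at_right 0)"
  proof eventually_elim
    case (elim h)
    have "0 \<le> (LINT t:{a..b}|lborel. \<bar>(LINT \<tau>:{t..t + h}|lborel. g \<tau>) / h - g t\<bar>)"
      unfolding set_lebesgue_integral_def by (intro integral_nonneg_AE) auto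
    with elim e show ?case by simp
  qed
qed

text \<open>After the shift \<open>\<tau> = t + u\<close> and an exchange of integrals, every
  translate of \<open>[a, b]\<close> by some \<open>u\<close> in \<open>[0, h]\<close> lies in
  \<open>[a, b + h]\<close>; the length of the range of \<open>u\<close> gives the factor
  \<open>h\<close>.\<close>

lemma steklov_sum_le:
  fixes F :: "real \<Rightarrow> real"
  assumes F[measurable]: "F \<in> borel_measurable borel" and B: "\<And>t. \<bar>F t\<bar> \<le> B" and F0: "\<And>t. 0 \<le> F t" and h: "0 \<le> h"
  shows "(LINT t:{a..b}|lborel. LINT \<tau>:{t..t + h}|lborel. F \<tau>) \<le> h * (LINT \<tau>:{a..b + h}|lborel. F \<tau>)"
proof -
  define C where "C = (LINT \<tau>:{a..b + h}|lborel. F \<tau>)"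
  have eq: "(LINT \<tau>:{t..t + h}|lborel. F \<tau>) = (LINT u:{0..h}|lborel. F (t + u))" for t
    using set_integral_shift[of 0 h F t] by (simp add: add.commute)
  have "(LINT t:{a..b}|lborel. LINT \<tau>:{t..t + h}|lborel. F \<tau>) = (LINT u:{0..h}|lborel. LINT t:{a..b}|lborel. F (t + u))"
    unfolding eq by (rule set_integral_rectangle_swap[where B = B]) (use B in \<open>auto simp: borel_prod[symmetric]\<close>)
  also have "\<dots> \<le> (LINT u:{0..h}|lborel. C)"
  proof (rule set_integral_mono)
    show "(LINT t:{a..b}|lborel. F (t + u)) \<le> C" if "u \<in> {0..h}" for u
    proof -
      have "(LINT t:{a..b}|lborel. F (t + u)) = (LINT t:{a + u..b + u}|lborel. F t)"
        by (rule set_integral_shift)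
      also have "\<dots> \<le> C"
        unfolding C_def set_lebesgue_integral_def
        by (intro integral_mono set_integrable_Icc_bounded[OF F B, unfolded set_integrable_def])
           (use that F0 in \<open>auto simp: indicator_def\<close>)
      finally show ?thesis .
    qed
    show "set_integrable lborel {0..h} (\<lambda>u. LINT t:{a..b}|lborel. F (t + u))"
    proof (cases "a \<le> b")
      case True
      show ?thesis
        by (rule set_integrable_Icc_bounded[where B = "(b - a) * B"])
           (use True B in \<open>auto simp: set_lebesgue_integral_def intro!: set_integral_Icc_bound[unfolded set_lebesgue_integral_def real_scaleR_def]\<close>)
    qed (auto simp: set_lebesgue_integral_def set_integrable_def)
    show "set_integrable lborel {0..h} (\<lambda>_. C)"
      by (rule set_integrable_Icc_bounded[where B = "\<bar>C\<bar>"]) auto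
  qed
  also have "\<dots> = h * C" using h by (simp add: set_integral_Icc_const)
  finally show ?thesis by (simp add: C_def)
qed

section \<open>The energy inequality\<close>

lemma powr_neg_lipschitz:
  fixes a b e \<rho> :: real
  assumes "0 < \<rho>" "\<rho> \<le> a" "\<rho> \<le> b" "0 \<le> e"
  shows "\<bar>a powr (- e) - b powr (- e)\<bar> \<le> e * \<rho> powr (- e - 1) * \<bar>a - b\<bar>"
proof -
  have *: "\<bar>a powr (- e) - b powr (- e)\<bar> \<le> e * \<rho> powr (- e - 1) * \<bar>a - b\<bar>" if "a < b" "\<rho> \<le> a" for a b
  proof -
    have "\<exists>z. a < z \<and> z < b \<and> b powr (- e) - a powr (- e) = (b - a) * (- e * z powr (- e - 1))"
      by (rule MVT2[OF that(1)]) (use that assms in \<open>auto intro!: derivative_eq_intros\<close>)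
    then obtain z where z: "a < z" "b powr (- e) - a powr (- e) = (b - a) * (- e * z powr (- e - 1))"
      by blast
    have "z powr (- e - 1) \<le> \<rho> powr (- e - 1)"
      by (rule powr_mono2') (use z that assms in auto)
    then have "\<bar>b - a\<bar> * (e * z powr (- e - 1)) \<le> \<bar>b - a\<bar> * (e * \<rho> powr (- e - 1))"
      by (intro mult_left_mono) (use assms in auto)
    moreover have "\<bar>a powr (- e) - b powr (- e)\<bar> = \<bar>b - a\<bar> * (e * z powr (- e - 1))"
      using assms by (subst abs_minus_commute) (simp add: z(2) abs_mult)
    ultimately show ?thesis by (simp add: abs_minus_commute mult_ac)
  qed
  show ?thesis using *[of a b] *[of b a] assms
    by (cases a b rule: linorder_cases) (auto simp: abs_minus_commute)
qed

lemma powr_unit_lipschitz: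
  fixes a b p :: real
  assumes "0 \<le> a" "a \<le> 1" "0 \<le> b" "b \<le> 1" "1 \<le> p"
  shows "\<bar>a powr p - b powr p\<bar> \<le> p * \<bar>a - b\<bar>"
proof -
  have *: "\<bar>a powr p - b powr p\<bar> \<le> p * \<bar>a - b\<bar>" if "a < b" "0 \<le> a" "b \<le> 1" for a b
  proof (cases "a = 0")
    case True
    have "b powr p \<le> b powr 1" by (rule powr_mono') (use that assms in auto)
    also have "\<dots> \<le> p * b" using that assms by simp
    finally show ?thesis using that True by simp
  next
    case False
    have "\<exists>z. a < z \<and> z < b \<and> b powr p - a powr p = (b - a) * (p * z powr (p - 1))"
      by (rule MVT2[OF that(1)]) (use that assms False in \<open>auto intro!: derivative_eq_intros\<close>)
    then obtain z where z: "a < z" "z < b" "b powr p - a powr p = (b - a) * (p * z powr (p - 1))"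
      by blast
    have "z powr (p - 1) \<le> 1" by (rule powr_le1) (use z that assms in auto)
    then have "\<bar>b - a\<bar> * (p * z powr (p - 1)) \<le> \<bar>b - a\<bar> * (p * 1)"
      by (intro mult_left_mono) (use assms in auto)
    moreover have "\<bar>a powr p - b powr p\<bar> = \<bar>b - a\<bar> * (p * z powr (p - 1))"
      using assms by (subst abs_minus_commute) (simp add: z(3) abs_mult)
    ultimately show ?thesis by (simp add: abs_minus_commute mult_ac)
  qed
  show ?thesis using *[of a b] *[of b a] assms
    by (cases a b rule: linorder_cases) (auto simp: abs_minus_commute)
qed

text \<open>Controls pairs with at least one point in \<open>B\<close>. A sum of two indicators is
  used instead of the indicator of a union so that \<open>nn_integral_weighted_cutker\<close>
  applies.\<close>

definition tailker :: "real \<Rightarrow> real \<Rightarrow> real \<Rightarrow> (real ^ 'n) set \<Rightarrow> (real ^ 'n) \<times> (real ^ 'n) \<Rightarrow> real" where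
  "tailker s p d B z = (indicator B (fst z) + indicator B (snd z)) * cutker s p d (fst z - snd z)"

lemma tailker_nonneg [simp]: "0 \<le> tailker s p d B z"
  by (simp add: tailker_def)

lemma borel_measurable_fst_snd [measurable]:
  "(fst :: 'a::second_countable_topology \<times> 'b::second_countable_topology \<Rightarrow> 'a) \<in> borel_measurable borel"
  "(snd :: 'a \<times> 'b \<Rightarrow> 'b) \<in> borel_measurable borel"
  by (simp_all add: borel_prod[symmetric])

lemma tailker_measurable [measurable]:
  assumes [measurable]: "B \<in> sets borel"
  shows "tailker s p d B \<in> borel_measurable borel"
  unfolding tailker_def by measurable

lemma nn_integral_lborel_pair:
  fixes f :: "'a::euclidean_space \<times> 'b::euclidean_space \<Rightarrow> ennreal"
  assumes "f \<in> borel_measurable borel"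
  shows "(\<integral>\<^sup>+z. f z \<partial>lborel) = (\<integral>\<^sup>+x. \<integral>\<^sup>+y. f (x, y) \<partial>lborel \<partial>lborel)"
    "(\<integral>\<^sup>+z. f z \<partial>lborel) = (\<integral>\<^sup>+y. \<integral>\<^sup>+x. f (x, y) \<partial>lborel \<partial>lborel)"
  using assms lborel.nn_integral_fst[of f lborel] lborel_pair.nn_integral_snd[of f]
  by (simp_all add: lborel_prod)

text \<open>Each of the two summands is integrated first in the variable that its weight does not
  involve, where the kernel has a constant integral.\<close>

lemma nn_integral_weighted_cutker:
  fixes w :: "real ^ 'n \<Rightarrow> real"
  assumes "0 < s" "s < 1" "0 < p" "0 < d" and [measurable]: "w \<in> borel_measurable borel" and w: "\<And>x. 0 \<le> w x"
  shows "(\<integral>\<^sup>+z. (w (fst z) + w (snd z)) * cutker s p d (fst z - snd z) \<partial>(lborel :: 'n points measure))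
    = ennreal (2 * cutker_const TYPE('n) s p * d powr (- (p * s))) * (\<integral>\<^sup>+x. w x \<partial>lborel)"
proof -
  define c where "c = cutker_const TYPE('n) s p * d powr (- (p * s))"
  have c: "0 \<le> c" by (simp add: c_def cutker_const_def)
  have 1: "(\<integral>\<^sup>+y. cutker s p d (x - y) \<partial>lborel) = ennreal c" for x :: "real ^ 'n"
    unfolding c_def by (rule nn_integral_cutker) fact+
  have 2: "(\<integral>\<^sup>+y. cutker s p d (y - x) \<partial>lborel) = ennreal c" for x :: "real ^ 'n"
    using 1[of x] by (simp add: cutker_minus[of s p d x])
  have "(\<integral>\<^sup>+z. (w (fst z) + w (snd z)) * cutker s p d (fst z - snd z) \<partial>(lborel :: 'n points measure))
    = (\<integral>\<^sup>+z. ennreal (w (fst z)) * cutker s p d (fst z - snd z) + ennreal (w (snd z)) * cutker s p d (fst z - snd z) \<partial>(lborel :: 'n points measure))"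
    using w by (simp add: distrib_right ennreal_plus ennreal_mult')
  also have "\<dots> = (\<integral>\<^sup>+z. ennreal (w (fst z)) * cutker s p d (fst z - snd z) \<partial>(lborel :: 'n points measure))
    + (\<integral>\<^sup>+z. ennreal (w (snd z)) * cutker s p d (fst z - snd z) \<partial>(lborel :: 'n points measure))"
    by (rule nn_integral_add) auto
  also have "(\<integral>\<^sup>+z. ennreal (w (fst z)) * cutker s p d (fst z - snd z) \<partial>(lborel :: 'n points measure))
    = (\<integral>\<^sup>+x. w x \<partial>lborel) * ennreal c"
    by (subst nn_integral_lborel_pair(1)) (auto simp: nn_integral_cmult nn_integral_multc 1)
  also have "(\<integral>\<^sup>+z. ennreal (w (snd z)) * cutker s p d (fst z - snd z) \<partial>(lborel :: 'n points measure))
    = (\<integral>\<^sup>+x. w x \<partial>lborel) * ennreal c"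
    by (subst nn_integral_lborel_pair(2)) (auto simp: nn_integral_cmult nn_integral_multc 2)
  also have "(\<integral>\<^sup>+x. w x \<partial>lborel) * ennreal c + (\<integral>\<^sup>+x. w x \<partial>lborel) * ennreal c = ennreal (2 * c) * (\<integral>\<^sup>+x. w x \<partial>lborel)"
    using c by (simp add: ennreal_mult' mult.commute mult.left_commute mult.assoc flip: mult_2)
  finally show ?thesis by (simp add: c_def mult.assoc)
qed

lemma nn_integral_tailker_finite:
  assumes "0 < s" "s < 1" "0 < p" "0 < d"
  shows "(\<integral>\<^sup>+z. tailker s p d (ball (x0 :: real ^ 'n) R) z \<partial>lborel) < \<infinity>"
proof -
  have "(\<integral>\<^sup>+x. ennreal (indicator (ball x0 R) x) \<partial>lborel) = emeasure lborel (ball x0 R)"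
    by (simp add: ennreal_indicator)
  also have "\<dots> < \<infinity>" using emeasure_bounded_finite[of "ball x0 R"] by simp
  finally show ?thesis unfolding tailker_def
    by (subst nn_integral_weighted_cutker)
       (use assms in \<open>auto simp: ennreal_mult_less_top intro!: borel_measurable_indicator\<close>)
qed

text \<open>If both points lie in the large ball, Young's inequality separates flux and test
  function. Otherwise a pair contributes only if one point lies in \<open>ball x0 R\<close>; the
  other is then at distance at least \<open>d\<close>, the kernel is not singular there, and the
  crude bounds \<open>M\<close> and \<open>b\<close> go with the tail kernel.\<close>

lemma flux_bound:
  fixes \<psi> :: "real ^ 'n \<Rightarrow> real"
  assumes "1 \<le> p" "0 < d" "R + d \<le> R'"
    and psi: "\<And>x. 0 \<le> \<psi> x" "\<And>x. \<psi> x \<le> b" "\<And>x. x \<notin> ball x0 R \<Longrightarrow> \<psi> x = 0"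
    and c: "\<bar>c\<bar> \<le> M"
  shows "\<bar>c\<bar> powr (p - 1) * \<bar>\<psi> x - \<psi> y\<bar> * fker s p (x - y)
    \<le> indicator (ball x0 R' \<times> ball x0 R') (x, y) * \<bar>c\<bar> powr p * fker s p (x - y)
      + \<bar>\<psi> x - \<psi> y\<bar> powr p * fker s p (x - y)
      + M powr (p - 1) * b * tailker s p d (ball x0 R') (x, y)"
proof -
  have b: "0 \<le> b" using psi(1)[of x] psi(2)[of x] by simp
  have M: "0 \<le> M" using c by linarith
  have far: "d \<le> norm (v - w)" if "v \<in> ball x0 R" "w \<notin> ball x0 R'" for v w
    using dist_triangle[of x0 w v] that assms(3) by (auto simp: dist_norm)
  consider "x \<in> ball x0 R'" "y \<in> ball x0 R'" | "\<psi> x = \<psi> y"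
    | "x \<in> ball x0 R \<and> y \<notin> ball x0 R' \<or> y \<in> ball x0 R \<and> x \<notin> ball x0 R'"
    using psi(3)[of x] psi(3)[of y] assms(2,3) by fastforce
  then show ?thesis
  proof cases
    case 1
    have "\<bar>c\<bar> powr (p - 1) * \<bar>\<psi> x - \<psi> y\<bar> * fker s p (x - y) \<le> (\<bar>c\<bar> powr p + \<bar>\<psi> x - \<psi> y\<bar> powr p) * fker s p (x - y)"
      by (intro mult_right_mono mult_powr_le_add) (use assms in auto)
    moreover have "0 \<le> M powr (p - 1) * b * tailker s p d (ball x0 R') (x, y)" using b by simp
    ultimately show ?thesis using 1 by (simp add: algebra_simps)
  next
    case 2
    then show ?thesis using b by simp
  next
    case 3
    then have "d \<le> norm (x - y)" using far[of x y] far[of y x] by (auto simp: norm_minus_commute)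
    then have ck: "cutker s p d (x - y) = fker s p (x - y)"
      using assms by (simp add: cutker_def min_def)
    have "x \<in> ball x0 R' \<or> y \<in> ball x0 R'" using 3 assms by auto
    then have tk: "fker s p (x - y) \<le> tailker s p d (ball x0 R') (x, y)"
      by (auto simp: tailker_def ck indicator_def)
    have "\<bar>c\<bar> powr (p - 1) \<le> M powr (p - 1)" by (rule powr_mono2) (use assms in auto)
    moreover have "\<bar>\<psi> x - \<psi> y\<bar> \<le> b" using psi(1,2)[of x] psi(1,2)[of y] by auto
    ultimately have "\<bar>c\<bar> powr (p - 1) * \<bar>\<psi> x - \<psi> y\<bar> * fker s p (x - y) \<le> M powr (p - 1) * b * tailker s p d (ball x0 R') (x, y)"
      using b by (intro mult_mono tk) auto
    then show ?thesis by (smt (verit) fker_nonneg indicator_pos_le mult_nonneg_nonneg powr_ge_zero)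
  qed
qed

definition cutoff :: "real ^ 'n \<Rightarrow> real \<Rightarrow> real \<Rightarrow> real ^ 'n \<Rightarrow> real" where
  "cutoff x0 R d x = max 0 (min 1 ((R + d - dist x0 x) / d))"

lemma cutoff_range [simp]: "0 \<le> cutoff x0 R d x" "cutoff x0 R d x \<le> 1"
  by (auto simp: cutoff_def)

lemma cutoff_eq_1: "0 < d \<Longrightarrow> x \<in> ball x0 R \<Longrightarrow> cutoff x0 R d x = 1"
  by (auto simp: cutoff_def max_def min_def field_simps)

lemma cutoff_eq_0: "0 < d \<Longrightarrow> x \<notin> ball x0 (R + d) \<Longrightarrow> cutoff x0 R d x = 0"
  by (auto simp: cutoff_def max_def min_def field_simps)

lemma cutoff_measurable [measurable]: "cutoff x0 R d \<in> borel_measurable borel"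
  unfolding cutoff_def by measurable

lemma cutoff_lipschitz:
  assumes "0 < d"
  shows "\<bar>cutoff x0 R d x - cutoff x0 R d y\<bar> \<le> min 1 (norm (x - y) / d)"
proof -
  have "\<bar>(R + d - dist x0 x) / d - (R + d - dist x0 y) / d\<bar> = \<bar>dist x0 y - dist x0 x\<bar> / d"
    using assms by (simp add: field_simps flip: diff_divide_distrib)
  also have "\<dots> \<le> norm (x - y) / d"
    using assms abs_dist_diff_le[of y x0 x] by (intro divide_right_mono) (auto simp: dist_commute dist_norm norm_minus_commute)
  finally have "\<bar>cutoff x0 R d x - cutoff x0 R d y\<bar> \<le> norm (x - y) / d"
    unfolding cutoff_def by linarith
  moreover have "\<bar>cutoff x0 R d x - cutoff x0 R d y\<bar> \<le> 1"
    using cutoff_range[of x0 R d x] cutoff_range[of x0 R d y] by linarith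
  ultimately show ?thesis by simp
qed

section \<open>Fubini and measurability of time integrals\<close>

lemma integrable_lborel_pairI:
  fixes f :: "'a::euclidean_space \<times> 'b::euclidean_space \<Rightarrow> real"
  assumes "f \<in> borel_measurable borel"
    and "integrable lborel (\<lambda>x. \<integral>y. \<bar>f (x, y)\<bar> \<partial>lborel)"
    and "AE x in lborel. integrable lborel (\<lambda>y. f (x, y))"
  shows "integrable lborel f"
  using lborel_pair.Fubini_integrable[of f] assms by (simp add: lborel_prod)

lemma integral_lborel_pair_swap:
  fixes f :: "'a::euclidean_space \<times> 'b::euclidean_space \<Rightarrow> real"
  assumes "integrable lborel f"
  shows "(\<integral>y. \<integral>x. f (x, y) \<partial>lborel \<partial>lborel) = (\<integral>x. \<integral>y. f (x, y) \<partial>lborel \<partial>lborel)"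
    "integrable lborel (\<lambda>y. \<integral>x. f (x, y) \<partial>lborel)"
    "(\<integral>z. f z \<partial>lborel) = (\<integral>x. \<integral>y. f (x, y) \<partial>lborel \<partial>lborel)"
    "AE y in lborel. integrable lborel (\<lambda>x. f (x, y))"
  using lborel_pair.Fubini_integral[of "\<lambda>x y. f (x, y)"] lborel_pair.integrable_snd[of "\<lambda>x y. f (x, y)"]
    lborel_pair.integral_fst'[of f] lborel_pair.AE_integrable_snd[of "\<lambda>x y. f (x, y)"] assms
  by (simp_all add: lborel_prod split_beta)

lemma borel_measurable_lborel_integral:
  fixes f :: "'a::euclidean_space \<times> 'b::euclidean_space \<Rightarrow> real"
  assumes "f \<in> borel_measurable borel"
  shows "(\<lambda>x. \<integral>y. f (x, y) \<partial>lborel) \<in> borel_measurable borel"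
proof -
  have "(\<lambda>(x, y). f (x, y)) \<in> borel_measurable (borel \<Otimes>\<^sub>M (lborel :: 'b measure))"
    using assms by (simp add: split_beta' borel_prod cong: measurable_cong_sets) (simp add: borel_prod)
  then show ?thesis by (rule lborel.borel_measurable_lebesgue_integral)
qed

lemma steklov_measurable:
  fixes F :: "real \<Rightarrow> real"
  assumes [measurable]: "F \<in> borel_measurable borel"
  shows "(\<lambda>t. LINT \<tau>:{t..t + h}|lborel. F \<tau>) \<in> borel_measurable borel"
proof -
  have [measurable]: "(\<lambda>w. F (snd w)) \<in> borel_measurable (borel :: (real \<times> real) measure)"
    by (rule measurable_compose[OF borel_measurable_fst_snd(2)]) measurable
  have "(\<lambda>w. (if fst w \<le> snd w \<and> snd w \<le> fst w + h then F (snd w) else 0))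
    \<in> borel_measurable (borel :: (real \<times> real) measure)"
    by measurable
  from borel_measurable_lborel_integral[OF this] show ?thesis
    unfolding set_lebesgue_integral_def
    by (rule subst[of _ _ "\<lambda>f. f \<in> _", rotated]) (auto simp: indicator_def intro!: ext Bochner_Integration.integral_cong)
qed

lemma set_integral_Icc_combine:
  fixes f :: "real \<Rightarrow> real"
  assumes "f \<in> borel_measurable borel" "\<And>x. \<bar>f x\<bar> \<le> B" "a \<le> b" "b \<le> c"
  shows "(LINT x:{a..c}|lborel. f x) = (LINT x:{a..b}|lborel. f x) + (LINT x:{b..c}|lborel. f x)"
proof -
  have "{a..c} = {a..b} \<union> {b..c}" using assms by auto
  moreover have "(LINT x:{a..b} \<union> {b..c}|lborel. f x) = (LINT x:{a..b}|lborel. f x) + (LINT x:{b..c}|lborel. f x)"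
  proof (rule set_integral_Un_AE)
    have "AE x in lborel. x \<noteq> b" by (rule AE_lborel_singleton)
    then show "AE x in lborel. \<not> (x \<in> {a..b} \<and> x \<in> {b..c})" by eventually_elim auto
  qed (auto intro!: set_integrable_Icc_bounded[OF assms(1,2)])
  ultimately show ?thesis by simp
qed

text \<open>The time-independent test functions that are used. A support in a ball of strictly
  smaller radius leaves room for the compact inclusion demanded by the weak formulation.\<close>

definition admissible_test :: "real \<Rightarrow> real \<Rightarrow> real \<Rightarrow> real ^ 'n \<Rightarrow> (real ^ 'n \<Rightarrow> real) \<Rightarrow> bool" where
  "admissible_test s p r x0 \<psi> \<longleftrightarrow> \<psi> \<in> borel_measurable borel \<and> (\<exists>R<r. \<forall>x. x \<notin> ball x0 R \<longrightarrow> \<psi> x = 0) \<and>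
     (\<exists>c. \<forall>x. 0 \<le> \<psi> x \<and> \<psi> x \<le> c) \<and>
     (\<integral>\<^sup>+z. \<bar>\<psi> (fst z) - \<psi> (snd z)\<bar> powr p * fker s p (fst z - snd z) \<partial>lborel) < \<infinity>"

text \<open>
  \<open>U\<close> and \<open>k\<close> are Borel representatives on the time window \<open>(t0, t1)\<close>, modified on null sets so that the
  bounds hold everywhere. The exceptional set \<open>N\<close> consists of times rather than of points.
\<close>

locale nonlocal_supersolution =
  fixes s p \<Lambda> \<rho> M t0 t1 r :: real and x0 :: "real ^ 'n"
    and U :: "real ^ 'n \<Rightarrow> real \<Rightarrow> real" and k :: "real ^ 'n \<Rightarrow> real ^ 'n \<Rightarrow> real \<Rightarrow> real"
  assumes p: "2 < p" and s: "0 < s" "s < 1" and Lam: "1 \<le> \<Lambda>" and rho: "0 < \<rho>"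
    and t01: "t0 < t1"
    and U_borel: "(\<lambda>z. U (fst z) (snd z)) \<in> borel_measurable borel"
    and U_ge: "\<And>x t. \<rho> \<le> U x t" and U_le: "\<And>x t. U x t \<le> M"
    and k_borel: "(\<lambda>z. k (fst z) (fst (snd z)) (snd (snd z))) \<in> borel_measurable borel"
    and k_ge: "\<And>x y t. fker s p (x - y) / \<Lambda> \<le> k x y t"
    and k_le: "\<And>x y t. k x y t \<le> \<Lambda> * fker s p (x - y)"
    and energy_finite: "\<And>R. R < r \<Longrightarrow> (\<integral>\<^sup>+t. \<integral>\<^sup>+z. ennreal (indicator {t0..t1} t *
        (indicator (ball x0 R \<times> ball x0 R) z * (\<bar>U (fst z) t - U (snd z) t\<bar> powr p
          * fker s p (fst z - snd z)))) \<partial>lborel \<partial>lborel) < \<infinity>"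
    and supersolution: "\<exists>N\<in>null_sets lborel. \<forall>b b' \<psi>. b \<notin> N \<and> b' \<notin> N \<and> t0 < b \<and> b < b' \<and> b' < t1 \<and>
         admissible_test s p r x0 \<psi> \<longrightarrow>
         0 \<le> (\<integral>x. (U x b' powr (p - 1) - U x b powr (p - 1)) * \<psi> x \<partial>lborel)
           + (\<integral>z. (LINT \<tau>:{b..b'}|lborel. cdn p (U (fst z) \<tau> - U (snd z) \<tau>) * k (fst z) (snd z) \<tau>)
                * (\<psi> (fst z) - \<psi> (snd z)) \<partial>lborel)"
begin

lemma U_pos [simp]: "0 < U x t" and U_nonneg [simp]: "0 \<le> U x t"
  using U_ge[of x t] rho by linarith+

lemma U_measurable [measurable (raw)]:
  assumes "f \<in> borel_measurable N" "g \<in> borel_measurable N"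
  shows "(\<lambda>w. U (f w) (g w)) \<in> borel_measurable N"
  using measurable_compose[OF borel_measurable_Pair[OF assms] U_borel] by simp

lemma k_measurable [measurable (raw)]:
  assumes "f \<in> borel_measurable N" "g \<in> borel_measurable N" "h \<in> borel_measurable N"
  shows "(\<lambda>w. k (f w) (g w) (h w)) \<in> borel_measurable N"
  using measurable_compose[OF borel_measurable_Pair[OF assms(1) borel_measurable_Pair[OF assms(2,3)]] k_borel]
  by simp

lemma U_diff_le: "\<bar>U x t - U y t'\<bar> \<le> M"
  using U_ge[of x t] U_ge[of y t'] U_le[of x t] U_le[of y t'] rho by linarith

definition flux :: "(real ^ 'n) \<times> (real ^ 'n) \<Rightarrow> real \<Rightarrow> real" where
  "flux z t = cdn p (U (fst z) t - U (snd z) t) * k (fst z) (snd z) t"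

lemma cdn_measurable [measurable]: "cdn q \<in> borel_measurable borel"
  unfolding cdn_def by measurable

lemma flux_measurable [measurable (raw)]:
  assumes [measurable]: "f \<in> borel_measurable N" "g \<in> borel_measurable N"
  shows "(\<lambda>w. flux (f w) (g w)) \<in> borel_measurable N"
proof -
  have [measurable]: "(\<lambda>w. fst (f w)) \<in> borel_measurable N" "(\<lambda>w. snd (f w)) \<in> borel_measurable N"
    using assms by (auto intro: measurable_compose[OF _ borel_measurable_fst_snd(1)] measurable_compose[OF _ borel_measurable_fst_snd(2)])
  show ?thesis unfolding flux_def by measurable
qed

lemma k_nonneg: "0 \<le> k x y t"
  using k_ge[where x=x and y=y and t=t] Lam by (smt (verit) divide_nonneg_nonneg fker_nonneg)

lemma abs_flux_le: "\<bar>flux z t\<bar> \<le> \<bar>U (fst z) t - U (snd z) t\<bar> powr (p - 1) * (\<Lambda> * fker s p (fst z - snd z))"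
  unfolding flux_def abs_mult abs_cdn
  by (intro mult_left_mono) (use k_le k_nonneg in auto)

text \<open>For fixed \<open>z\<close> this bounds the flux uniformly in time, which is what time
  averages need; integrability in \<open>z\<close> comes from \<open>flux_Psi_le\<close>
  instead.\<close>

lemma flux_bounded: "\<bar>flux z t\<bar> \<le> M powr (p - 1) * (\<Lambda> * fker s p (fst z - snd z))"
  by (rule order_trans[OF abs_flux_le mult_right_mono[OF powr_mono2]])
     (use p Lam U_diff_le in auto)

end

text \<open>The two layers of width \<open>d\<close> have different purposes: the cutoff descends to
  0 in the first, and the second keeps its support at distance \<open>d\<close> from the complement
  of \<open>B'\<close>, so that the kernel is not singular between them.\<close>

locale caccioppoli = nonlocal_supersolution +
  fixes a e R d :: real
  assumes a: "0 < a" and e: "0 < e" and ae: "a + e = p - 1" and d: "0 < d" and Rd: "R + 2 * d < r"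
begin

definition "B' = ball x0 (R + 2 * d)"
definition "eta = cutoff x0 R d"
definition "psi t x = U x t powr (- e) * eta x powr p"
definition "Psi z t = psi t (fst z) - psi t (snd z)"
definition "en z t = indicator (B' \<times> B') z * (\<bar>U (fst z) t - U (snd z) t\<bar> powr p * fker s p (fst z - snd z))"
definition "En z = (LINT t:{t0..t1}|lborel. en z t)"
definition "tail = tailker s p d B'"
definition "mass t = (\<integral>x. U x t powr a * eta x powr p \<partial>lborel)"

lemma eta_range [simp]: "0 \<le> eta x" "eta x \<le> 1" by (auto simp: eta_def)
lemma eta_measurable [measurable]: "eta \<in> borel_measurable borel" by (simp add: eta_def)
lemma eta_powr_le [simp]: "eta x powr p \<le> 1" using powr_le1[of p "eta x"] p by simp
lemma eta_eq_0: "x \<notin> ball x0 (R + d) \<Longrightarrow> eta x = 0" using cutoff_eq_0[OF d] by (simp add: eta_def)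
lemma B'_sets [measurable]: "B' \<in> sets borel" by (simp add: B'_def)
lemma tail_nonneg [simp]: "0 \<le> tail z" by (simp add: tail_def)
lemma tail_measurable [measurable]: "tail \<in> borel_measurable borel" by (simp add: tail_def)
lemma en_nonneg [simp]: "0 \<le> en z t" by (simp add: en_def)

lemma psi_measurable [measurable (raw)]:
  assumes [measurable]: "f \<in> borel_measurable N" "g \<in> borel_measurable N"
  shows "(\<lambda>w. psi (g w) (f w)) \<in> borel_measurable N"
  unfolding psi_def by measurable

lemma Psi_measurable [measurable (raw)]:
  assumes [measurable]: "f \<in> borel_measurable N" "g \<in> borel_measurable N"
  shows "(\<lambda>w. Psi (f w) (g w)) \<in> borel_measurable N" "(\<lambda>w. en (f w) (g w)) \<in> borel_measurable N"
proof -
  have [measurable]: "(\<lambda>w. fst (f w)) \<in> borel_measurable N" "(\<lambda>w. snd (f w)) \<in> borel_measurable N"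
    using assms by (auto intro: measurable_compose[OF _ borel_measurable_fst_snd(1)] measurable_compose[OF _ borel_measurable_fst_snd(2)])
  show "(\<lambda>w. Psi (f w) (g w)) \<in> borel_measurable N" unfolding Psi_def by measurable
  have eq: "(\<lambda>w. indicator (B' \<times> B') (f w) :: real) = (\<lambda>w. indicator B' (fst (f w)) * indicator B' (snd (f w)))"
    by (auto simp: indicator_def mem_Times_iff fun_eq_iff)
  have [measurable]: "(\<lambda>w. indicator (B' \<times> B') (f w) :: real) \<in> borel_measurable N"
    unfolding eq by measurable
  show "(\<lambda>w. en (f w) (g w)) \<in> borel_measurable N" unfolding en_def by measurable
qed

lemma psi_range: "0 \<le> psi t x" "psi t x \<le> \<rho> powr (- e)"
proof -
  have "U x t powr (- e) \<le> \<rho> powr (- e)"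
    by (rule powr_mono2') (use e rho U_ge in auto)
  then show "psi t x \<le> \<rho> powr (- e)"
    using mult_mono[of "U x t powr (- e)" "\<rho> powr (- e)" "eta x powr p" 1] by (simp add: psi_def)
qed (simp add: psi_def)

lemma psi_eq_0: "x \<notin> ball x0 (R + d) \<Longrightarrow> psi t x = 0"
  using p by (simp add: psi_def eta_eq_0)

lemma Psi_bounded: "\<bar>Psi z t\<bar> \<le> \<rho> powr (- e)"
  using psi_range[of t "fst z"] psi_range[of t "snd z"] by (simp add: Psi_def abs_le_iff)

text \<open>\<open>C1\<close>, \<open>C2\<close> and \<open>CF\<close> depend on
  \<open>\<rho>\<close> and \<open>M\<close>. They serve integrability and dominated convergence and
  do not occur in \<open>energy_inequality\<close>.\<close>

definition "C1 = max (e * \<rho> powr (- e - 1)) (p * \<rho> powr (- e))"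
definition "C2 = C1 powr p * 2 powr (p - 1)"
definition "CF = \<Lambda> * (1 + C2 + M powr (p - 1) * \<rho> powr (- e))"

lemma C_nonneg: "0 < C1" "0 \<le> C2" "0 \<le> CF"
  using e rho p Lam by (auto simp: C1_def C2_def CF_def less_max_iff_disj)

lemma far_dist:
  assumes "x \<in> ball x0 (R + d)" "y \<notin> B'"
  shows "d \<le> norm (x - y)"
proof -
  have "dist x0 y \<le> dist x0 x + dist x y" by (rule dist_triangle)
  then show ?thesis using assms by (auto simp: B'_def dist_norm)
qed

text \<open>Inside \<open>B' \<times> B'\<close> the difference splits into one of
  \<open>U powr (- e)\<close>, Lipschitz in \<open>U\<close> because \<open>U \<ge> \<rho>\<close>,
  and one of \<open>eta powr p\<close>, Lipschitz with constant \<open>p / d\<close>. For pairs that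
  leave \<open>B'\<close> the distance is at least \<open>d\<close> wherever \<open>Psi\<close> does
  not vanish, so the minimum is 1 and the sup bound suffices.\<close>

lemma Psi_le:
  "\<bar>Psi z t\<bar> \<le> C1 * (indicator (B' \<times> B') z * \<bar>U (fst z) t - U (snd z) t\<bar>
      + (if fst z \<in> B' \<or> snd z \<in> B' then min 1 (norm (fst z - snd z) / d) else 0))"
proof -
  obtain x y where z: "z = (x, y)" by fastforce
  have c1: "e * \<rho> powr (- e - 1) \<le> C1" "p * \<rho> powr (- e) \<le> C1" "\<rho> powr (- e) \<le> C1"
    using p rho mult_right_mono[of 1 p "\<rho> powr (- e)"] by (auto simp: C1_def le_max_iff_disj)
  have sub: "ball x0 (R + d) \<subseteq> B'" using d by (auto simp: B'_def)
  consider "x \<in> B'" "y \<in> B'" | "psi t x = 0" "psi t y = 0"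
    | "x \<in> B'" "y \<notin> B'" "x \<in> ball x0 (R + d)" | "y \<in> B'" "x \<notin> B'" "y \<in> ball x0 (R + d)"
    using psi_eq_0[of x t] psi_eq_0[of y t] sub by blast
  then show ?thesis
  proof cases
    case 1
    define m where "m = min 1 (norm (x - y) / d)"
    have "psi t x - psi t y = (U x t powr (- e) - U y t powr (- e)) * eta x powr p
        + U y t powr (- e) * (eta x powr p - eta y powr p)"
      by (simp add: psi_def algebra_simps)
    then have "\<bar>psi t x - psi t y\<bar> \<le> \<bar>U x t powr (- e) - U y t powr (- e)\<bar> * eta x powr p
        + U y t powr (- e) * \<bar>eta x powr p - eta y powr p\<bar>"
      using abs_triangle_ineq[of "(U x t powr (- e) - U y t powr (- e)) * eta x powr p"
          "U y t powr (- e) * (eta x powr p - eta y powr p)"] by (simp add: abs_mult)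
    also have "\<dots> \<le> (e * \<rho> powr (- e - 1) * \<bar>U x t - U y t\<bar>) * 1 + \<rho> powr (- e) * (p * m)"
    proof (intro add_mono mult_mono)
      show "\<bar>U x t powr (- e) - U y t powr (- e)\<bar> \<le> e * \<rho> powr (- e - 1) * \<bar>U x t - U y t\<bar>"
        by (rule powr_neg_lipschitz) (use rho U_ge e in auto)
      have "\<bar>eta x powr p - eta y powr p\<bar> \<le> p * \<bar>eta x - eta y\<bar>"
        by (rule powr_unit_lipschitz) (use p in auto)
      also have "\<dots> \<le> p * m"
        unfolding m_def eta_def by (intro mult_left_mono cutoff_lipschitz d) (use p in auto)
      finally show "\<bar>eta x powr p - eta y powr p\<bar> \<le> p * m" .
      show "U y t powr (- e) \<le> \<rho> powr (- e)"
        by (rule powr_mono2') (use e rho U_ge in auto)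
    qed (use e in auto)
    also have "\<dots> = (e * \<rho> powr (- e - 1)) * \<bar>U x t - U y t\<bar> + (p * \<rho> powr (- e)) * m"
      by simp
    also have "\<dots> \<le> C1 * \<bar>U x t - U y t\<bar> + C1 * m"
      by (intro add_mono mult_right_mono c1) (use d in \<open>auto simp: m_def\<close>)
    finally show ?thesis using 1 by (simp add: z Psi_def m_def algebra_simps)
  next
    case 2
    then show ?thesis using C_nonneg d by (simp add: z Psi_def)
  next
    case 3
    then have "d \<le> norm (x - y)" by (intro far_dist)
    then have "min 1 (norm (x - y) / d) = 1" using d by (simp add: min_def)
    then show ?thesis using 3 Psi_bounded[of z t] c1(3) by (simp add: z)
  next
    case 4
    then have "d \<le> norm (y - x)" by (intro far_dist)
    then have "min 1 (norm (x - y) / d) = 1" using d by (simp add: min_def norm_minus_commute)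
    then show ?thesis using 4 Psi_bounded[of z t] c1(3) by (simp add: z)
  qed
qed

lemma Psi_powr_le: "\<bar>Psi z t\<bar> powr p * fker s p (fst z - snd z) \<le> C2 * (en z t + tail z)"
proof -
  define m where "m = (if fst z \<in> B' \<or> snd z \<in> B' then min 1 (norm (fst z - snd z) / d) else 0)"
  define u where "u = indicator (B' \<times> B') z * \<bar>U (fst z) t - U (snd z) t\<bar>"
  have m0: "0 \<le> m" using d by (simp add: m_def)
  have u0: "0 \<le> u" by (simp add: u_def)
  have "\<bar>Psi z t\<bar> powr p \<le> (C1 * (u + m)) powr p"
    by (rule powr_mono2) (use Psi_le[of z t] p in \<open>auto simp: u_def m_def\<close>)
  also have "\<dots> = C1 powr p * (u + m) powr p" by (rule powr_mult)
  also have "\<dots> \<le> C1 powr p * (2 powr (p - 1) * (u powr p + m powr p))"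
    by (intro mult_left_mono powr_add_le) (use p m0 u0 in auto)
  finally have "\<bar>Psi z t\<bar> powr p * fker s p (fst z - snd z) \<le> C2 * ((u powr p + m powr p)) * fker s p (fst z - snd z)"
    by (intro mult_right_mono) (auto simp: C2_def)
  also have "\<dots> = C2 * (u powr p * fker s p (fst z - snd z) + m powr p * fker s p (fst z - snd z))"
    by (simp add: algebra_simps)
  also have "\<dots> \<le> C2 * (en z t + tail z)"
  proof (intro mult_left_mono add_mono C_nonneg)
    show "u powr p * fker s p (fst z - snd z) \<le> en z t"
      using p by (auto simp: u_def en_def indicator_def)
    show "m powr p * fker s p (fst z - snd z) \<le> tail z"
      using p by (auto simp: m_def tail_def tailker_def cutker_def indicator_def)
  qed
  finally show ?thesis .
qed

lemma flux_Psi_le: "\<bar>flux z u\<bar> * \<bar>Psi z t\<bar> \<le> CF * (en z u + en z t + tail z)"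
proof -
  obtain x y where z: "z = (x, y)" by fastforce
  define w where "w = fker s p (x - y)"
  have "\<bar>flux z u\<bar> * \<bar>Psi z t\<bar> \<le> \<bar>U x u - U y u\<bar> powr (p - 1) * (\<Lambda> * w) * \<bar>Psi z t\<bar>"
    using abs_flux_le[of z u] by (intro mult_right_mono) (auto simp: z w_def)
  also have "\<dots> = \<Lambda> * (\<bar>U x u - U y u\<bar> powr (p - 1) * \<bar>psi t x - psi t y\<bar> * w)"
    by (simp add: z Psi_def)
  also have "\<dots> \<le> \<Lambda> * (en z u + \<bar>Psi z t\<bar> powr p * w + M powr (p - 1) * \<rho> powr (- e) * tail z)"
    using flux_bound[where p=p and d=d and R="R + d" and R'="R + 2 * d" and \<psi>="psi t" and b="\<rho> powr (- e)"
        and ?x0.0=x0 and c="U x u - U y u" and M=M and s=s and x=x and y=y]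
      p d psi_range psi_eq_0 U_diff_le Lam
    by (intro mult_left_mono) (auto simp: z Psi_def en_def w_def tail_def B'_def mult.assoc)
  also have "\<dots> \<le> \<Lambda> * (en z u + C2 * (en z t + tail z) + M powr (p - 1) * \<rho> powr (- e) * tail z)"
    using Psi_powr_le[of z t] Lam by (intro mult_left_mono add_mono) (auto simp: z w_def)
  also have "\<dots> \<le> \<Lambda> * ((1 + C2 + M powr (p - 1) * \<rho> powr (- e)) * (en z u + en z t + tail z))"
  proof (intro mult_left_mono)
    define m where "m = M powr (p - 1) * \<rho> powr (- e)"
    have nn: "0 \<le> m" "0 \<le> C2" by (auto simp: m_def C_nonneg)
    have "0 \<le> C2 * en z u + m * en z u + en z t + m * en z t + tail z"
      by (intro add_nonneg_nonneg mult_nonneg_nonneg nn) auto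
    then show "en z u + C2 * (en z t + tail z) + M powr (p - 1) * \<rho> powr (- e) * tail z
      \<le> (1 + C2 + M powr (p - 1) * \<rho> powr (- e)) * (en z u + en z t + tail z)"
      unfolding m_def[symmetric] by (simp add: algebra_simps)
  qed (use Lam in auto)
  finally show ?thesis by (simp add: CF_def mult.assoc)
qed


lemma en_bounded: "\<bar>en z t\<bar> \<le> M powr p * fker s p (fst z - snd z)"
proof -
  have "\<bar>U (fst z) t - U (snd z) t\<bar> powr p \<le> M powr p"
    by (rule powr_mono2) (use p U_diff_le in auto)
  then have "\<bar>U (fst z) t - U (snd z) t\<bar> powr p * fker s p (fst z - snd z) \<le> M powr p * fker s p (fst z - snd z)"
    by (rule mult_right_mono) auto
  then show ?thesis by (auto simp: en_def indicator_def)
qed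

lemma En_nonneg [simp]: "0 \<le> En z"
  unfolding En_def set_lebesgue_integral_def by (intro integral_nonneg_AE) auto

lemma set_integral_en_le:
  assumes "t0 \<le> c" "c' \<le> t1"
  shows "(LINT t:{c..c'}|lborel. en z t) \<le> En z"
  unfolding En_def set_lebesgue_integral_def
  by (intro integral_mono set_integrable_Icc_bounded[OF _ en_bounded, unfolded set_integrable_def])
     (use assms in \<open>auto simp: indicator_def\<close>)

lemma En_measurable [measurable]: "En \<in> borel_measurable borel"
proof -
  have "(\<lambda>w. indicator {t0..t1} (snd w) *\<^sub>R en (fst w) (snd w)) \<in> borel_measurable borel"
    by measurable
  from borel_measurable_lborel_integral[OF this] show ?thesis
    unfolding En_def set_lebesgue_integral_def by simp
qed

lemma nn_integral_En: "(\<integral>\<^sup>+z. En z \<partial>lborel) < \<infinity>"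
proof -
  define F where "F w = ennreal (indicator {t0..t1} (snd w) * en (fst w) (snd w))"
    for w :: "'a points \<times> real"
  have F: "F \<in> borel_measurable borel" unfolding F_def by measurable
  have "(\<integral>\<^sup>+z. En z \<partial>lborel) = (\<integral>\<^sup>+z. \<integral>\<^sup>+t. F (z, t) \<partial>lborel \<partial>lborel)"
  proof (rule nn_integral_cong)
    fix z
    have "(\<integral>\<^sup>+t. ennreal (indicator {t0..t1} t * en z t) \<partial>lborel) = ennreal (\<integral>t. indicator {t0..t1} t * en z t \<partial>lborel)"
      by (rule nn_integral_eq_integral)
         (use set_integrable_Icc_bounded[OF _ en_bounded, of z] in \<open>auto simp: set_integrable_def\<close>)
    then show "ennreal (En z) = (\<integral>\<^sup>+t. F (z, t) \<partial>lborel)"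
      by (simp add: F_def En_def set_lebesgue_integral_def)
  qed
  also have "\<dots> = (\<integral>\<^sup>+t. \<integral>\<^sup>+z. F (z, t) \<partial>lborel \<partial>lborel)"
    using nn_integral_lborel_pair[OF F] by simp
  also have "\<dots> < \<infinity>"
    using energy_finite[OF Rd] by (simp add: F_def en_def B'_def mult.assoc)
  finally show ?thesis .
qed

lemma integrable_En: "integrable lborel En"
  by (rule integrableI_nonneg) (use nn_integral_En in auto)

lemma integrable_tail: "integrable lborel tail"
proof (rule integrableI_nonneg)
  show "(\<integral>\<^sup>+z. tail z \<partial>lborel) < \<infinity>" unfolding tail_def B'_def
    by (rule nn_integral_tailker_finite) (use p s d in auto)
qed auto

text \<open>The majorant for the limit \<open>h \<rightarrow> 0\<close>: it bounds the time integral
  of \<open>\<bar>Q h z t\<bar> / h\<close> for all admissible \<open>h\<close>. The energy counts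
  twice, once for the flux and once for the test function.\<close>

definition "Gd z = CF * (2 * En z + (t1 - t0) * tail z)"

lemma integrable_Gd: "integrable lborel Gd"
  unfolding Gd_def by (intro Bochner_Integration.integrable_mult_right Bochner_Integration.integrable_add integrable_En integrable_tail)

section \<open>Testing on short time intervals with the test function frozen at the later
  end\<close>

definition "Q h z t = (LINT \<tau>:{t..t + h}|lborel. flux z \<tau>) * Psi z (t + h)"

lemma Q_measurable [measurable (raw)]:
  assumes "f \<in> borel_measurable N" "g \<in> borel_measurable N"
  shows "(\<lambda>w. Q h (f w) (g w)) \<in> borel_measurable N"
proof -
  have "(\<lambda>w. (if snd (fst w) \<le> snd w \<and> snd w \<le> snd (fst w) + h then flux (fst (fst w)) (snd w) else 0))
    \<in> borel_measurable (borel :: (('a points \<times> real) \<times> real) measure)"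
    by measurable
  from borel_measurable_lborel_integral[OF this]
  have "(\<lambda>w. LINT \<tau>:{snd w..snd w + h}|lborel. flux (fst w) \<tau>) \<in> borel_measurable (borel :: ('a points \<times> real) measure)"
    unfolding set_lebesgue_integral_def
    by (rule subst[of _ _ "\<lambda>f. f \<in> _", rotated]) (auto simp: indicator_def intro!: ext Bochner_Integration.integral_cong)
  then have "(\<lambda>w. Q h (fst w) (snd w)) \<in> borel_measurable (borel :: ('a points \<times> real) measure)"
    unfolding Q_def by measurable
  from measurable_compose[OF borel_measurable_Pair[OF assms] this] show ?thesis by simp
qed

lemma abs_Q_le:
  assumes "0 \<le> h"
  shows "\<bar>Q h z t\<bar> \<le> CF * ((LINT \<tau>:{t..t + h}|lborel. en z \<tau>) + h * (en z (t + h) + tail z))"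
proof -
  note si = set_integrable_Icc_bounded
  define Bf where "Bf = M powr (p - 1) * (\<Lambda> * fker s p (fst z - snd z))"
  have fi: "set_integrable lborel {t..t + h} (flux z)"
    by (rule si[where B = Bf]) (use flux_bounded in \<open>auto simp: Bf_def\<close>)
  have ei: "set_integrable lborel {t..t + h} (en z)"
    by (rule si[OF _ en_bounded]) auto
  have ci: "set_integrable lborel {t..t + h} (\<lambda>_. c)" for c :: real
    by (rule si[where B = "\<bar>c\<bar>"]) auto
  have "\<bar>Q h z t\<bar> \<le> (LINT \<tau>:{t..t + h}|lborel. \<bar>flux z \<tau>\<bar>) * \<bar>Psi z (t + h)\<bar>"
    unfolding Q_def abs_mult using set_integral_norm_bound[OF fi] by (intro mult_right_mono) auto
  also have "\<dots> = (LINT \<tau>:{t..t + h}|lborel. \<bar>flux z \<tau>\<bar> * \<bar>Psi z (t + h)\<bar>)"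
    by simp
  also have "\<dots> \<le> (LINT \<tau>:{t..t + h}|lborel. CF * (en z \<tau> + (en z (t + h) + tail z)))"
  proof (rule set_integral_mono)
    show "set_integrable lborel {t..t + h} (\<lambda>\<tau>. \<bar>flux z \<tau>\<bar> * \<bar>Psi z (t + h)\<bar>)"
      using set_integrable_abs[OF fi] by simp
    show "set_integrable lborel {t..t + h} (\<lambda>\<tau>. CF * (en z \<tau> + (en z (t + h) + tail z)))"
      by (intro set_integrable_mult_right set_integral_add ei ci)
    show "\<bar>flux z \<tau>\<bar> * \<bar>Psi z (t + h)\<bar> \<le> CF * (en z \<tau> + (en z (t + h) + tail z))" for \<tau>
      using flux_Psi_le[of z \<tau> "t + h"] by (simp add: add.assoc)
  qed
  also have "\<dots> = CF * ((LINT \<tau>:{t..t + h}|lborel. en z \<tau>) + h * (en z (t + h) + tail z))"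
    using assms by (simp add: set_integral_add(2)[OF ei ci] set_integral_Icc_const)
  finally show ?thesis .
qed

lemma Q_bounded:
  assumes "0 \<le> h"
  shows "\<bar>Q h z t\<bar> \<le> h * (M powr (p - 1) * (\<Lambda> * fker s p (fst z - snd z))) * \<rho> powr (- e)"
  unfolding Q_def abs_mult
  using set_integral_Icc_bound[of "flux z" "M powr (p - 1) * (\<Lambda> * fker s p (fst z - snd z))" t "t + h"]
    flux_bounded[of z] assms Lam
  by (intro mult_mono Psi_bounded) auto

text \<open>The bound \<open>abs_Q_le\<close> has a Steklov window in its first part and an explicit
  \<open>h\<close> in the rest; \<open>steklov_sum_le\<close> turns the former into another factor
  \<open>h\<close>. The condition \<open>c' + h \<le> t1\<close> keeps windows and shifted times
  inside the range of \<open>En\<close>.\<close>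

lemma set_integral_abs_Q_le:
  assumes "t0 \<le> c" "c \<le> c'" "c' + h \<le> t1" "0 \<le> h"
  shows "(LINT t:{c..c'}|lborel. \<bar>Q h z t\<bar>) \<le> h * Gd z"
proof -
  define Bf where "Bf = M powr p * fker s p (fst z - snd z)"
  have Bf: "\<bar>en z t\<bar> \<le> Bf" for t using en_bounded by (simp add: Bf_def)
  define S where "S t = (LINT \<tau>:{t..t + h}|lborel. en z \<tau>)" for t
  have Smeas: "S \<in> borel_measurable borel"
    unfolding S_def[abs_def] by (rule steklov_measurable) measurable
  have SB: "\<bar>S t\<bar> \<le> h * Bf" for t
    using set_integral_Icc_bound[of "en z" Bf t "t + h"] Bf assms by (simp add: S_def)
  have i1: "set_integrable lborel {c..c'} S"
    by (rule set_integrable_Icc_bounded[OF Smeas SB])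
  have i2: "set_integrable lborel {c..c'} (\<lambda>t. en z (t + h))"
    by (rule set_integrable_Icc_bounded[OF _ Bf]) measurable
  have i3: "set_integrable lborel {c..c'} (\<lambda>_. tail z)"
    by (rule set_integrable_Icc_bounded[where B = "tail z"]) auto
  have i4: "set_integrable lborel {c..c'} (\<lambda>t. \<bar>Q h z t\<bar>)"
    by (rule set_integrable_abs, rule set_integrable_Icc_bounded[OF _ Q_bounded]) (use assms in auto)
  have i23: "set_integrable lborel {c..c'} (\<lambda>t. h * (en z (t + h) + tail z))"
    by (intro set_integrable_mult_right set_integral_add i2 i3)
  have "(LINT t:{c..c'}|lborel. \<bar>Q h z t\<bar>) \<le> (LINT t:{c..c'}|lborel. CF * (S t + h * (en z (t + h) + tail z)))"
    by (intro set_integral_mono i4 set_integrable_mult_right set_integral_add i1 i23)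
       (use abs_Q_le[of h z] assms in \<open>auto simp: S_def\<close>)
  also have "\<dots> = CF * ((LINT t:{c..c'}|lborel. S t) + h * ((LINT t:{c..c'}|lborel. en z (t + h)) + (c' - c) * tail z))"
    using assms by (simp add: set_integral_add(2)[OF i1 i23] set_integral_add(2)[OF i2 i3] set_integral_Icc_const)
  also have "\<dots> \<le> CF * (h * En z + h * (En z + (t1 - t0) * tail z))"
  proof (intro mult_left_mono add_mono mult_right_mono C_nonneg)
    have "(LINT t:{c..c'}|lborel. S t) \<le> h * (LINT t:{c..c' + h}|lborel. en z t)"
      unfolding S_def by (rule steklov_sum_le[OF _ Bf]) (use assms in auto)
    also have "\<dots> \<le> h * En z"
      by (intro mult_left_mono set_integral_en_le) (use assms in auto)
    finally show "(LINT t:{c..c'}|lborel. S t) \<le> h * En z" .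
    show "(LINT t:{c..c'}|lborel. en z (t + h)) \<le> En z"
      using set_integral_shift[of c c' "en z" h] set_integral_en_le[of "c + h" "c' + h" z] assms by simp
  qed (use assms in auto)
  also have "\<dots> = h * Gd z" by (simp add: Gd_def algebra_simps)
  finally show ?thesis .
qed

lemma eta_powr_indicator: "eta x powr p \<le> indicator B' x"
  using eta_eq_0[of x] d p by (auto simp: indicator_def B'_def)

text \<open>The maximum covers both signs of the exponent \<open>c\<close>.\<close>

lemma mass_integrand_bound: "\<bar>U x t powr c * eta x powr p\<bar> \<le> max (M powr c) (\<rho> powr c) * indicator B' x"
proof -
  have "U x t powr c \<le> max (M powr c) (\<rho> powr c)"
  proof (cases "0 \<le> c")
    case True
    then have "U x t powr c \<le> M powr c" by (intro powr_mono2) (auto simp: U_le)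
    then show ?thesis by simp
  next
    case False
    then have "U x t powr c \<le> \<rho> powr c" by (intro powr_mono2') (use rho U_ge in auto)
    then show ?thesis by simp
  qed
  moreover have "0 \<le> max (M powr c) (\<rho> powr c)" by (simp add: le_max_iff_disj)
  ultimately show ?thesis using eta_powr_indicator[of x]
    by (auto simp: abs_mult intro!: mult_mono)
qed

lemma integrable_B': "integrable lborel (indicator B' :: real ^ 'a \<Rightarrow> real)"
  by (rule integrable_real_indicator) (use emeasure_bounded_finite[of B'] in \<open>auto simp: B'_def\<close>)

lemma integrable_U_eta: "integrable lborel (\<lambda>x. U x t powr c * eta x powr p)"
proof (rule Bochner_Integration.integrable_bound)
  show "integrable lborel (\<lambda>x. max (M powr c) (\<rho> powr c) * indicator B' x)"
    by (intro Bochner_Integration.integrable_mult_right integrable_B')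
  show "AE x in lborel. norm (U x t powr c * eta x powr p) \<le> norm (max (M powr c) (\<rho> powr c) * indicator B' x)"
    using mass_integrand_bound[of _ t c] by (auto simp: le_max_iff_disj intro!: AE_I2 order_trans[OF _ abs_ge_self])
qed measurable

definition "massB = max (M powr a) (\<rho> powr a) * measure lborel B'"

lemma mass_measurable [measurable]: "mass \<in> borel_measurable borel"
proof -
  have "(\<lambda>w. U (snd w) (fst w) powr a * eta (snd w) powr p) \<in> borel_measurable (borel :: (real \<times> (real ^ 'a)) measure)"
    by measurable
  from borel_measurable_lborel_integral[OF this] show ?thesis by (simp add: mass_def[abs_def])
qed

lemma mass_nonneg [simp]: "0 \<le> mass t"
  unfolding mass_def by (intro integral_nonneg_AE) auto

lemma mass_bounded: "\<bar>mass t\<bar> \<le> massB"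
proof -
  have "mass t \<le> (\<integral>x. max (M powr a) (\<rho> powr a) * indicator B' x \<partial>lborel)"
    unfolding mass_def using mass_integrand_bound[of _ t a]
    by (intro integral_mono integrable_U_eta Bochner_Integration.integrable_mult_right integrable_B')
       (auto simp: abs_le_iff)
  also have "\<dots> = massB" using integrable_B' by (simp add: massB_def)
  finally show ?thesis by simp
qed

text \<open>Concavity of \<open>w \<mapsto> w powr (a / (p - 1))\<close>, tested at the later time, points the right way for
  supersolutions.\<close>

lemma time_term_le:
  "(\<integral>x. (U x t' powr (p - 1) - U x t powr (p - 1)) * psi t' x \<partial>lborel) \<le> (p - 1) / a * (mass t' - mass t)"
proof -
  have pw: "(A powr (p - 1) - B powr (p - 1)) * A powr (- e) \<le> (p - 1) / a * (A powr a - B powr a)"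
    if "0 < A" "0 < B" for A B :: real
  proof -
    define y where "y = (B / A) powr (p - 1)"
    have y: "0 < y" using that by (simp add: y_def)
    have "y powr (a / (p - 1)) \<le> 1 + a / (p - 1) * (y - 1)"
      by (rule powr_le_affine) (use y a e ae in auto)
    moreover have "y powr (a / (p - 1)) = (B / A) powr a" using p by (simp add: y_def powr_powr)
    ultimately have "1 - y \<le> (p - 1) / a * (1 - (B / A) powr a)" using a p by (simp add: field_simps)
    then have "A powr a * (1 - y) \<le> A powr a * ((p - 1) / a * (1 - (B / A) powr a))"
      by (rule mult_left_mono) simp
    moreover have "A powr a * (1 - y) = (A powr (p - 1) - B powr (p - 1)) * A powr (- e)"
    proof -
      have "A powr a = A powr (p - 1) * A powr (- e)"
        using ae by (simp flip: powr_add) (metis add_diff_cancel_right')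
      then have "A powr a * (1 - y) = (A powr (p - 1) - A powr (p - 1) * y) * A powr (- e)"
        by (simp add: algebra_simps)
      also have "A powr (p - 1) * y = B powr (p - 1)"
        using that by (simp add: y_def flip: powr_mult)
      finally show ?thesis .
    qed
    moreover have "A powr a * ((p - 1) / a * (1 - (B / A) powr a)) = (p - 1) / a * (A powr a - B powr a)"
    proof -
      have "A powr a * ((p - 1) / a * (1 - (B / A) powr a)) = (p - 1) / a * (A powr a - A powr a * (B / A) powr a)"
        by (simp add: algebra_simps)
      also have "A powr a * (B / A) powr a = B powr a" using that by (simp flip: powr_mult)
      finally show ?thesis .
    qed
    ultimately show ?thesis by (simp only:)
  qed
  have i1: "integrable lborel (\<lambda>x. (U x t' powr (p - 1) - U x t powr (p - 1)) * psi t' x)"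
  proof (rule Bochner_Integration.integrable_bound)
    show "integrable lborel (\<lambda>x. (M powr (p - 1) * \<rho> powr (- e)) * indicator B' x)"
      by (intro Bochner_Integration.integrable_mult_right integrable_B')
    show "AE x in lborel. norm ((U x t' powr (p - 1) - U x t powr (p - 1)) * psi t' x) \<le> norm ((M powr (p - 1) * \<rho> powr (- e)) * indicator B' x)"
    proof (intro AE_I2)
      fix x
      have "U x t powr (p - 1) \<le> M powr (p - 1)" for t
        by (rule powr_mono2) (use p U_le in auto)
      then have u: "\<bar>U x t' powr (p - 1) - U x t powr (p - 1)\<bar> \<le> M powr (p - 1)"
        by (simp add: abs_le_iff) (smt (verit) powr_ge_zero)
      have "psi t' x \<le> \<rho> powr (- e) * indicator B' x"
        using psi_eq_0[of x t'] psi_range[of t' x] d by (auto simp: B'_def indicator_def)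
      with u show "norm ((U x t' powr (p - 1) - U x t powr (p - 1)) * psi t' x) \<le> norm ((M powr (p - 1) * \<rho> powr (- e)) * indicator B' x)"
        using psi_range[of t' x] by (auto simp: abs_mult mult.assoc intro!: mult_mono)
    qed
  qed measurable
  have "(\<integral>x. (U x t' powr (p - 1) - U x t powr (p - 1)) * psi t' x \<partial>lborel)
    \<le> (\<integral>x. (p - 1) / a * (U x t' powr a * eta x powr p - U x t powr a * eta x powr p) \<partial>lborel)"
  proof (intro integral_mono i1 Bochner_Integration.integrable_mult_right Bochner_Integration.integrable_diff integrable_U_eta)
    fix x
    have "(U x t' powr (p - 1) - U x t powr (p - 1)) * U x t' powr (- e) * eta x powr p
       \<le> (p - 1) / a * (U x t' powr a - U x t powr a) * eta x powr p"
      by (intro mult_right_mono pw) auto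
    then show "(U x t' powr (p - 1) - U x t powr (p - 1)) * psi t' x
      \<le> (p - 1) / a * (U x t' powr a * eta x powr p - U x t powr a * eta x powr p)"
      by (simp add: psi_def algebra_simps)
  qed
  also have "\<dots> = (p - 1) / a * (mass t' - mass t)"
    by (simp add: mass_def Bochner_Integration.integral_diff[OF integrable_U_eta integrable_U_eta])
  finally show ?thesis .
qed

text \<open>Finite local energy of the slice is what makes \<open>psi t\<close> an admissible test
  function; \<open>AE_en_finite\<close> provides it at almost every time.\<close>

lemma psi_seminorm_finite:
  assumes "En_fin": "(\<integral>\<^sup>+z. en z t \<partial>lborel) < \<infinity>"
  shows "(\<integral>\<^sup>+z. \<bar>psi t (fst z) - psi t (snd z)\<bar> powr p * fker s p (fst z - snd z) \<partial>lborel) < \<infinity>"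
proof -
  have "(\<integral>\<^sup>+z. \<bar>psi t (fst z) - psi t (snd z)\<bar> powr p * fker s p (fst z - snd z) \<partial>lborel)
    \<le> (\<integral>\<^sup>+z. ennreal C2 * (ennreal (en z t) + ennreal (tail z)) \<partial>lborel)"
  proof (rule nn_integral_mono)
    fix z
    have "\<bar>psi t (fst z) - psi t (snd z)\<bar> powr p * fker s p (fst z - snd z) \<le> C2 * (en z t + tail z)"
      using Psi_powr_le[of z t] by (simp add: Psi_def)
    then show "ennreal (\<bar>psi t (fst z) - psi t (snd z)\<bar> powr p * fker s p (fst z - snd z)) \<le> ennreal C2 * (ennreal (en z t) + ennreal (tail z))"
      by (simp add: ennreal_mult'[symmetric] C_nonneg ennreal_leI flip: ennreal_plus)
  qed
  also have "\<dots> = ennreal C2 * ((\<integral>\<^sup>+z. en z t \<partial>lborel) + (\<integral>\<^sup>+z. tail z \<partial>lborel))"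
    by (simp add: nn_integral_cmult nn_integral_add)
  also have "\<dots> < \<infinity>"
    using assms integrable_tail by (simp add: ennreal_mult_less_top integrable_iff_bounded)
  finally show ?thesis .
qed


lemma AE_en_finite: "AE t in lborel. t \<in> {t0..t1} \<longrightarrow> (\<integral>\<^sup>+z. en z t \<partial>lborel) < \<infinity>"
proof -
  define F where "F w = ennreal (indicator {t0..t1} (fst w) * en (snd w) (fst w))"
    for w :: "real \<times> 'a points"
  have F: "F \<in> borel_measurable borel" unfolding F_def by measurable
  have Fm: "(\<lambda>t. \<integral>\<^sup>+z. F (t, z) \<partial>lborel) \<in> borel_measurable lborel"
  proof -
    have "(\<lambda>(t, z). F (t, z)) \<in> borel_measurable (borel \<Otimes>\<^sub>M (lborel :: 'a points measure))"
      using F by (simp add: split_beta' borel_prod cong: measurable_cong_sets) (simp add: borel_prod)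
    then show ?thesis using lborel.borel_measurable_nn_integral by auto
  qed
  have "(\<integral>\<^sup>+t. \<integral>\<^sup>+z. F (t, z) \<partial>lborel \<partial>lborel) < \<infinity>"
    using energy_finite[OF Rd] by (simp add: F_def en_def B'_def mult.assoc)
  then have "AE t in lborel. (\<integral>\<^sup>+z. F (t, z) \<partial>lborel) \<noteq> \<infinity>"
    by (intro nn_integral_noteq_infinite Fm) auto
  then show ?thesis
  proof eventually_elim
    case (elim t)
    show ?case
    proof
      assume "t \<in> {t0..t1}"
      then have "(\<integral>\<^sup>+z. F (t, z) \<partial>lborel) = (\<integral>\<^sup>+z. en z t \<partial>lborel)" by (simp add: F_def)
      with elim show "(\<integral>\<^sup>+z. en z t \<partial>lborel) < \<infinity>" by (simp only: infinity_ennreal_def less_top)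
    qed
  qed
qed

lemma integrable_Q:
  assumes "t0 \<le> c" "c \<le> c'" "c' + h \<le> t1" "0 \<le> h"
  shows "integrable lborel (\<lambda>w. indicator {c..c'} (snd w) * Q h (fst w) (snd w))"
proof (rule integrable_lborel_pairI)
  show "(\<lambda>w. indicator {c..c'} (snd w) * Q h (fst w) (snd w)) \<in> borel_measurable (borel :: ('a points \<times> real) measure)"
    by measurable
  have m: "(\<lambda>w. indicator {c..c'} (snd w) * \<bar>Q h (fst w) (snd w)\<bar>) \<in> borel_measurable (borel :: ('a points \<times> real) measure)"
    by measurable
  have "integrable lborel (\<lambda>z. LINT t:{c..c'}|lborel. \<bar>Q h z t\<bar>)"
  proof (rule Bochner_Integration.integrable_bound)
    show "integrable lborel (\<lambda>z. h * Gd z)"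
      by (intro Bochner_Integration.integrable_mult_right integrable_Gd)
    show "(\<lambda>z. LINT t:{c..c'}|lborel. \<bar>Q h z t\<bar>) \<in> borel_measurable lborel"
      using borel_measurable_lborel_integral[OF m] by (simp add: set_lebesgue_integral_def)
    have nn: "0 \<le> (LINT t:{c..c'}|lborel. \<bar>Q h z t\<bar>)" for z
      unfolding set_lebesgue_integral_def by (intro integral_nonneg_AE) auto
    show "AE z in lborel. norm (LINT t:{c..c'}|lborel. \<bar>Q h z t\<bar>) \<le> norm (h * Gd z)"
      using nn set_integral_abs_Q_le[OF assms] by (intro AE_I2) (auto simp: abs_of_nonneg intro: order_trans[OF _ abs_ge_self])
  qed
  then show "integrable lborel (\<lambda>z. \<integral>t. \<bar>indicator {c..c'} (snd (z, t)) * Q h (fst (z, t)) (snd (z, t))\<bar> \<partial>lborel)"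
    by (simp add: set_lebesgue_integral_def abs_mult)
  have "set_integrable lborel {c..c'} (Q h z)" for z
    by (rule set_integrable_Icc_bounded[OF _ Q_bounded]) (use assms in auto)
  then show "AE z in lborel. integrable lborel (\<lambda>t. indicator {c..c'} (snd (z, t)) * Q h (fst (z, t)) (snd (z, t)))"
    by (intro AE_I2) (simp add: set_integrable_def)
qed

text \<open>For fixed \<open>h\<close>, almost every \<open>t\<close> satisfies three conditions:
  \<open>t\<close> and \<open>t + h\<close> avoid the exceptional times, and the slice at
  \<open>t + h\<close> has finite energy. The last two are translates of conditions that hold almost
  everywhere.\<close>

lemma tested_at_t:
  assumes "0 < h"
  shows "AE t in lborel. t0 < t \<and> t + h < t1 \<longrightarrow>
    0 \<le> (p - 1) / a * (mass (t + h) - mass t) + (\<integral>z. Q h z t \<partial>lborel)"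
proof -
  obtain N where N: "N \<in> null_sets lborel" and sup: "\<forall>b b' \<psi>. b \<notin> N \<and> b' \<notin> N \<and> t0 < b \<and> b < b' \<and> b' < t1 \<and>
         admissible_test s p r x0 \<psi> \<longrightarrow>
         0 \<le> (\<integral>x. (U x b' powr (p - 1) - U x b powr (p - 1)) * \<psi> x \<partial>lborel)
           + (\<integral>z. (LINT \<tau>:{b..b'}|lborel. cdn p (U (fst z) \<tau> - U (snd z) \<tau>) * k (fst z) (snd z) \<tau>)
                * (\<psi> (fst z) - \<psi> (snd z)) \<partial>lborel)"
    using supersolution by (rule bexE)
  have NAE: "AE t in lborel. t \<notin> N" by (rule AE_not_in[OF N])
  have Nm: "Measurable.pred borel (\<lambda>t. t \<notin> N)" using N by (auto simp: null_sets_def)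
  have "AE t in lborel. h + 1 * t \<notin> N" by (rule AE_borel_affine[OF _ Nm NAE]) simp
  moreover have "AE t in lborel. h + 1 * t \<in> {t0..t1} \<longrightarrow> (\<integral>\<^sup>+z. en z (h + 1 * t) \<partial>lborel) < \<infinity>"
  proof (rule AE_borel_affine[OF _ _ AE_en_finite])
    have "(\<lambda>(t, z). ennreal (en z t)) \<in> borel_measurable (borel \<Otimes>\<^sub>M (lborel :: 'a points measure))"
    proof -
      have "(\<lambda>w. ennreal (en (snd w) (fst w))) \<in> borel_measurable (borel :: (real \<times> 'a points) measure)"
        by measurable
      then show ?thesis by (simp add: split_beta' borel_prod cong: measurable_cong_sets)
    qed
    then have [measurable]: "(\<lambda>t. \<integral>\<^sup>+z. en z t \<partial>lborel) \<in> borel_measurable borel"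
      by (rule lborel.borel_measurable_nn_integral)
    show "Measurable.pred borel (\<lambda>t. t \<in> {t0..t1} \<longrightarrow> (\<integral>\<^sup>+z. en z t \<partial>lborel) < \<infinity>)"
      by measurable
  qed simp
  ultimately show ?thesis using NAE
  proof eventually_elim
    case (elim t)
    show ?case
    proof
      assume t: "t0 < t \<and> t + h < t1"
      have "0 \<le> (\<integral>x. (U x (t + h) powr (p - 1) - U x t powr (p - 1)) * psi (t + h) x \<partial>lborel)
           + (\<integral>z. (LINT \<tau>:{t..t + h}|lborel. cdn p (U (fst z) \<tau> - U (snd z) \<tau>) * k (fst z) (snd z) \<tau>)
                * (psi (t + h) (fst z) - psi (t + h) (snd z)) \<partial>lborel)"
      proof (rule sup[rule_format], intro conjI)
        have "(\<integral>\<^sup>+z. en z (t + h) \<partial>lborel) < \<infinity>" using elim(2) t assms by (simp add: add.commute)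
        note fin = psi_seminorm_finite[OF this]
        show "admissible_test s p r x0 (psi (t + h))"
          unfolding admissible_test_def
        proof (intro conjI fin)
          show "\<exists>R<r. \<forall>x. x \<notin> ball x0 R \<longrightarrow> psi (t + h) x = 0"
            using psi_eq_0 Rd d by (intro exI[of _ "R + d"]) auto
          show "\<exists>c. \<forall>x. 0 \<le> psi (t + h) x \<and> psi (t + h) x \<le> c" using psi_range by blast
        qed measurable
      qed (use elim t assms in \<open>auto simp: add.commute\<close>)
      also have "(\<integral>z. (LINT \<tau>:{t..t + h}|lborel. cdn p (U (fst z) \<tau> - U (snd z) \<tau>) * k (fst z) (snd z) \<tau>)
                * (psi (t + h) (fst z) - psi (t + h) (snd z)) \<partial>lborel) = (\<integral>z. Q h z t \<partial>lborel)"
        by (simp add: Q_def flux_def Psi_def)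
      finally show "0 \<le> (p - 1) / a * (mass (t + h) - mass t) + (\<integral>z. Q h z t \<partial>lborel)"
        using time_term_le[of "t + h" t] by linarith
    qed
  qed
qed

text \<open>The integral of \<open>mass (t + h) - mass t\<close> over \<open>[c, c']\<close>
  telescopes to two integrals over windows of length \<open>h\<close>, which after division by
  \<open>h\<close> are Steklov averages at \<open>c'\<close> and \<open>c\<close>.\<close>

lemma tested_integrated:
  assumes "t0 < c" "c \<le> c'" "c' + h < t1" "0 < h"
  shows "0 \<le> (p - 1) / a * ((LINT t:{c'..c' + h}|lborel. mass t) - (LINT t:{c..c + h}|lborel. mass t))
      + (\<integral>z. (LINT t:{c..c'}|lborel. Q h z t) \<partial>lborel)"
proof -
  note si = set_integrable_Icc_bounded[OF _ mass_bounded]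
  have iQ: "integrable lborel (\<lambda>w. indicator {c..c'} (snd w) * Q h (fst w) (snd w))"
    by (rule integrable_Q) (use assms in auto)
  define Y where "Y t = (\<integral>z. Q h z t \<partial>lborel)" for t
  have Yi: "set_integrable lborel {c..c'} Y"
    using integral_lborel_pair_swap(2)[OF iQ] by (simp add: set_integrable_def Y_def)
  have Yeq: "(LINT t:{c..c'}|lborel. Y t) = (\<integral>z. (LINT t:{c..c'}|lborel. Q h z t) \<partial>lborel)"
    using integral_lborel_pair_swap(1)[OF iQ] by (simp add: set_lebesgue_integral_def Y_def)
  have m1: "set_integrable lborel {c..c'} mass" by (rule si) measurable
  have m2: "set_integrable lborel {c..c'} (\<lambda>t. mass (t + h))" 
    by (rule set_integrable_Icc_bounded[OF _ mass_bounded]) measurable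
  have m3: "set_integrable lborel {c..c'} (\<lambda>t. (p - 1) / a * (mass (t + h) - mass t))"
    by (intro set_integrable_mult_right set_integral_diff m1 m2)
  have "0 \<le> (LINT t:{c..c'}|lborel. (p - 1) / a * (mass (t + h) - mass t) + Y t)"
    unfolding set_lebesgue_integral_def
  proof (rule integral_nonneg_AE)
    show "AE t in lborel. 0 \<le> indicator {c..c'} t *\<^sub>R ((p - 1) / a * (mass (t + h) - mass t) + Y t)"
      using tested_at_t[OF assms(4)]
      by eventually_elim (use assms in \<open>auto simp: indicator_def Y_def\<close>)
  qed
  also have "\<dots> = (p - 1) / a * ((LINT t:{c..c'}|lborel. mass (t + h)) - (LINT t:{c..c'}|lborel. mass t)) + (LINT t:{c..c'}|lborel. Y t)"
    by (simp only: set_integral_add(2)[OF m3 Yi] set_integral_mult_right set_integral_diff(2)[OF m2 m1])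
  also have "(LINT t:{c..c'}|lborel. mass (t + h)) = (LINT t:{c + h..c' + h}|lborel. mass t)"
    by (rule set_integral_shift)
  also have "\<dots> - (LINT t:{c..c'}|lborel. mass t) = (LINT t:{c'..c' + h}|lborel. mass t) - (LINT t:{c..c + h}|lborel. mass t)"
    using set_integral_Icc_combine[OF mass_measurable mass_bounded, of c "c + h" "c' + h"]
      set_integral_Icc_combine[OF mass_measurable mass_bounded, of c c' "c' + h"] assms by simp
  finally show ?thesis by (simp add: Yeq)
qed

text \<open>For fixed \<open>z\<close> the quotient is the time integral of a Steklov average of the
  flux times a translate of \<open>Psi\<close>; both factors are bounded and converge in L1 in time.
  The passage to the integral over \<open>z\<close> is dominated convergence with
  \<open>Gd\<close>.\<close>

lemma flux_Psi_limit:
  assumes "t0 < c" "c \<le> c'" "c' < t1" and X: "\<And>i. 0 < X i" "X \<longlonglongrightarrow> 0"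
  shows "(\<lambda>i. \<integral>z. (LINT t:{c..c'}|lborel. Q (X i) z t) / X i \<partial>lborel)
    \<longlonglongrightarrow> (\<integral>z. (LINT t:{c..c'}|lborel. flux z t * Psi z t) \<partial>lborel)"
proof -
  have "eventually (\<lambda>i. X i < t1 - c') sequentially"
    using X(2) by (rule order_tendstoD) (use assms in auto)
  \<comment> \<open>The finitely many indices for which \<open>c' + X i\<close> is not below
    \<open>t1\<close> are dropped, since \<open>Gd\<close> is a majorant only as long as the windows
    fit.\<close>
  then obtain i0 where i0: "\<And>i. i \<ge> i0 \<Longrightarrow> X i < t1 - c'" by (auto simp: eventually_sequentially)
  have Xr: "filterlim X (at_right 0) sequentially"
    unfolding filterlim_at using X by (auto intro!: always_eventually simp: less_imp_neq[OF X(1), symmetric])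
  have "(\<lambda>i. \<integral>z. (LINT t:{c..c'}|lborel. Q (X (i + i0)) z t) / X (i + i0) \<partial>lborel)
    \<longlonglongrightarrow> (\<integral>z. (LINT t:{c..c'}|lborel. flux z t * Psi z t) \<partial>lborel)"
  proof (rule integral_dominated_convergence[OF _ _ integrable_Gd])
    have "(\<lambda>w. indicator {c..c'} (snd w) * (flux (fst w) (snd w) * Psi (fst w) (snd w))) \<in> borel_measurable (borel :: ('a points \<times> real) measure)"
      by measurable
    from borel_measurable_lborel_integral[OF this]
    show "(\<lambda>z. LINT t:{c..c'}|lborel. flux z t * Psi z t) \<in> borel_measurable lborel"
      by (simp add: set_lebesgue_integral_def)
    fix i
    have "(\<lambda>w. indicator {c..c'} (snd w) * Q (X (i + i0)) (fst w) (snd w)) \<in> borel_measurable (borel :: ('a points \<times> real) measure)"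
      by measurable
    from borel_measurable_lborel_integral[OF this]
    show "(\<lambda>z. (LINT t:{c..c'}|lborel. Q (X (i + i0)) z t) / X (i + i0)) \<in> borel_measurable lborel"
      by (simp add: set_lebesgue_integral_def)
    define h where "h = X (i + i0)"
    have h: "0 < h" "c' + h < t1" using X(1)[of "i + i0"] i0[of "i + i0"] by (auto simp: h_def)
    show "AE z in lborel. norm ((LINT t:{c..c'}|lborel. Q (X (i + i0)) z t) / X (i + i0)) \<le> Gd z"
    proof (intro AE_I2)
      fix z
      have "set_integrable lborel {c..c'} (Q h z)"
        by (rule set_integrable_Icc_bounded[OF _ Q_bounded]) (use h in auto)
      from set_integral_norm_bound[OF this]
      have "\<bar>LINT t:{c..c'}|lborel. Q h z t\<bar> \<le> h * Gd z"
        using set_integral_abs_Q_le[of c c' h z] assms h by simp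
      then show "norm ((LINT t:{c..c'}|lborel. Q (X (i + i0)) z t) / X (i + i0)) \<le> Gd z"
        using h unfolding h_def[symmetric] by (simp add: abs_mult field_simps)
    qed
  next
    show "AE z in lborel. (\<lambda>i. (LINT t:{c..c'}|lborel. Q (X (i + i0)) z t) / X (i + i0)) \<longlonglongrightarrow> (LINT t:{c..c'}|lborel. flux z t * Psi z t)"
    proof (intro AE_I2)
      fix z :: "(real ^ 'a) \<times> (real ^ 'a)"
      define Bf where "Bf = M powr (p - 1) * (\<Lambda> * fker s p (fst z - snd z))"
      have Bf: "\<bar>flux z t\<bar> \<le> Bf" for t using flux_bounded by (simp add: Bf_def)
      define Bp where "Bp = \<rho> powr (- e)"
      have Bp: "\<bar>Psi z t\<bar> \<le> Bp" for t using Psi_bounded by (simp add: Bp_def)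
      define J where "J h t = (LINT \<tau>:{t..t + h}|lborel. flux z \<tau>) / h" for h t
      have Jm: "J h \<in> borel_measurable borel" for h
    unfolding J_def by (intro borel_measurable_divide steklov_measurable borel_measurable_const) measurable
  have JB: "\<bar>J h t\<bar> \<le> Bf" if "0 < h" for h t
        using set_integral_Icc_bound[of "flux z" Bf t "t + h"] Bf that by (simp add: J_def abs_mult field_simps)
      have l1: "((\<lambda>h. LINT t:{c..c'}|lborel. \<bar>J h t - flux z t\<bar>) \<longlongrightarrow> 0) (at_right 0)"
        unfolding J_def by (rule steklov_L1_tendsto[OF _ Bf]) (use assms in auto)
      have l2: "((\<lambda>h. LINT t:{c..c'}|lborel. \<bar>Psi z (t + h) - Psi z t\<bar>) \<longlongrightarrow> 0) (at_right 0)"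
        by (rule translation_L1_tendsto[OF _ Bp]) auto
      have lim0: "((\<lambda>h. Bp * (LINT t:{c..c'}|lborel. \<bar>J h t - flux z t\<bar>) + Bf * (LINT t:{c..c'}|lborel. \<bar>Psi z (t + h) - Psi z t\<bar>)) \<longlongrightarrow> Bp * 0 + Bf * 0) (at_right 0)"
        by (intro tendsto_intros l1 l2)
      have est: "\<bar>(LINT t:{c..c'}|lborel. Q h z t) / h - (LINT t:{c..c'}|lborel. flux z t * Psi z t)\<bar>
         \<le> Bp * (LINT t:{c..c'}|lborel. \<bar>J h t - flux z t\<bar>) + Bf * (LINT t:{c..c'}|lborel. \<bar>Psi z (t + h) - Psi z t\<bar>)"
        if h: "0 < h" for h
      proof -
        note si = set_integrable_Icc_bounded
        have i1: "set_integrable lborel {c..c'} (\<lambda>t. J h t * Psi z (t + h))"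
          by (rule si[where B = "Bf * Bp"]) (use Jm h in \<open>auto simp: abs_mult intro!: mult_mono JB Bp order_trans[OF abs_ge_zero Bf]\<close>)
        have i2: "set_integrable lborel {c..c'} (\<lambda>t. flux z t * Psi z t)"
          by (rule si[where B = "Bf * Bp"]) (use h in \<open>auto simp: abs_mult intro!: mult_mono Bf Bp order_trans[OF abs_ge_zero Bf]\<close>)
        have i3: "set_integrable lborel {c..c'} (\<lambda>t. J h t - flux z t)"
        proof (rule si[where B = "Bf + Bf"])
          show "\<bar>J h t - flux z t\<bar> \<le> Bf + Bf" for t using JB[OF h, of t] Bf[of t] by linarith
        qed (use Jm in measurable)
        have i4: "set_integrable lborel {c..c'} (\<lambda>t. Psi z (t + h) - Psi z t)"
        proof (rule si[where B = "Bp + Bp"])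
          show "\<bar>Psi z (t + h) - Psi z t\<bar> \<le> Bp + Bp" for t using Bp[of t] Bp[of "t + h"] by linarith
        qed measurable
        have "(LINT t:{c..c'}|lborel. Q h z t) / h = (LINT t:{c..c'}|lborel. J h t * Psi z (t + h))"
        proof -
          have "Q h z t / h = J h t * Psi z (t + h)" for t by (simp add: Q_def J_def)
          then show ?thesis by (simp only: set_integral_divide_zero[symmetric])
        qed
        then have "\<bar>(LINT t:{c..c'}|lborel. Q h z t) / h - (LINT t:{c..c'}|lborel. flux z t * Psi z t)\<bar>
          = \<bar>LINT t:{c..c'}|lborel. J h t * Psi z (t + h) - flux z t * Psi z t\<bar>"
          by (simp add: set_integral_diff(2)[OF i1 i2])
        also have "\<dots> \<le> (LINT t:{c..c'}|lborel. \<bar>J h t * Psi z (t + h) - flux z t * Psi z t\<bar>)"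
          using set_integral_norm_bound[OF set_integral_diff(1)[OF i1 i2]] by simp
        also have "\<dots> \<le> (LINT t:{c..c'}|lborel. Bp * \<bar>J h t - flux z t\<bar> + Bf * \<bar>Psi z (t + h) - Psi z t\<bar>)"
        proof (rule set_integral_mono)
          show "set_integrable lborel {c..c'} (\<lambda>t. \<bar>J h t * Psi z (t + h) - flux z t * Psi z t\<bar>)"
            by (intro set_integrable_abs set_integral_diff i1 i2)
          show "set_integrable lborel {c..c'} (\<lambda>t. Bp * \<bar>J h t - flux z t\<bar> + Bf * \<bar>Psi z (t + h) - Psi z t\<bar>)"
            by (intro set_integral_add set_integrable_mult_right set_integrable_abs i3 i4)
          fix t
          have "J h t * Psi z (t + h) - flux z t * Psi z t = Psi z (t + h) * (J h t - flux z t) + flux z t * (Psi z (t + h) - Psi z t)"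
            by (simp add: algebra_simps)
          then have "\<bar>J h t * Psi z (t + h) - flux z t * Psi z t\<bar> \<le> \<bar>Psi z (t + h)\<bar> * \<bar>J h t - flux z t\<bar> + \<bar>flux z t\<bar> * \<bar>Psi z (t + h) - Psi z t\<bar>"
            by (metis abs_mult abs_triangle_ineq)
          also have "\<dots> \<le> Bp * \<bar>J h t - flux z t\<bar> + Bf * \<bar>Psi z (t + h) - Psi z t\<bar>"
            by (intro add_mono mult_right_mono Bp Bf) auto
          finally show "\<bar>J h t * Psi z (t + h) - flux z t * Psi z t\<bar> \<le> Bp * \<bar>J h t - flux z t\<bar> + Bf * \<bar>Psi z (t + h) - Psi z t\<bar>" .
        qed
        also have "\<dots> = Bp * (LINT t:{c..c'}|lborel. \<bar>J h t - flux z t\<bar>) + Bf * (LINT t:{c..c'}|lborel. \<bar>Psi z (t + h) - Psi z t\<bar>)"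
          by (subst set_integral_add(2)) (auto intro!: set_integrable_mult_right set_integrable_abs i3 i4)
        finally show ?thesis .
      qed
      have "((\<lambda>h. (LINT t:{c..c'}|lborel. Q h z t) / h - (LINT t:{c..c'}|lborel. flux z t * Psi z t)) \<longlongrightarrow> 0) (at_right 0)"
        by (rule Lim_null_comparison[where g = "\<lambda>h. Bp * (LINT t:{c..c'}|lborel. \<bar>J h t - flux z t\<bar>) + Bf * (LINT t:{c..c'}|lborel. \<bar>Psi z (t + h) - Psi z t\<bar>)"])
           (use lim0 est in \<open>auto simp: eventually_at_right_field intro!: exI[of _ 1]\<close>)
      then have "((\<lambda>h. (LINT t:{c..c'}|lborel. Q h z t) / h) \<longlongrightarrow> (LINT t:{c..c'}|lborel. flux z t * Psi z t)) (at_right 0)"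
        by (simp add: LIM_zero_iff)
      from filterlim_compose[OF this Xr]
      have "(\<lambda>i. (LINT t:{c..c'}|lborel. Q (X i) z t) / X i) \<longlonglongrightarrow> (LINT t:{c..c'}|lborel. flux z t * Psi z t)" .
      then show "(\<lambda>i. (LINT t:{c..c'}|lborel. Q (X (i + i0)) z t) / X (i + i0)) \<longlonglongrightarrow> (LINT t:{c..c'}|lborel. flux z t * Psi z t)"
        by (rule LIMSEQ_ignore_initial_segment)
    qed
  qed
  then show ?thesis by (rule LIMSEQ_offset)
qed

text \<open>L1 convergence of the Steklov averages of \<open>mass\<close> gives convergence almost
  everywhere along a subsequence. One sequence serves all times, so the exceptional times form a
  single null set.\<close>

lemma steklov_mass_AE:
  obtains X where "\<And>i. 0 < X i" "X \<longlonglongrightarrow> 0"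
    "AE t in lborel. t \<in> {t0..t1} \<longrightarrow> (\<lambda>i. (LINT \<tau>:{t..t + X i}|lborel. mass \<tau>) / X i) \<longlonglongrightarrow> mass t"
proof -
  define Y :: "nat \<Rightarrow> real" where "Y i = inverse (real (Suc i))" for i
  have Y: "0 < Y i" "Y \<longlonglongrightarrow> 0" for i
    unfolding Y_def by (simp, rule LIMSEQ_inverse_real_of_nat)
  have Yr: "filterlim Y (at_right 0) sequentially"
    unfolding filterlim_at using Y by (auto intro!: always_eventually simp: less_imp_neq[OF Y(1), symmetric])
  define J where "J h t = (LINT \<tau>:{t..t + h}|lborel. mass \<tau>) / h" for h t
  have Jm: "J h \<in> borel_measurable borel" for h
  proof -
    have "(\<lambda>w. (if fst w \<le> snd w \<and> snd w \<le> fst w + h then mass (snd w) else 0))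
      \<in> borel_measurable (borel :: (real \<times> real) measure)"
      by measurable
    from borel_measurable_lborel_integral[OF this]
    have "(\<lambda>t. LINT \<tau>:{t..t + h}|lborel. mass \<tau>) \<in> borel_measurable borel"
      unfolding set_lebesgue_integral_def
      by (rule subst[of _ _ "\<lambda>f. f \<in> _", rotated]) (auto simp: indicator_def intro!: ext Bochner_Integration.integral_cong)
    then show ?thesis unfolding J_def by measurable
  qed
  have JB: "\<bar>J h t\<bar> \<le> massB" if "0 < h" for h t
    using set_integral_Icc_bound[OF mass_measurable mass_bounded, of t "t + h"] that by (simp add: J_def abs_mult field_simps)
  have l1: "((\<lambda>h. LINT t:{t0..t1}|lborel. \<bar>J h t - mass t\<bar>) \<longlongrightarrow> 0) (at_right 0)"
    unfolding J_def by (rule steklov_L1_tendsto[OF _ mass_bounded]) (use t01 in auto)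
  from filterlim_compose[OF this Yr]
  have "(\<lambda>i. \<integral>t. norm (indicator {t0..t1} t * (J (Y i) t - mass t)) \<partial>lborel) \<longlonglongrightarrow> 0"
    by (simp add: set_lebesgue_integral_def abs_mult)
  moreover have "integrable lborel (\<lambda>t. indicator {t0..t1} t * (J (Y i) t - mass t))" for i
  proof -
    have "\<bar>J (Y i) t - mass t\<bar> \<le> massB + massB" for t
      using JB[OF Y(1), of i t] mass_bounded[of t] by linarith
    then have "set_integrable lborel {t0..t1} (\<lambda>t. J (Y i) t - mass t)"
      by (rule set_integrable_Icc_bounded[rotated]) (use Jm in measurable)
    then show ?thesis by (simp add: set_integrable_def)
  qed
  ultimately obtain q where q: "strict_mono q" "AE t in lborel. (\<lambda>i. indicator {t0..t1} t * (J (Y (q i)) t - mass t)) \<longlonglongrightarrow> 0"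
    using tendsto_L1_AE_subseq[of lborel "\<lambda>i t. indicator {t0..t1} t * (J (Y i) t - mass t)"] by auto
  show thesis
  proof (rule that[of "Y \<circ> q"])
    show "(Y \<circ> q) \<longlonglongrightarrow> 0" by (rule LIMSEQ_subseq_LIMSEQ[OF Y(2) q(1)])
    show "AE t in lborel. t \<in> {t0..t1} \<longrightarrow> (\<lambda>i. (LINT \<tau>:{t..t + (Y \<circ> q) i}|lborel. mass \<tau>) / (Y \<circ> q) i) \<longlonglongrightarrow> mass t"
      using q(2)
    proof eventually_elim
      case (elim t)
      then show ?case by (auto simp: J_def o_def LIM_zero_iff)
    qed
  qed (use Y in auto)
qed

text \<open>The inequality \<open>tested_integrated\<close>, divided by \<open>X i\<close>, passes
  to the limit at endpoints where the averages of \<open>mass\<close> converge. Multiplication by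
  \<open>a\<close> then removes the factor \<open>1 / a\<close>, which would degenerate for small
  \<open>a\<close>.\<close>

lemma energy_inequality_raw:
  obtains N where "N \<in> null_sets lborel"
    "\<And>c c'. c \<notin> N \<Longrightarrow> c' \<notin> N \<Longrightarrow> t0 < c \<Longrightarrow> c \<le> c' \<Longrightarrow> c' < t1 \<Longrightarrow>
      0 \<le> (p - 1) * (mass c' - mass c) + a * (\<integral>z. (LINT t:{c..c'}|lborel. flux z t * Psi z t) \<partial>lborel)"
proof -
  obtain X where X: "\<And>i. 0 < X i" "X \<longlonglongrightarrow> 0"
    "AE t in lborel. t \<in> {t0..t1} \<longrightarrow> (\<lambda>i. (LINT \<tau>:{t..t + X i}|lborel. mass \<tau>) / X i) \<longlonglongrightarrow> mass t"
    using steklov_mass_AE by blast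
  from AE_E[OF X(3)] obtain N where N: "{t. \<not> (t \<in> {t0..t1} \<longrightarrow> (\<lambda>i. (LINT \<tau>:{t..t + X i}|lborel. mass \<tau>) / X i) \<longlonglongrightarrow> mass t)} \<subseteq> N"
    "N \<in> null_sets lborel"
    by (auto simp: null_sets_def)
  show thesis
  proof (rule that[OF N(2)])
    fix c c' assume c: "c \<notin> N" "c' \<notin> N" "t0 < c" "c \<le> c'" "c' < t1"
    have l: "(\<lambda>i. (LINT \<tau>:{c..c + X i}|lborel. mass \<tau>) / X i) \<longlonglongrightarrow> mass c"
       "(\<lambda>i. (LINT \<tau>:{c'..c' + X i}|lborel. mass \<tau>) / X i) \<longlonglongrightarrow> mass c'"
      using subsetD[OF N(1), of c] subsetD[OF N(1), of c'] c by fastforce+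
    have "(\<lambda>i. (p - 1) / a * ((LINT \<tau>:{c'..c' + X i}|lborel. mass \<tau>) / X i - (LINT \<tau>:{c..c + X i}|lborel. mass \<tau>) / X i)
        + (\<integral>z. (LINT t:{c..c'}|lborel. Q (X i) z t) / X i \<partial>lborel))
      \<longlonglongrightarrow> (p - 1) / a * (mass c' - mass c) + (\<integral>z. (LINT t:{c..c'}|lborel. flux z t * Psi z t) \<partial>lborel)"
      by (rule tendsto_add[OF tendsto_mult[OF tendsto_const tendsto_diff[OF l(2,1)]] flux_Psi_limit[OF c(3-5) X(1,2)]])
    moreover have "eventually (\<lambda>i. 0 \<le> (p - 1) / a * ((LINT \<tau>:{c'..c' + X i}|lborel. mass \<tau>) / X i - (LINT \<tau>:{c..c + X i}|lborel. mass \<tau>) / X i)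
        + (\<integral>z. (LINT t:{c..c'}|lborel. Q (X i) z t) / X i \<partial>lborel)) sequentially"
    proof -
      have "eventually (\<lambda>i. X i < t1 - c') sequentially"
        using X(2) by (rule order_tendstoD) (use c in auto)
      then show ?thesis
      proof eventually_elim
        case (elim i)
        have "0 \<le> (p - 1) / a * ((LINT t:{c'..c' + X i}|lborel. mass t) - (LINT t:{c..c + X i}|lborel. mass t))
          + (\<integral>z. (LINT t:{c..c'}|lborel. Q (X i) z t) \<partial>lborel)"
          by (rule tested_integrated) (use c elim X in auto)
        then have "0 \<le> ((p - 1) / a * ((LINT t:{c'..c' + X i}|lborel. mass t) - (LINT t:{c..c + X i}|lborel. mass t))
          + (\<integral>z. (LINT t:{c..c'}|lborel. Q (X i) z t) \<partial>lborel)) / X i"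
          using X(1)[of i] by simp
        then show ?case by (simp add: add_divide_distrib diff_divide_distrib right_diff_distrib)
      qed
    qed
    ultimately have "0 \<le> (p - 1) / a * (mass c' - mass c) + (\<integral>z. (LINT t:{c..c'}|lborel. flux z t * Psi z t) \<partial>lborel)"
      by (rule tendsto_lowerbound) auto
    then have "0 \<le> a * ((p - 1) / a * (mass c' - mass c) + (\<integral>z. (LINT t:{c..c'}|lborel. flux z t * Psi z t) \<partial>lborel))"
      using a by simp
    then show "0 \<le> (p - 1) * (mass c' - mass c) + a * (\<integral>z. (LINT t:{c..c'}|lborel. flux z t * Psi z t) \<partial>lborel)"
      using a by (simp add: distrib_left)
  qed
qed


section \<open>The Caccioppoli inequality\<close>

definition "vv t x = eta x * U x t powr (a / p)"
definition "vdiff z t = \<bar>vv t (fst z) - vv t (snd z)\<bar> powr p * fker s p (fst z - snd z)"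
definition "venergy t = (\<integral>\<^sup>+z. vdiff z t \<partial>lborel)"
definition "weight t x = indicator B' x * U x t powr a"
definition "gain z t = (weight t (fst z) + weight t (snd z)) * cutker s p d (fst z - snd z)"
text \<open>Coefficients of \<open>pointwise_energy\<close> combined with the lower kernel bound for
  the energy and the upper one for the error. Both remain controlled as \<open>a\<close> tends to
  0.\<close>

definition "c0 = p * e * 2 powr (- p) / \<Lambda>"
definition "C0 = (p * e / 2 + a * (2 * (p - 1) / e) powr (p - 1)) * \<Lambda>"

lemma c0_pos: "0 < c0" "0 < C0"
  using p e a Lam by (auto simp: c0_def C0_def intro!: mult_pos_pos add_pos_nonneg)

lemma vv_measurable [measurable (raw)]:
  assumes [measurable]: "f \<in> borel_measurable N" "g \<in> borel_measurable N"
  shows "(\<lambda>w. vv (g w) (f w)) \<in> borel_measurable N" "(\<lambda>w. weight (g w) (f w)) \<in> borel_measurable N"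
  unfolding vv_def weight_def by measurable

lemma vdiff_measurable [measurable (raw)]:
  assumes [measurable]: "f \<in> borel_measurable N" "g \<in> borel_measurable N"
  shows "(\<lambda>w. vdiff (f w) (g w)) \<in> borel_measurable N" "(\<lambda>w. gain (f w) (g w)) \<in> borel_measurable N"
proof -
  have [measurable]: "(\<lambda>w. fst (f w)) \<in> borel_measurable N" "(\<lambda>w. snd (f w)) \<in> borel_measurable N"
    using assms by (auto intro: measurable_compose[OF _ borel_measurable_fst_snd(1)] measurable_compose[OF _ borel_measurable_fst_snd(2)])
  show "(\<lambda>w. vdiff (f w) (g w)) \<in> borel_measurable N" "(\<lambda>w. gain (f w) (g w)) \<in> borel_measurable N"
    unfolding vdiff_def gain_def by measurable
qed

lemma nonneg_simps [simp]: "0 \<le> vdiff z t" "0 \<le> weight t x" "0 \<le> gain z t"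
  by (auto simp: vdiff_def weight_def gain_def)

text \<open>The product of \<open>pointwise_energy\<close> with the kernel. In the error term the
  Lipschitz bound of the cutoff turns the singular kernel into \<open>cutker\<close>, which is
  integrable.\<close>

lemma flux_Psi_upper: "a * (flux z t * Psi z t) \<le> - c0 * vdiff z t + C0 * gain z t"
proof -
  obtain x y where z: "z = (x, y)" by fastforce
  define A B where "A = U x t" and "B = U y t"
  define \<sigma> \<tau> where "\<sigma> = eta x" and "\<tau> = eta y"
  define w where "w = fker s p (x - y)"
  define kk where "kk = k x y t"
  have kk: "0 \<le> kk" "w / \<Lambda> \<le> kk" "kk \<le> \<Lambda> * w"
    using k_nonneg k_ge k_le by (auto simp: kk_def w_def)
  have sub: "ball x0 (R + d) \<subseteq> B'" using d by (auto simp: B'_def)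
  have eta0: "x \<notin> B' \<Longrightarrow> eta x = 0" for x using eta_eq_0[of x] sub by blast
  define c1 where "c1 = p * e * 2 powr (- p)"
  define c2 where "c2 = p * e / 2 + a * (2 * (p - 1) / e) powr (p - 1)"
  define V where "V = \<bar>\<sigma> * A powr (a / p) - \<tau> * B powr (a / p)\<bar> powr p"
  define W where "W = indicator B' x * A powr a + indicator B' y * B powr a"
  have nn: "0 \<le> c1" "0 \<le> c2" "0 \<le> V" "0 \<le> W" using p e a
    by (auto simp: c1_def c2_def V_def W_def intro!: add_nonneg_nonneg)
  have "a * (cdn p (A - B) * (A powr (- e) * \<sigma> powr p - B powr (- e) * \<tau> powr p))
    \<le> - c1 * V + c2 * \<bar>\<sigma> - \<tau>\<bar> powr p * W"
    unfolding V_def W_def c1_def c2_def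
    by (rule pointwise_energy)
       (use p a e ae eta0 in \<open>auto simp: A_def B_def \<sigma>_def \<tau>_def indicator_def\<close>)
  then have "a * (cdn p (A - B) * (A powr (- e) * \<sigma> powr p - B powr (- e) * \<tau> powr p)) * kk
    \<le> (- c1 * V + c2 * \<bar>\<sigma> - \<tau>\<bar> powr p * W) * kk"
    by (rule mult_right_mono) (rule kk)
  also have "\<dots> = - (c1 * V * kk) + c2 * W * (\<bar>\<sigma> - \<tau>\<bar> powr p * kk)" by (simp add: algebra_simps)
  also have "\<dots> \<le> - (c1 * V * (w / \<Lambda>)) + c2 * W * (\<Lambda> * cutker s p d (x - y))"
  proof (intro add_mono le_imp_neg_le mult_left_mono)
    have "\<bar>\<sigma> - \<tau>\<bar> powr p * kk \<le> (min 1 (norm (x - y) / d)) powr p * (\<Lambda> * w)"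
      using cutoff_lipschitz[OF d, of x0 R x y] p kk d
      by (intro mult_mono powr_mono2) (auto simp: \<sigma>_def \<tau>_def eta_def)
    also have "\<dots> = \<Lambda> * cutker s p d (x - y)" by (simp add: cutker_def w_def)
    finally show "\<bar>\<sigma> - \<tau>\<bar> powr p * kk \<le> \<Lambda> * cutker s p d (x - y)" .
  qed (use nn kk in auto)
  finally have fin: "a * (cdn p (A - B) * (A powr (- e) * \<sigma> powr p - B powr (- e) * \<tau> powr p)) * kk
    \<le> - (c1 * V * (w / \<Lambda>)) + c2 * W * (\<Lambda> * cutker s p d (x - y))" .
  have "a * (flux z t * Psi z t) = a * (cdn p (A - B) * (A powr (- e) * \<sigma> powr p - B powr (- e) * \<tau> powr p)) * kk"
    by (simp add: z flux_def Psi_def psi_def A_def B_def \<sigma>_def \<tau>_def kk_def)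
  moreover have "- c0 * vdiff z t = - (c1 * V * (w / \<Lambda>))"
    by (simp add: z vdiff_def vv_def c0_def c1_def V_def w_def A_def B_def \<sigma>_def \<tau>_def)
  moreover have "C0 * gain z t = c2 * W * (\<Lambda> * cutker s p d (x - y))"
    by (simp add: z gain_def weight_def C0_def c2_def W_def A_def B_def)
  ultimately show ?thesis using fin by (simp only:)
qed

lemma integrable_flux_Psi:
  assumes "t0 \<le> c" "c \<le> c'" "c' \<le> t1"
  shows "integrable lborel (\<lambda>w. indicator {c..c'} (snd w) * (flux (fst w) (snd w) * Psi (fst w) (snd w)))"
proof (rule integrable_lborel_pairI)
  note si = set_integrable_Icc_bounded
  have m: "(\<lambda>w. indicator {c..c'} (snd w) * \<bar>flux (fst w) (snd w) * Psi (fst w) (snd w)\<bar>) \<in> borel_measurable (borel :: ('a points \<times> real) measure)"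
    by measurable
  show "(\<lambda>w. indicator {c..c'} (snd w) * (flux (fst w) (snd w) * Psi (fst w) (snd w))) \<in> borel_measurable (borel :: ('a points \<times> real) measure)"
    by measurable
  have fi: "set_integrable lborel {c..c'} (\<lambda>t. flux z t * Psi z t)" for z
  proof (rule si[where B = "(M powr (p - 1) * (\<Lambda> * fker s p (fst z - snd z))) * \<rho> powr (- e)"])
    show "\<bar>flux z t * Psi z t\<bar> \<le> (M powr (p - 1) * (\<Lambda> * fker s p (fst z - snd z))) * \<rho> powr (- e)" for t
      unfolding abs_mult by (intro mult_mono flux_bounded Psi_bounded) (use Lam in auto)
  qed measurable
  have ei: "set_integrable lborel {c..c'} (en z)" for z
    by (rule si[OF _ en_bounded]) measurable
  have ci: "set_integrable lborel {c..c'} (\<lambda>_. x)" for x :: real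
    by (rule si[where B = "\<bar>x\<bar>"]) auto
  have est: "(LINT t:{c..c'}|lborel. \<bar>flux z t * Psi z t\<bar>) \<le> Gd z" for z
  proof -
    have "(LINT t:{c..c'}|lborel. \<bar>flux z t * Psi z t\<bar>) \<le> (LINT t:{c..c'}|lborel. CF * (2 * en z t + tail z))"
    proof (rule set_integral_mono)
      show "set_integrable lborel {c..c'} (\<lambda>t. CF * (2 * en z t + tail z))"
        by (intro set_integrable_mult_right set_integral_add ei ci)
      show "\<bar>flux z t * Psi z t\<bar> \<le> CF * (2 * en z t + tail z)" for t
        using flux_Psi_le[of z t t] by (simp add: abs_mult)
    qed (intro set_integrable_abs fi)
    also have "\<dots> = CF * (2 * (LINT t:{c..c'}|lborel. en z t) + (c' - c) * tail z)"
      using assms by (simp add: set_integral_add(2)[OF set_integrable_mult_right[OF ei] ci] set_integral_Icc_const)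
    also have "\<dots> \<le> CF * (2 * En z + (t1 - t0) * tail z)"
      using set_integral_en_le[of c c' z] assms by (intro mult_left_mono add_mono mult_right_mono C_nonneg) auto
    finally show ?thesis by (simp add: Gd_def)
  qed
  have nn: "0 \<le> (LINT t:{c..c'}|lborel. \<bar>flux z t * Psi z t\<bar>)" for z
    unfolding set_lebesgue_integral_def by (intro integral_nonneg_AE) auto
  have "integrable lborel (\<lambda>z. LINT t:{c..c'}|lborel. \<bar>flux z t * Psi z t\<bar>)"
  proof (rule Bochner_Integration.integrable_bound[OF integrable_Gd])
    show "(\<lambda>z. LINT t:{c..c'}|lborel. \<bar>flux z t * Psi z t\<bar>) \<in> borel_measurable lborel"
      using borel_measurable_lborel_integral[OF m] by (simp add: set_lebesgue_integral_def)
    show "AE z in lborel. norm (LINT t:{c..c'}|lborel. \<bar>flux z t * Psi z t\<bar>) \<le> norm (Gd z)"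
    proof (intro AE_I2)
      show "norm (LINT t:{c..c'}|lborel. \<bar>flux z t * Psi z t\<bar>) \<le> norm (Gd z)" for z
        using nn[of z] est[of z] by simp
    qed
  qed
  then show "integrable lborel (\<lambda>z. \<integral>t. \<bar>indicator {c..c'} (snd (z, t)) * (flux (fst (z, t)) (snd (z, t)) * Psi (fst (z, t)) (snd (z, t)))\<bar> \<partial>lborel)"
    by (simp add: set_lebesgue_integral_def abs_mult)
  show "AE z in lborel. integrable lborel (\<lambda>t. indicator {c..c'} (snd (z, t)) * (flux (fst (z, t)) (snd (z, t)) * Psi (fst (z, t)) (snd (z, t))))"
    using fi by (intro AE_I2) (simp add: set_integrable_def)
qed

definition "bulk c c' = (\<integral>\<^sup>+t. indicator {c..c'} t * (\<integral>\<^sup>+x. weight t x \<partial>lborel) \<partial>lborel)"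

lemma weight_le: "weight t x \<le> max (M powr a) (\<rho> powr a) * indicator B' x"
proof -
  have "U x t powr a \<le> M powr a" using a U_le by (intro powr_mono2) auto
  then show ?thesis by (auto simp: weight_def indicator_def)
qed

lemma bulk_finite: "bulk c c' < \<infinity>"
proof -
  define m where "m = max (M powr a) (\<rho> powr a)"
  have m: "0 \<le> m" by (simp add: m_def le_max_iff_disj)
  have "(\<integral>\<^sup>+x. weight t x \<partial>lborel) \<le> ennreal m * emeasure lborel B'" for t
  proof -
    have "(\<integral>\<^sup>+x. weight t x \<partial>lborel) \<le> (\<integral>\<^sup>+x. ennreal m * indicator B' x \<partial>lborel)"
    proof (rule nn_integral_mono)
      fix x
      have "weight t x \<le> m * indicator B' x" using weight_le[of t x] by (simp add: m_def)
      then have "ennreal (weight t x) \<le> ennreal (m * indicator B' x)" by (rule ennreal_leI)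
      also have "\<dots> = ennreal m * indicator B' x" using m by (simp add: ennreal_mult' ennreal_indicator)
      finally show "ennreal (weight t x) \<le> ennreal m * indicator B' x" .
    qed
    also have "\<dots> = ennreal m * emeasure lborel B'" by (rule nn_integral_cmult_indicator) measurable
    finally show ?thesis .
  qed
  then have "bulk c c' \<le> (\<integral>\<^sup>+t. (ennreal m * emeasure lborel B') * indicator {c..c'} t \<partial>lborel)"
    unfolding bulk_def by (intro nn_integral_mono) (auto simp: indicator_def)
  also have "\<dots> = (ennreal m * emeasure lborel B') * emeasure lborel {c..c'}"
    by (rule nn_integral_cmult_indicator) auto
  also have "\<dots> < \<infinity>"
    using emeasure_bounded_finite[of B'] by (simp add: ennreal_mult_less_top emeasure_lborel_Icc_eq B'_def)
  finally show ?thesis .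
qed

lemma nn_integral_gain:
  "(\<integral>\<^sup>+w. ennreal (indicator {c..c'} (snd w) * gain (fst w) (snd w)) \<partial>lborel)
    = ennreal (2 * cutker_const TYPE('a) s p * d powr (- (p * s))) * bulk c c'"
proof -
  have m: "(\<lambda>w. ennreal (indicator {c..c'} (snd w) * gain (fst w) (snd w))) \<in> borel_measurable (borel :: ('a points \<times> real) measure)"
    by measurable
  have g: "(\<integral>\<^sup>+z. gain z t \<partial>lborel) = ennreal (2 * cutker_const TYPE('a) s p * d powr (- (p * s))) * (\<integral>\<^sup>+x. weight t x \<partial>lborel)" for t
    unfolding gain_def by (rule nn_integral_weighted_cutker) (use p s d in auto)
  have "(\<integral>\<^sup>+w. ennreal (indicator {c..c'} (snd w) * gain (fst w) (snd w)) \<partial>lborel)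
    = (\<integral>\<^sup>+t. \<integral>\<^sup>+z. ennreal (indicator {c..c'} t * gain z t) \<partial>lborel \<partial>lborel)"
    by (subst nn_integral_lborel_pair(2)[OF m]) simp
  also have "\<dots> = (\<integral>\<^sup>+t. ennreal (2 * cutker_const TYPE('a) s p * d powr (- (p * s))) * (indicator {c..c'} t * (\<integral>\<^sup>+x. weight t x \<partial>lborel)) \<partial>lborel)"
    by (intro nn_integral_cong) (auto simp: indicator_def g)
  also have "\<dots> = ennreal (2 * cutker_const TYPE('a) s p * d powr (- (p * s))) * bulk c c'"
    unfolding bulk_def
  proof (rule nn_integral_cmult)
    have "(\<lambda>(t, x). ennreal (weight t x)) \<in> borel_measurable (borel \<Otimes>\<^sub>M (lborel :: (real ^ 'a) measure))"
    proof -
      have "(\<lambda>w. ennreal (weight (fst w) (snd w))) \<in> borel_measurable (borel :: (real \<times> (real ^ 'a)) measure)"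
        by measurable
      then show ?thesis by (simp add: split_beta' borel_prod cong: measurable_cong_sets)
    qed
    then have [measurable]: "(\<lambda>t. \<integral>\<^sup>+x. weight t x \<partial>lborel) \<in> borel_measurable borel"
      by (rule lborel.borel_measurable_nn_integral)
    show "(\<lambda>t. indicator {c..c'} t * (\<integral>\<^sup>+x. weight t x \<partial>lborel)) \<in> borel_measurable lborel"
      by measurable
  qed
  finally show ?thesis .
qed

lemma venergy_measurable [measurable]: "venergy \<in> borel_measurable borel"
proof -
  have "(\<lambda>(t, z). ennreal (vdiff z t)) \<in> borel_measurable (borel \<Otimes>\<^sub>M (lborel :: 'a points measure))"
  proof -
    have "(\<lambda>w. ennreal (vdiff (snd w) (fst w))) \<in> borel_measurable (borel :: (real \<times> 'a points) measure)"
      by measurable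
    then show ?thesis by (simp add: split_beta' borel_prod cong: measurable_cong_sets)
  qed
  then have "(\<lambda>t. \<integral>\<^sup>+z. vdiff z t \<partial>lborel) \<in> borel_measurable borel"
    by (rule lborel.borel_measurable_nn_integral)
  then show ?thesis by (simp add: venergy_def[abs_def])
qed

text \<open>Obtained by integrating \<open>flux_Psi_upper\<close> and inserting the result into
  \<open>energy_inequality_raw\<close>. All terms are moved to the side where they are nonnegative,
  because the integral of \<open>venergy\<close> is an extended number not known to be finite
  beforehand.\<close>

lemma energy_inequality:
  obtains N where "N \<in> null_sets lborel"
    "\<And>c c'. c \<notin> N \<Longrightarrow> c' \<notin> N \<Longrightarrow> t0 < c \<Longrightarrow> c \<le> c' \<Longrightarrow> c' < t1 \<Longrightarrow>
      ennreal ((p - 1) * mass c) + ennreal c0 * (\<integral>\<^sup>+t. indicator {c..c'} t * venergy t \<partial>lborel)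
      \<le> ennreal ((p - 1) * mass c') + ennreal (C0 * (2 * cutker_const TYPE('a) s p * d powr (- (p * s)))) * bulk c c'"
proof -
  obtain N where N: "N \<in> null_sets lborel" and raw: "\<And>c c'. c \<notin> N \<Longrightarrow> c' \<notin> N \<Longrightarrow> t0 < c \<Longrightarrow> c \<le> c' \<Longrightarrow> c' < t1 \<Longrightarrow>
      0 \<le> (p - 1) * (mass c' - mass c) + a * (\<integral>z. (LINT t:{c..c'}|lborel. flux z t * Psi z t) \<partial>lborel)"
    using energy_inequality_raw by blast
  show thesis
  proof (rule that[OF N])
    fix c c' assume c: "c \<notin> N" "c' \<notin> N" "t0 < c" "c \<le> c'" "c' < t1"
    define H where "H w = indicator {c..c'} (snd w) * (flux (fst w) (snd w) * Psi (fst w) (snd w))"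
      for w :: "'a points \<times> real"
    define G where "G w = indicator {c..c'} (snd w) * gain (fst w) (snd w)"
      for w :: "'a points \<times> real"
    define D where "D w = indicator {c..c'} (snd w) * vdiff (fst w) (snd w)"
      for w :: "'a points \<times> real"
    have meas: "H \<in> borel_measurable borel" "G \<in> borel_measurable borel" "D \<in> borel_measurable borel"
      unfolding H_def[abs_def] G_def[abs_def] D_def[abs_def] by measurable
    define k2 where "k2 = 2 * cutker_const TYPE('a) s p * d powr (- (p * s))"
    have k2: "0 \<le> k2" by (simp add: k2_def cutker_const_def)
    have Hi: "integrable lborel H"
      unfolding H_def[abs_def] by (rule integrable_flux_Psi) (use c in auto)
    have Hv: "(\<integral>w. H w \<partial>lborel) = (\<integral>z. (LINT t:{c..c'}|lborel. flux z t * Psi z t) \<partial>lborel)"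
      using integral_lborel_pair_swap(3)[OF Hi] by (simp add: H_def set_lebesgue_integral_def)
    have Gn: "(\<integral>\<^sup>+w. G w \<partial>lborel) = ennreal k2 * bulk c c'"
      unfolding G_def k2_def by (rule nn_integral_gain)
    have Gi: "integrable lborel G"
      by (rule integrableI_nonneg) (use meas Gn bulk_finite[of c c'] in \<open>auto simp: G_def ennreal_mult_less_top\<close>)
    have Gv: "ennreal (\<integral>w. G w \<partial>lborel) = ennreal k2 * bulk c c'"
    proof -
      have "(\<integral>\<^sup>+w. G w \<partial>lborel) = ennreal (\<integral>w. G w \<partial>lborel)"
        by (rule nn_integral_eq_integral[OF Gi]) (simp add: G_def)
      then show ?thesis using Gn by simp
    qed
    have "ennreal c0 * (\<integral>\<^sup>+t. indicator {c..c'} t * venergy t \<partial>lborel) = (\<integral>\<^sup>+t. ennreal c0 * (indicator {c..c'} t * venergy t) \<partial>lborel)"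
      by (rule nn_integral_cmult[symmetric]) measurable
    also have "\<dots> = (\<integral>\<^sup>+t. \<integral>\<^sup>+z. ennreal (c0 * D (z, t)) \<partial>lborel \<partial>lborel)"
    proof (intro nn_integral_cong)
      fix t
      show "ennreal c0 * (indicator {c..c'} t * venergy t) = (\<integral>\<^sup>+z. ennreal (c0 * D (z, t)) \<partial>lborel)"
        using c0_pos by (auto simp: indicator_def D_def venergy_def ennreal_mult' nn_integral_cmult)
    qed
    also have "\<dots> = (\<integral>\<^sup>+w. ennreal (c0 * D w) \<partial>lborel)"
      by (rule nn_integral_lborel_pair(2)[symmetric]) (use meas in measurable)
    also have "\<dots> \<le> (\<integral>\<^sup>+w. ennreal (C0 * G w - a * H w) \<partial>lborel)"
    proof (intro nn_integral_mono ennreal_leI)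
      fix w show "c0 * D w \<le> C0 * G w - a * H w"
        using flux_Psi_upper[of "fst w" "snd w"] by (auto simp: D_def G_def H_def indicator_def)
    qed
    also have "\<dots> = ennreal (\<integral>w. C0 * G w - a * H w \<partial>lborel)"
    proof (rule nn_integral_eq_integral)
      show "integrable lborel (\<lambda>w. C0 * G w - a * H w)"
        by (intro Bochner_Integration.integrable_diff Bochner_Integration.integrable_mult_right Gi Hi)
      show "AE w in lborel. 0 \<le> C0 * G w - a * H w"
      proof (intro AE_I2)
        fix w
        have "0 \<le> c0 * D w" using c0_pos by (simp add: D_def)
        then show "0 \<le> C0 * G w - a * H w"
          using flux_Psi_upper[of "fst w" "snd w"] by (auto simp: D_def G_def H_def indicator_def split: if_splits)
      qed
    qed
    also have "(\<integral>w. C0 * G w - a * H w \<partial>lborel) = C0 * (\<integral>w. G w \<partial>lborel) - a * (\<integral>w. H w \<partial>lborel)"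
      by (simp add: Bochner_Integration.integral_diff Gi Hi)
    also have "\<dots> \<le> C0 * (\<integral>w. G w \<partial>lborel) + (p - 1) * (mass c' - mass c)"
      using raw[OF c] by (simp add: Hv)
    finally have *: "ennreal c0 * (\<integral>\<^sup>+t. indicator {c..c'} t * venergy t \<partial>lborel)
       \<le> ennreal (C0 * (\<integral>w. G w \<partial>lborel) + (p - 1) * (mass c' - mass c))"
      by (simp add: ennreal_leI)
    have Gnn: "0 \<le> (\<integral>w. G w \<partial>lborel)" by (intro integral_nonneg_AE) (auto simp: G_def)
    \<comment> \<open>\<open>ennreal\<close> cuts off negative numbers, so nonnegativity is needed
      before the sum can be split.\<close>
    have nonneg: "0 \<le> C0 * (\<integral>w. G w \<partial>lborel) + (p - 1) * (mass c' - mass c)"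
    proof -
      have "0 \<le> (\<integral>w. C0 * G w - a * H w \<partial>lborel)"
      proof (intro integral_nonneg_AE AE_I2)
        fix w
        have "0 \<le> c0 * D w" using c0_pos by (simp add: D_def)
        then show "0 \<le> C0 * G w - a * H w"
          using flux_Psi_upper[of "fst w" "snd w"] by (auto simp: D_def G_def H_def indicator_def split: if_splits)
      qed
      also have "\<dots> = C0 * (\<integral>w. G w \<partial>lborel) - a * (\<integral>w. H w \<partial>lborel)"
        by (simp add: Bochner_Integration.integral_diff Gi Hi)
      finally show ?thesis using raw[OF c] by (simp add: Hv)
    qed
    have "ennreal ((p - 1) * mass c) + ennreal c0 * (\<integral>\<^sup>+t. indicator {c..c'} t * venergy t \<partial>lborel)
      \<le> ennreal ((p - 1) * mass c) + ennreal (C0 * (\<integral>w. G w \<partial>lborel) + (p - 1) * (mass c' - mass c))"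
      by (intro add_left_mono *)
    also have "\<dots> = ennreal ((p - 1) * mass c + (C0 * (\<integral>w. G w \<partial>lborel) + (p - 1) * (mass c' - mass c)))"
      by (rule ennreal_plus[symmetric]) (use p nonneg in auto)
    also have "(p - 1) * mass c + (C0 * (\<integral>w. G w \<partial>lborel) + (p - 1) * (mass c' - mass c))
        = (p - 1) * mass c' + C0 * (\<integral>w. G w \<partial>lborel)"
      by (simp add: algebra_simps)
    also have "ennreal ((p - 1) * mass c' + C0 * (\<integral>w. G w \<partial>lborel)) = ennreal ((p - 1) * mass c') + ennreal C0 * ennreal (\<integral>w. G w \<partial>lborel)"
      using p c0_pos Gnn by (simp add: ennreal_plus ennreal_mult')
    also have "\<dots> = ennreal ((p - 1) * mass c') + ennreal (C0 * k2) * bulk c c'"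
      using c0_pos k2 by (simp add: Gv ennreal_mult' mult.assoc)
    finally show "ennreal ((p - 1) * mass c) + ennreal c0 * (\<integral>\<^sup>+t. indicator {c..c'} t * venergy t \<partial>lborel)
      \<le> ennreal ((p - 1) * mass c') + ennreal (C0 * (2 * cutker_const TYPE('a) s p * d powr (- (p * s)))) * bulk c c'"
      by (simp add: k2_def)
  qed
qed

end

section \<open>Moser iteration\<close>

lemma borel_measurable_nn_lborel:
  fixes f :: "'a::euclidean_space \<times> 'b::euclidean_space \<Rightarrow> ennreal"
  assumes "f \<in> borel_measurable borel"
  shows "(\<lambda>x. \<integral>\<^sup>+y. f (x, y) \<partial>lborel) \<in> borel_measurable borel"
proof -
  have "(\<lambda>(x, y). f (x, y)) \<in> borel_measurable (borel \<Otimes>\<^sub>M (lborel :: 'b measure))"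
    using assms by (simp add: split_beta' borel_prod cong: measurable_cong_sets) (simp add: borel_prod)
  then show ?thesis by (rule lborel.borel_measurable_nn_integral)
qed

text \<open>Energy estimates start at times \<open>c\<close> outside a null set and strictly after
  \<open>l\<close>; such times accumulate at \<open>l\<close>, and monotone convergence reaches the
  open interval.\<close>

lemma nn_integral_Ioo_le_if_Icc_le:
  fixes F :: "real \<Rightarrow> ennreal"
  assumes [measurable]: "F \<in> borel_measurable borel" and N: "N \<in> null_sets lborel" and "l < u"
    and le: "\<And>c. c \<notin> N \<Longrightarrow> l < c \<Longrightarrow> c < u \<Longrightarrow> (\<integral>\<^sup>+t. indicator {c..u} t * F t \<partial>lborel) \<le> B"
  shows "(\<integral>\<^sup>+t. indicator {l<..<u} t * F t \<partial>lborel) \<le> B"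
proof -
  define c where "c i = l + (u - l) * inverse (real (Suc i))" for i
  have ci: "l < c i" "c i \<le> u" for i
  proof -
    have "inverse (real (Suc i)) \<le> 1" by (simp add: field_simps)
    then have "(u - l) * inverse (real (Suc i)) \<le> (u - l) * 1"
      by (rule mult_left_mono) (use assms(3) in simp)
    then show "c i \<le> u" by (simp add: c_def)
    show "l < c i" using assms(3) by (simp add: c_def)
  qed
  have cdec: "decseq c"
    unfolding c_def decseq_def using assms(3) by (auto intro!: mult_left_mono le_imp_inverse_le)
  have clim: "c \<longlonglongrightarrow> l + (u - l) * 0"
    unfolding c_def by (intro tendsto_intros LIMSEQ_inverse_real_of_nat)
  have le': "(\<integral>\<^sup>+t. indicator {c i..<u} t * F t \<partial>lborel) \<le> B" for i
  proof -
    have "\<exists>c'. c' \<notin> N \<and> l < c' \<and> c' < c i"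
    proof (rule ccontr)
      assume "\<not> ?thesis"
      then have "{l<..<c i} \<subseteq> N" by auto
      then have "{l<..<c i} \<in> null_sets lborel" using N by (rule null_sets_subset[rotated 2]) auto
      then show False using ci[of i] by (simp add: null_sets_def)
    qed
    then obtain c' where c': "c' \<notin> N" "l < c'" "c' < c i" by blast
    have "(\<integral>\<^sup>+t. indicator {c i..<u} t * F t \<partial>lborel) \<le> (\<integral>\<^sup>+t. indicator {c'..u} t * F t \<partial>lborel)"
      using c' by (intro nn_integral_mono) (auto simp: indicator_def)
    also have "\<dots> \<le> B" using le[of c'] c' ci[of i] by auto
    finally show ?thesis .
  qed
  have "(\<integral>\<^sup>+t. indicator {l<..<u} t * F t \<partial>lborel) = (\<integral>\<^sup>+t. (SUP i. indicator {c i..<u} t * F t) \<partial>lborel)"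
  proof (rule nn_integral_cong)
    fix t
    show "indicator {l<..<u} t * F t = (SUP i. indicator {c i..<u} t * F t)"
    proof (cases "t \<in> {l<..<u}")
      case True
      have "eventually (\<lambda>i. c i < t) sequentially"
        using clim by (rule order_tendstoD) (use True in auto)
      then obtain i where i: "c i < t" by (auto simp: eventually_sequentially)
      have "(SUP i. indicator {c i..<u} t * F t) = F t"
      proof (rule antisym)
        show "(SUP i. indicator {c i..<u} t * F t) \<le> F t"
          by (rule SUP_least) (auto simp: indicator_def)
        have "indicator {c i..<u} t * F t \<le> (SUP i. indicator {c i..<u} t * F t)"
          by (rule SUP_upper) auto
        then show "F t \<le> (SUP i. indicator {c i..<u} t * F t)" using i True by auto
      qed
      then show ?thesis using True by simp
    next
      case False
      then have "indicator {c i..<u} t = (0 :: ennreal)" for i using ci(1)[of i] by (auto simp: indicator_def)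
      then show ?thesis using False by simp
    qed
  qed
  also have "\<dots> = (SUP i. \<integral>\<^sup>+t. indicator {c i..<u} t * F t \<partial>lborel)"
  proof (rule nn_integral_monotone_convergence_SUP)
    show "incseq (\<lambda>i t. indicator {c i..<u} t * F t)"
    proof (intro incseq_SucI le_funI)
      fix i t
      have "c (Suc i) \<le> c i" using cdec by (simp add: decseq_Suc_iff)
      then show "indicator {c i..<u} t * F t \<le> indicator {c (Suc i)..<u} t * F t"
        by (auto simp: indicator_def)
    qed
  qed measurable
  also have "\<dots> \<le> B" by (intro SUP_least le')
  finally show ?thesis .
qed

context nonlocal_supersolution
begin

text \<open>The integral over the cylinder is iterated with time outermost, so that the Nash
  inequality can be applied slice by slice.\<close>

definition "slab R \<alpha> = (\<integral>\<^sup>+t. indicator {t0<..<t0 + R powr (s * p)} t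
    * (\<integral>\<^sup>+x. ennreal (indicator (ball x0 R) x * U x t powr \<alpha>) \<partial>lborel) \<partial>lborel)"

lemma slice_measurable: "(\<lambda>t. \<integral>\<^sup>+x. ennreal (indicator (ball x0 R) x * U x t powr \<alpha>) \<partial>lborel) \<in> borel_measurable borel"
proof -
  have [measurable]: "ball x0 R \<in> sets borel" by simp
  have "(\<lambda>w. ennreal (indicator (ball x0 R) (snd w) * U (snd w) (fst w) powr \<alpha>)) \<in> borel_measurable (borel :: (real \<times> (real ^ 'n)) measure)"
    by measurable
  from borel_measurable_nn_lborel[OF this] show ?thesis by simp
qed

text \<open>On the smaller cylinder both the mass at almost every time and \<open>c0\<close> times
  the total energy are at most \<open>A\<close>. The Nash inequality on each slice contributes the
  mass to the power \<open>K - 1\<close> and the energy to the power 1, which together give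
  \<open>A powr K\<close>.\<close>

lemma moser_step:
  fixes \<alpha> r1 r2 Z :: real
  assumes r12: "0 < r2" "r2 < r1" "r1 \<le> r" and t1: "t1 = t0 + r powr (s * p)"
    and al: "0 < \<alpha>" "\<alpha> < p - 1" and Z: "0 < Z" "slab r1 \<alpha> \<le> ennreal Z"
  defines "n \<equiv> real CARD('n)" and "eps \<equiv> p - 1 - \<alpha>" and "\<omega> \<equiv> unit_ball_vol (real CARD('n))"
  defines "K \<equiv> 1 + p * s / n"
  defines "A \<equiv> ((p - 1) / (r1 powr (s * p) - r2 powr (s * p)) + (p * eps / 2 + \<alpha> * (2 * (p - 1) / eps) powr (p - 1)) * \<Lambda>
     * (2 * cutker_const TYPE('n) s p * ((r1 - r2) / 3) powr (- (p * s)))) * Z"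
  shows "slab r2 (\<alpha> * K) \<le> ennreal ((2 powr p / \<omega>) powr K / (p * eps * 2 powr (- p) / \<Lambda>) * A powr K)"
proof -
  \<comment> \<open>A third of the gap, because \<open>B'\<close>, the ball of radius
    \<open>r2 + 2 * d\<close>, has to fit into \<open>ball x0 r1\<close> and the locale demands
    \<open>r2 + 2 * d < r\<close>.\<close>
  define d where "d = (r1 - r2) / 3"
  interpret C: caccioppoli s p \<Lambda> \<rho> M t0 t1 r x0 U k \<alpha> eps r2 d
    by unfold_locales (use al r12 in \<open>auto simp: eps_def d_def field_simps\<close>)
  define \<tau>1 \<tau>2 where "\<tau>1 = t0 + r1 powr (s * p)" and "\<tau>2 = t0 + r2 powr (s * p)"
  have sp: "0 < s * p" using s p by simp
  have tau: "t0 < \<tau>2" "\<tau>2 < \<tau>1" "\<tau>1 \<le> t1"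
    using r12 sp by (auto simp: \<tau>1_def \<tau>2_def t1 intro!: powr_less_mono2 powr_mono2)
  have B'r1: "C.B' \<subseteq> ball x0 r1" unfolding C.B'_def by (rule subset_ball) (use r12 in \<open>simp add: d_def field_simps\<close>)
  define k2 where "k2 = C.C0 * (2 * cutker_const TYPE('n) s p * d powr (- (p * s)))"
  have k2: "0 \<le> k2" using C.c0_pos by (simp add: k2_def cutker_const_def)
  define l where "l = \<tau>1 - \<tau>2"
  have l: "0 < l" using tau by (simp add: l_def)
  have A: "A = ((p - 1) / l + k2) * Z"
    by (simp add: A_def l_def \<tau>1_def \<tau>2_def k2_def C.C0_def d_def)
  have A0: "0 < A" using l k2 Z p by (simp add: A add_pos_nonneg)
  obtain N where N: "N \<in> null_sets lborel" and en: "\<And>c c'. c \<notin> N \<Longrightarrow> c' \<notin> N \<Longrightarrow> t0 < c \<Longrightarrow> c \<le> c' \<Longrightarrow> c' < t1 \<Longrightarrow>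
      ennreal ((p - 1) * C.mass c) + ennreal C.c0 * (\<integral>\<^sup>+t. indicator {c..c'} t * C.venergy t \<partial>lborel)
      \<le> ennreal ((p - 1) * C.mass c') + ennreal k2 * C.bulk c c'"
    unfolding k2_def using C.energy_inequality by blast
  define Bx where "Bx t = (\<integral>\<^sup>+x. ennreal (indicator (ball x0 r1) x * U x t powr \<alpha>) \<partial>lborel)" for t
  have [measurable]: "Bx \<in> borel_measurable borel" unfolding Bx_def by (rule slice_measurable)
  have slab1: "slab r1 \<alpha> = (\<integral>\<^sup>+t. indicator {t0<..<\<tau>1} t * Bx t \<partial>lborel)"
    by (simp add: slab_def \<tau>1_def Bx_def)
  have massn: "(\<integral>\<^sup>+x. ennreal (U x t powr \<alpha> * C.eta x powr p) \<partial>lborel) = ennreal (C.mass t)" for t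
    unfolding C.mass_def by (rule nn_integral_eq_integral[OF C.integrable_U_eta]) auto
  have mass_le: "ennreal (C.mass t) \<le> Bx t" for t
    unfolding massn[symmetric] Bx_def
  proof (intro nn_integral_mono ennreal_leI)
    fix x
    have "U x t powr \<alpha> * C.eta x powr p \<le> U x t powr \<alpha> * indicator C.B' x"
      by (intro mult_left_mono C.eta_powr_indicator) auto
    also have "\<dots> \<le> indicator (ball x0 r1) x * U x t powr \<alpha>"
      using B'r1 by (auto simp: indicator_def)
    finally show "U x t powr \<alpha> * C.eta x powr p \<le> indicator (ball x0 r1) x * U x t powr \<alpha>" .
  qed
  have bulk_le: "C.bulk c c' \<le> ennreal Z" if "t0 < c" "c' < \<tau>1" for c c'
  proof -
    have "C.bulk c c' \<le> (\<integral>\<^sup>+t. indicator {t0<..<\<tau>1} t * Bx t \<partial>lborel)"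
      unfolding C.bulk_def
    proof (rule nn_integral_mono)
      fix t
      have "(\<integral>\<^sup>+x. C.weight t x \<partial>lborel) \<le> Bx t"
        unfolding Bx_def C.weight_def using B'r1 by (intro nn_integral_mono ennreal_leI) (auto simp: indicator_def)
      then show "indicator {c..c'} t * (\<integral>\<^sup>+x. C.weight t x \<partial>lborel) \<le> indicator {t0<..<\<tau>1} t * Bx t"
        using that by (auto simp: indicator_def)
    qed
    also have "\<dots> \<le> ennreal Z" using Z slab1 by simp
    finally show ?thesis .
  qed
  have NAE: "AE t in lborel. t \<notin> N" by (rule AE_not_in[OF N])
  have X_le: "ennreal ((p - 1) * C.mass c) + ennreal C.c0 * (\<integral>\<^sup>+t. indicator {c..\<tau>2} t * C.venergy t \<partial>lborel) \<le> ennreal A"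
    if c: "c \<notin> N" "t0 < c" "c < \<tau>2" for c
  proof -
    define X where "X = ennreal ((p - 1) * C.mass c) + ennreal C.c0 * (\<integral>\<^sup>+t. indicator {c..\<tau>2} t * C.venergy t \<partial>lborel)"
    \<comment> \<open>No bound is known for the mass at a single later time; averaging over
      \<open>c'\<close> in \<open>(\<tau>2, \<tau>1)\<close> replaces it by the space-time integral
      divided by \<open>l\<close>.\<close>
    have "X * ennreal l = (\<integral>\<^sup>+c'. X * indicator {\<tau>2<..<\<tau>1} c' \<partial>lborel)"
      using tau by (subst nn_integral_cmult_indicator) (auto simp: l_def)
    also have "\<dots> \<le> (\<integral>\<^sup>+c'. ennreal (p - 1) * (indicator {t0<..<\<tau>1} c' * Bx c') + (ennreal k2 * ennreal Z) * indicator {\<tau>2<..<\<tau>1} c' \<partial>lborel)"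
    proof (rule nn_integral_mono_AE)
      show "AE c' in lborel. X * indicator {\<tau>2<..<\<tau>1} c' \<le> ennreal (p - 1) * (indicator {t0<..<\<tau>1} c' * Bx c') + (ennreal k2 * ennreal Z) * indicator {\<tau>2<..<\<tau>1} c'"
        using NAE
      proof eventually_elim
        case (elim c')
        show ?case
        proof (cases "c' \<in> {\<tau>2<..<\<tau>1}")
          case True
          have "X \<le> ennreal ((p - 1) * C.mass c) + ennreal C.c0 * (\<integral>\<^sup>+t. indicator {c..c'} t * C.venergy t \<partial>lborel)"
            unfolding X_def using True by (intro add_left_mono mult_left_mono nn_integral_mono) (auto simp: indicator_def)
          also have "\<dots> \<le> ennreal ((p - 1) * C.mass c') + ennreal k2 * C.bulk c c'"
            by (rule en) (use c elim True tau in auto)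
          also have "\<dots> \<le> ennreal (p - 1) * Bx c' + ennreal k2 * ennreal Z"
            using p c True by (intro add_mono mult_left_mono bulk_le) (auto simp: ennreal_mult' intro!: mult_left_mono mass_le)
          finally show ?thesis using True tau by simp
        qed simp
      qed
    qed
    also have "\<dots> = ennreal (p - 1) * slab r1 \<alpha> + (ennreal k2 * ennreal Z) * ennreal l"
      using tau by (simp add: nn_integral_add nn_integral_cmult slab1 nn_integral_cmult_indicator l_def)
    also have "\<dots> \<le> ennreal (p - 1) * ennreal Z + (ennreal k2 * ennreal Z) * ennreal l"
      by (intro add_right_mono mult_left_mono Z) auto
    also have "\<dots> = ennreal ((p - 1) * Z + k2 * Z * l)"
      using p Z k2 l by (simp add: ennreal_mult' ennreal_plus)
    also have "(p - 1) * Z + k2 * Z * l = A * l" using l by (simp add: A field_simps)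
    finally have *: "X * ennreal l \<le> ennreal (A * l)" .
    have "X \<le> ennreal A"
    proof (cases X)
      case (real x)
      then have "ennreal (x * l) \<le> ennreal (A * l)" using * l by (simp add: ennreal_mult')
      then have "x * l \<le> A * l" using A0 l by (subst (asm) ennreal_le_iff) auto
      then show ?thesis using l real by (simp add: ennreal_leI)
    next
      case top
      then show ?thesis using * l by (simp add: ennreal_top_mult top_unique)
    qed
    then show ?thesis by (simp add: X_def)
  qed
  have mass_A: "ennreal (C.mass c) \<le> ennreal A" if "c \<notin> N" "t0 < c" "c < \<tau>2" for c
  proof -
    have "C.mass c \<le> (p - 1) * C.mass c" using p mult_right_mono[of 1 "p - 1" "C.mass c"] by simp
    then have "ennreal (C.mass c) \<le> ennreal ((p - 1) * C.mass c)" by (rule ennreal_leI)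
    also have "\<dots> \<le> ennreal ((p - 1) * C.mass c) + ennreal C.c0 * (\<integral>\<^sup>+t. indicator {c..\<tau>2} t * C.venergy t \<partial>lborel)"
      by simp
    also have "\<dots> \<le> ennreal A" by (rule X_le[OF that])
    finally show ?thesis .
  qed
  have energy_A: "(\<integral>\<^sup>+t. indicator {t0<..<\<tau>2} t * C.venergy t \<partial>lborel) \<le> ennreal (A / C.c0)"
  proof (rule nn_integral_Ioo_le_if_Icc_le[OF _ N tau(1)])
    fix c assume c: "c \<notin> N" "t0 < c" "c < \<tau>2"
    have "ennreal C.c0 * (\<integral>\<^sup>+t. indicator {c..\<tau>2} t * C.venergy t \<partial>lborel) \<le> ennreal A"
      using order_trans[OF _ X_le[OF c], of "ennreal C.c0 * (\<integral>\<^sup>+t. indicator {c..\<tau>2} t * C.venergy t \<partial>lborel)"] by simp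
    then have "ennreal (1 / C.c0) * (ennreal C.c0 * (\<integral>\<^sup>+t. indicator {c..\<tau>2} t * C.venergy t \<partial>lborel)) \<le> ennreal (1 / C.c0) * ennreal A"
      by (rule mult_left_mono) auto
    moreover have "ennreal (1 / C.c0) * (ennreal C.c0 * Y) = Y" for Y
      using C.c0_pos by (simp add: mult.assoc[symmetric] ennreal_mult'[symmetric])
    moreover have "ennreal (1 / C.c0) * ennreal A = ennreal (A / C.c0)"
      using C.c0_pos A0 by (simp add: ennreal_mult'[symmetric])
    ultimately show "(\<integral>\<^sup>+t. indicator {c..\<tau>2} t * C.venergy t \<partial>lborel) \<le> ennreal (A / C.c0)" by simp
  qed measurable
  define cN where "cN = (2 powr p / \<omega>) powr K * A powr (K - 1)"
  have slice: "(\<integral>\<^sup>+x. ennreal (indicator (ball x0 r2) x * U x t powr (\<alpha> * K)) \<partial>lborel) \<le> ennreal cN * C.venergy t"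
    if t: "t \<notin> N" "t0 < t" "t < \<tau>2" for t
  proof -
    have vpow: "\<bar>C.vv t y\<bar> powr p = U y t powr \<alpha> * C.eta y powr p" for y
      using p by (simp add: C.vv_def abs_mult powr_mult powr_powr)
    have "(\<integral>\<^sup>+y. \<bar>C.vv t y\<bar> powr p \<partial>lborel) \<le> ennreal A"
      using mass_A[OF t] massn[of t] by (simp add: vpow)
    then have nash: "ennreal (\<bar>C.vv t x\<bar> powr (p * K)) \<le> ennreal cN * (\<integral>\<^sup>+y. \<bar>C.vv t x - C.vv t y\<bar> powr p * fker s p (x - y) \<partial>lborel)" for x
      unfolding cN_def K_def n_def \<omega>_def
      by (intro pointwise_nash) (use s p A0 in auto)
    have "(\<integral>\<^sup>+x. ennreal (indicator (ball x0 r2) x * U x t powr (\<alpha> * K)) \<partial>lborel) \<le> (\<integral>\<^sup>+x. ennreal (\<bar>C.vv t x\<bar> powr (p * K)) \<partial>lborel)"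
    proof (intro nn_integral_mono ennreal_leI)
      fix x
      show "indicator (ball x0 r2) x * U x t powr (\<alpha> * K) \<le> \<bar>C.vv t x\<bar> powr (p * K)"
      proof (cases "x \<in> ball x0 r2")
        case True
        then have "C.eta x = 1" unfolding C.eta_def by (intro cutoff_eq_1) (use C.d in auto)
        then show ?thesis using True p by (simp add: C.vv_def powr_powr)
      qed simp
    qed
    also have "\<dots> \<le> (\<integral>\<^sup>+x. ennreal cN * (\<integral>\<^sup>+y. \<bar>C.vv t x - C.vv t y\<bar> powr p * fker s p (x - y) \<partial>lborel) \<partial>lborel)"
      by (intro nn_integral_mono nash)
    also have "\<dots> = ennreal cN * C.venergy t"
    proof -
      have m: "(\<lambda>z. ennreal (C.vdiff z t)) \<in> borel_measurable (borel :: 'n points measure)"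
        by measurable
      have "C.venergy t = (\<integral>\<^sup>+x. \<integral>\<^sup>+y. ennreal (C.vdiff (x, y) t) \<partial>lborel \<partial>lborel)"
        unfolding C.venergy_def by (rule nn_integral_lborel_pair(1)[OF m])
      moreover have "(\<integral>\<^sup>+x. ennreal cN * (\<integral>\<^sup>+y. ennreal (C.vdiff (x, y) t) \<partial>lborel) \<partial>lborel)
         = ennreal cN * (\<integral>\<^sup>+x. \<integral>\<^sup>+y. ennreal (C.vdiff (x, y) t) \<partial>lborel \<partial>lborel)"
        using borel_measurable_nn_lborel[OF m] by (intro nn_integral_cmult) simp
      ultimately show ?thesis by (simp add: C.vdiff_def)
    qed
    finally show ?thesis .
  qed
  have "slab r2 (\<alpha> * K) \<le> (\<integral>\<^sup>+t. ennreal cN * (indicator {t0<..<\<tau>2} t * C.venergy t) \<partial>lborel)"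
    unfolding slab_def \<tau>2_def[symmetric]
  proof (rule nn_integral_mono_AE)
    show "AE t in lborel. indicator {t0<..<\<tau>2} t * (\<integral>\<^sup>+x. ennreal (indicator (ball x0 r2) x * U x t powr (\<alpha> * K)) \<partial>lborel)
       \<le> ennreal cN * (indicator {t0<..<\<tau>2} t * C.venergy t)"
      using NAE
    proof eventually_elim
      case (elim t)
      show ?case using slice[of t] elim by (cases "t \<in> {t0<..<\<tau>2}") auto
    qed
  qed
  also have "\<dots> = ennreal cN * (\<integral>\<^sup>+t. indicator {t0<..<\<tau>2} t * C.venergy t \<partial>lborel)"
    by (rule nn_integral_cmult) measurable
  also have "\<dots> \<le> ennreal cN * ennreal (A / C.c0)"
    by (intro mult_left_mono energy_A) auto
  also have "\<dots> = ennreal (cN * (A / C.c0))"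
    using A0 C.c0_pos by (subst ennreal_mult') (auto simp: cN_def)
  also have "cN * (A / C.c0) = (2 powr p / \<omega>) powr K / (p * eps * 2 powr (- p) / \<Lambda>) * A powr K"
    using A0 by (simp add: cN_def C.c0_def powr_diff)
  finally show ?thesis .
qed

end

text \<open>One-step constant for averages, uniform in \<open>\<alpha> \<le> p - 1 - e0\<close>.
  \<open>CA\<close> collects the bounds for the time layer, with \<open>min 1 \<sigma>\<close> from
  \<open>powr_diff_lower\<close>, and for the space layer, with \<open>3 powr \<sigma>\<close> from
  the width \<open>(r1 - r2) / 3\<close>; \<open>2 powr (n + \<sigma>)\<close> compares the cylinder
  of radius \<open>r2 \<ge> r / 2\<close> with that of radius \<open>r\<close>.\<close>

definition moser_const :: "'n::finite itself \<Rightarrow> real \<Rightarrow> real \<Rightarrow> real \<Rightarrow> real \<Rightarrow> real" where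
  "moser_const TYPEn s p \<Lambda> e0 =
    (let n = real CARD('n); \<sigma> = s * p; K = 1 + p * s / n; \<omega> = unit_ball_vol n;
       CA = (p - 1) * 2 powr \<sigma> / min 1 \<sigma>
         + (p * p / 2 + p * (2 * (p - 1) / e0) powr (p - 1)) * \<Lambda> * (2 * cutker_const TYPEn s p * 3 powr \<sigma>)
     in max 1 ((2 powr p / \<omega>) powr K / (p * e0 * 2 powr (- p) / \<Lambda>) * (CA * \<omega>) powr K * 2 powr (n + \<sigma>) / \<omega>))"

text \<open>With \<open>z = r2 / r1\<close> this reduces to
  \<open>min 1 \<sigma> * (1 - z) \<le> 1 - z powr \<sigma>\<close>, which is concavity for
  \<open>\<sigma> \<le> 1\<close> and \<open>z powr \<sigma> \<le> z\<close> beyond.\<close>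

lemma powr_diff_lower:
  fixes r r1 r2 \<sigma> :: real
  assumes "r / 2 \<le> r2" "r2 < r1" "r1 \<le> r" "0 < r" "0 < \<sigma>"
  shows "min 1 \<sigma> * ((r1 - r2) / r) * (r / 2) powr \<sigma> \<le> r1 powr \<sigma> - r2 powr \<sigma>"
proof -
  define z where "z = r2 / r1"
  have r1: "0 < r1" "0 < r2" using assms by auto
  have z: "0 < z" "z < 1" using assms r1 by (auto simp: z_def)
  have zz: "min 1 \<sigma> * (1 - z) \<le> 1 - z powr \<sigma>"
  proof (cases "\<sigma> \<le> 1")
    case True
    then show ?thesis using powr_le_affine[of z \<sigma>] z assms by (simp add: algebra_simps)
  next
    case False
    then have "z powr \<sigma> \<le> z powr 1" by (intro powr_mono') (use z in auto)
    then show ?thesis using False z by simp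
  qed
  have "(r1 - r2) / r \<le> (r1 - r2) / r1"
    by (rule divide_left_mono) (use assms r1 in auto)
  also have "\<dots> = 1 - z" using r1 by (simp add: z_def field_simps)
  finally have "min 1 \<sigma> * ((r1 - r2) / r) * (r / 2) powr \<sigma> \<le> min 1 \<sigma> * (1 - z) * r1 powr \<sigma>"
    by (intro mult_mono powr_mono2) (use assms z in auto)
  also have "\<dots> \<le> (1 - z powr \<sigma>) * r1 powr \<sigma>" by (intro mult_right_mono zz) auto
  also have "\<dots> = r1 powr \<sigma> - r2 powr \<sigma>"
    using r1 by (simp add: z_def left_diff_distrib flip: powr_mult)
  finally show ?thesis .
qed

context nonlocal_supersolution
begin

definition "vol R = unit_ball_vol (real CARD('n)) * R powr (real CARD('n) + s * p)"
definition "avg R \<alpha> = enn2real (slab R \<alpha>) / vol R"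

lemma vol_pos: "0 < R \<Longrightarrow> 0 < vol R"
  by (simp add: vol_def)

lemma slab_const:
  assumes "0 < R" "0 \<le> c"
  shows "(\<integral>\<^sup>+t. indicator {t0<..<t0 + R powr (s * p)} t * (\<integral>\<^sup>+x. ennreal (indicator (ball x0 R) x * c) \<partial>lborel) \<partial>lborel)
    = ennreal (c * vol R)"
proof -
  have "(\<integral>\<^sup>+x. ennreal (indicator (ball x0 R) x * c) \<partial>lborel) = (\<integral>\<^sup>+x. ennreal c * indicator (ball x0 R) x \<partial>lborel)"
    using assms by (simp add: ennreal_mult' ennreal_indicator mult.commute)
  also have "\<dots> = ennreal c * ennreal (unit_ball_vol (real CARD('n)) * R ^ CARD('n))"
    using assms by (subst nn_integral_cmult_indicator) (auto simp: emeasure_ball)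
  also have "\<dots> = ennreal (c * (unit_ball_vol (real CARD('n)) * R powr real CARD('n)))"
    using assms by (simp add: ennreal_mult' powr_realpow)
  finally have i: "(\<integral>\<^sup>+x. ennreal (indicator (ball x0 R) x * c) \<partial>lborel) = ennreal (c * (unit_ball_vol (real CARD('n)) * R powr real CARD('n)))" .
  have "(\<integral>\<^sup>+t. indicator {t0<..<t0 + R powr (s * p)} t * ennreal (c * (unit_ball_vol (real CARD('n)) * R powr real CARD('n))) \<partial>(lborel :: real measure))
     = ennreal (R powr (s * p)) * ennreal (c * (unit_ball_vol (real CARD('n)) * R powr real CARD('n)))"
    by (subst nn_integral_multc) auto
  also have "\<dots> = ennreal (c * vol R)"
    using assms by (subst ennreal_mult'[symmetric]) (auto simp: vol_def powr_add mult_ac)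
  finally show ?thesis unfolding i .
qed

lemma slab_bounds:
  assumes "0 < R" "0 < \<alpha>"
  shows "ennreal (\<rho> powr \<alpha> * vol R) \<le> slab R \<alpha>" "slab R \<alpha> \<le> ennreal (M powr \<alpha> * vol R)"
proof -
  have lo: "\<rho> powr \<alpha> \<le> U x t powr \<alpha>" and hi: "U x t powr \<alpha> \<le> M powr \<alpha>" for x t
    using assms rho U_ge U_le by (auto intro!: powr_mono2)
  show "ennreal (\<rho> powr \<alpha> * vol R) \<le> slab R \<alpha>"
    using assms by (subst slab_const[symmetric])
      (auto simp: slab_def intro!: nn_integral_mono mult_left_mono ennreal_leI lo)
  show "slab R \<alpha> \<le> ennreal (M powr \<alpha> * vol R)"
    using assms by (subst slab_const[symmetric])
      (auto simp: slab_def intro!: nn_integral_mono mult_left_mono ennreal_leI hi)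
qed

text \<open>\<open>U\<close> lies between \<open>\<rho>\<close> and \<open>M\<close>, so the
  conversion from \<open>ennreal\<close> loses nothing and averages are positive, as the
  manipulation of their powers requires.\<close>

lemma slab_avg:
  assumes "0 < R" "0 < \<alpha>"
  shows "slab R \<alpha> = ennreal (avg R \<alpha> * vol R)" "0 < avg R \<alpha>"
proof -
  have fin: "slab R \<alpha> < \<infinity>" using slab_bounds(2)[OF assms] by (simp add: le_less_trans)
  then show "slab R \<alpha> = ennreal (avg R \<alpha> * vol R)"
    using vol_pos[OF assms(1)] by (simp add: avg_def)
  have "0 < ennreal (\<rho> powr \<alpha> * vol R)" using vol_pos[OF assms(1)] rho by simp
  then have "0 < slab R \<alpha>" using slab_bounds(1)[OF assms] by (rule less_le_trans)
  then have "0 < enn2real (slab R \<alpha>)" using fin by (simp add: enn2real_positive_iff)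
  then show "0 < avg R \<alpha>" using vol_pos[OF assms(1)] by (simp add: avg_def)
qed

text \<open>Division by volumes makes \<open>moser_step\<close> scale invariant: since
  \<open>n * K = n + \<sigma>\<close>, the factor \<open>r powr n\<close> in the bound for
  \<open>A\<close>, raised to \<open>K\<close>, cancels against the volume. All negative powers of
  the relative width \<open>\<delta>\<close> are raised to \<open>\<delta> powr (- p)\<close>, which
  is possible because \<open>1 \<le> p\<close>, \<open>\<sigma> \<le> p\<close> and
  \<open>\<delta> \<le> 1\<close>.\<close>

lemma moser_normalized:
  assumes r12: "r / 2 \<le> r2" "r2 < r1" "r1 \<le> r" "0 < r" and t1: "t1 = t0 + r powr (s * p)"
    and al: "0 < \<alpha>" "\<alpha> \<le> p - 1 - e0" "0 < e0"
  defines "K \<equiv> 1 + p * s / real CARD('n)"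
  shows "avg r2 (\<alpha> * K) \<le> moser_const TYPE('n) s p \<Lambda> e0 * (((r1 - r2) / r) powr (- p) * avg r1 \<alpha>) powr K"
proof -
  define n where "n = real CARD('n)"
  define \<sigma> where "\<sigma> = s * p"
  define \<omega> where "\<omega> = unit_ball_vol n"
  define \<delta> where "\<delta> = (r1 - r2) / r"
  define eps where "eps = p - 1 - \<alpha>"
  define cc where "cc = cutker_const TYPE('n) s p"
  define CA where "CA = (p - 1) * 2 powr \<sigma> / min 1 \<sigma>
         + (p * p / 2 + p * (2 * (p - 1) / e0) powr (p - 1)) * \<Lambda> * (2 * cc * 3 powr \<sigma>)"
  define Z where "Z = avg r1 \<alpha> * vol r1"
  define A where "A = ((p - 1) / (r1 powr \<sigma> - r2 powr \<sigma>) + (p * eps / 2 + \<alpha> * (2 * (p - 1) / eps) powr (p - 1)) * \<Lambda>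
     * (2 * cc * ((r1 - r2) / 3) powr (- \<sigma>))) * Z"
  have n: "0 < n" by (simp add: n_def)
  have \<sigma>: "0 < \<sigma>" "\<sigma> \<le> p" using s p by (auto simp: \<sigma>_def)
  have om: "0 < \<omega>" using n by (simp add: \<omega>_def)
  have rp: "0 < r1" "0 < r2" using r12 by auto
  have de: "0 < \<delta>" "\<delta> \<le> 1" using r12 by (auto simp: \<delta>_def field_simps)
  have ep: "e0 \<le> eps" "0 < eps" "eps \<le> p" using al by (auto simp: eps_def)
  have cc: "0 \<le> cc" by (simp add: cc_def cutker_const_def)
  have K: "1 < K" "K = 1 + \<sigma> / n" using p s n by (auto simp: K_def \<sigma>_def n_def mult.commute)
  have Z0: "0 < Z" using slab_avg(2)[OF rp(1) al(1)] vol_pos[OF rp(1)] by (simp add: Z_def)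
  have av: "0 < avg r1 \<alpha>" by (rule slab_avg(2)[OF rp(1) al(1)])
  have pow_de: "\<delta> powr (- x) \<le> \<delta> powr (- p)" if "x \<le> p" for x
    by (rule powr_mono') (use that de in auto)
  have t_up: "(p - 1) / (r1 powr \<sigma> - r2 powr \<sigma>) \<le> (p - 1) * 2 powr \<sigma> / min 1 \<sigma> * (r powr (- \<sigma>) * \<delta> powr (- p))"
  proof -
    have lo: "min 1 \<sigma> * \<delta> * (r / 2) powr \<sigma> \<le> r1 powr \<sigma> - r2 powr \<sigma>"
      unfolding \<delta>_def by (rule powr_diff_lower) (use r12 \<sigma> in auto)
    have pos: "0 < min 1 \<sigma> * \<delta> * (r / 2) powr \<sigma>" using \<sigma> de r12 by simp
    have "(p - 1) / (r1 powr \<sigma> - r2 powr \<sigma>) \<le> (p - 1) / (min 1 \<sigma> * \<delta> * (r / 2) powr \<sigma>)"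
      by (rule divide_left_mono[OF lo]) (use p pos lo in \<open>auto intro!: mult_pos_pos\<close>)
    also have "\<dots> = (p - 1) * 2 powr \<sigma> / min 1 \<sigma> * (r powr (- \<sigma>) * \<delta> powr (- 1))"
      using r12 de by (simp add: powr_divide powr_minus field_simps)
    also have "\<dots> \<le> (p - 1) * 2 powr \<sigma> / min 1 \<sigma> * (r powr (- \<sigma>) * \<delta> powr (- p))"
      by (intro mult_left_mono pow_de) (use p \<sigma> in auto)
    finally show ?thesis .
  qed
  have e_up: "p * eps / 2 + \<alpha> * (2 * (p - 1) / eps) powr (p - 1) \<le> p * p / 2 + p * (2 * (p - 1) / e0) powr (p - 1)"
  proof -
    have "(2 * (p - 1) / eps) powr (p - 1) \<le> (2 * (p - 1) / e0) powr (p - 1)"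
      by (intro powr_mono2 divide_left_mono) (use p ep al in auto)
    then have "\<alpha> * (2 * (p - 1) / eps) powr (p - 1) \<le> p * (2 * (p - 1) / e0) powr (p - 1)"
      by (intro mult_mono) (use al p in auto)
    moreover have "p * eps \<le> p * p" using ep p by (intro mult_left_mono) auto
    ultimately show ?thesis by simp
  qed
  have d_up: "((r1 - r2) / 3) powr (- \<sigma>) \<le> 3 powr \<sigma> * (r powr (- \<sigma>) * \<delta> powr (- p))"
  proof -
    have "(r1 - r2) / 3 = r * \<delta> / 3" using r12 by (simp add: \<delta>_def)
    then have "((r1 - r2) / 3) powr (- \<sigma>) = (r * \<delta> / 3) powr (- \<sigma>)" by (simp only:)
    also have "\<dots> = 3 powr \<sigma> * (r powr (- \<sigma>) * \<delta> powr (- \<sigma>))"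
      using r12 de by (simp add: powr_divide powr_mult powr_minus field_simps)
    also have "\<dots> \<le> 3 powr \<sigma> * (r powr (- \<sigma>) * \<delta> powr (- p))"
      by (intro mult_left_mono pow_de \<sigma>) auto
    finally show ?thesis .
  qed
  have "A \<le> ((p - 1) * 2 powr \<sigma> / min 1 \<sigma> * (r powr (- \<sigma>) * \<delta> powr (- p))
      + (p * p / 2 + p * (2 * (p - 1) / e0) powr (p - 1)) * \<Lambda> * (2 * cc * (3 powr \<sigma> * (r powr (- \<sigma>) * \<delta> powr (- p))))) * Z"
    unfolding A_def
    by (intro mult_right_mono add_mono mult_mono t_up e_up d_up order_refl)
       (use Z0 Lam cc p in \<open>auto intro!: add_nonneg_nonneg mult_nonneg_nonneg\<close>)
  also have "\<dots> = CA * (r powr (- \<sigma>) * \<delta> powr (- p)) * Z" by (simp add: CA_def algebra_simps)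
  finally have A_le1: "A \<le> CA * (r powr (- \<sigma>) * \<delta> powr (- p)) * Z" .
  have CA0: "0 \<le> CA" using p \<sigma> cc Lam by (auto simp: CA_def intro!: add_nonneg_nonneg mult_nonneg_nonneg divide_nonneg_pos)
  have Z_le: "Z \<le> avg r1 \<alpha> * (\<omega> * r powr (n + \<sigma>))"
    unfolding Z_def vol_def n_def[symmetric] \<omega>_def[symmetric] \<sigma>_def[symmetric]
    by (intro mult_left_mono powr_mono2) (use r12 rp n \<sigma> om av in auto)
  have "A \<le> CA * (r powr (- \<sigma>) * \<delta> powr (- p)) * (avg r1 \<alpha> * (\<omega> * r powr (n + \<sigma>)))"
    by (rule order_trans[OF A_le1 mult_left_mono[OF Z_le]]) (use CA0 in auto)
  also have "\<dots> = CA * \<omega> * (\<delta> powr (- p) * avg r1 \<alpha>) * r powr n"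
    using r12 by (simp add: powr_add powr_minus field_simps)
  finally have A_le: "A \<le> CA * \<omega> * (\<delta> powr (- p) * avg r1 \<alpha>) * r powr n" .
  have tpos: "0 < r1 powr \<sigma> - r2 powr \<sigma>" using r12 rp \<sigma> by (simp add: powr_less_mono2)
  have A0: "0 \<le> A" unfolding A_def
    using tpos Z0 Lam cc p al ep by (intro mult_nonneg_nonneg add_nonneg_nonneg) auto
  define X where "X = \<delta> powr (- p) * avg r1 \<alpha>"
  have X0: "0 < X" using av de by (simp add: X_def)
  have "A powr K \<le> (CA * \<omega> * X * r powr n) powr K"
    using A_le A0 K by (intro powr_mono2) (auto simp: X_def)
  also have "\<dots> = (CA * \<omega>) powr K * X powr K * r powr (n + \<sigma>)"
  proof -
    have "n * K = n + \<sigma>" using n by (simp add: K(2) field_simps)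
    then show ?thesis by (simp add: powr_mult powr_powr)
  qed
  finally have AK: "A powr K \<le> (CA * \<omega>) powr K * X powr K * r powr (n + \<sigma>)" .
  define B where "B = (2 powr p / \<omega>) powr K / (p * e0 * 2 powr (- p) / \<Lambda>)"
  have B0: "0 < B" using om p al Lam by (simp add: B_def)
  have "slab r2 (\<alpha> * K) \<le> ennreal ((2 powr p / \<omega>) powr K / (p * eps * 2 powr (- p) / \<Lambda>) * A powr K)"
  proof -
    have "slab r1 \<alpha> \<le> ennreal Z" using slab_avg(1)[OF rp(1) al(1)] by (simp add: Z_def)
    moreover have "\<alpha> < p - 1" using al by simp
    ultimately show ?thesis
      using moser_step[OF rp(2) r12(2,3) t1 al(1) _ Z0]
      by (simp only: K_def A_def \<sigma>_def cc_def eps_def \<omega>_def n_def mult.commute[of p s])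
  qed
  also have "\<dots> \<le> ennreal (B * ((CA * \<omega>) powr K * X powr K * r powr (n + \<sigma>)))"
  proof (intro ennreal_leI mult_mono AK)
    show "(2 powr p / \<omega>) powr K / (p * eps * 2 powr (- p) / \<Lambda>) \<le> B"
      unfolding B_def using p al ep Lam om
      by (intro divide_left_mono divide_right_mono mult_right_mono mult_left_mono) auto
  qed (use B0 in auto)
  finally have sl: "slab r2 (\<alpha> * K) \<le> ennreal (B * ((CA * \<omega>) powr K * X powr K * r powr (n + \<sigma>)))" .
  have aK: "0 < \<alpha> * K" using al K by simp
  have "avg r2 (\<alpha> * K) * vol r2 \<le> B * ((CA * \<omega>) powr K * X powr K * r powr (n + \<sigma>))"
    using sl B0 unfolding slab_avg(1)[OF rp(2) aK] by (subst (asm) ennreal_le_iff) auto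
  moreover have "\<omega> * (r / 2) powr (n + \<sigma>) \<le> vol r2"
    unfolding vol_def n_def[symmetric] \<omega>_def[symmetric] \<sigma>_def[symmetric]
    by (intro mult_left_mono powr_mono2) (use r12 n \<sigma> om in auto)
  then have "avg r2 (\<alpha> * K) * (\<omega> * (r / 2) powr (n + \<sigma>)) \<le> avg r2 (\<alpha> * K) * vol r2"
    using slab_avg(2)[OF rp(2) aK] by (intro mult_left_mono) auto
  ultimately have "avg r2 (\<alpha> * K) * (\<omega> * (r / 2) powr (n + \<sigma>)) \<le> B * ((CA * \<omega>) powr K * X powr K * r powr (n + \<sigma>))"
    by linarith
  then have "avg r2 (\<alpha> * K) \<le> (B * (CA * \<omega>) powr K * 2 powr (n + \<sigma>) / \<omega>) * X powr K"
    using om r12 by (simp add: powr_divide field_simps)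
  also have "\<dots> \<le> moser_const TYPE('n) s p \<Lambda> e0 * X powr K"
    by (intro mult_right_mono)
       (auto simp: moser_const_def Let_def B_def CA_def cc_def \<omega>_def n_def K_def \<sigma>_def mult.commute[of p s])
  finally show ?thesis by (simp add: X_def \<delta>_def)
qed

end

section \<open>Finite iteration and the reverse Hoelder inequality\<close>

lemma moser_const_ge_1: "1 \<le> moser_const TYPE('n::finite) s p \<Lambda> e0"
  by (simp add: moser_const_def Let_def)

text \<open>The exponent \<open>m\<close> and the constant \<open>B\<close> are fixed points of one iteration step.\<close>

lemma iterate_reverse_hoelder:
  fixes \<Phi> :: "real \<Rightarrow> real \<Rightarrow> real"
  assumes step: "\<And>r1 r2 \<alpha>. r / 2 \<le> r2 \<Longrightarrow> r2 < r1 \<Longrightarrow> r1 \<le> r \<Longrightarrow> 0 < \<alpha> \<Longrightarrow> \<alpha> \<le> amax \<Longrightarrow>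
      \<Phi> r2 (\<alpha> * K) \<le> C1 * (((r1 - r2) / r) powr (- p) * \<Phi> r1 \<alpha>) powr K"
    and pos: "\<And>R \<alpha>. 0 < R \<Longrightarrow> 0 < \<alpha> \<Longrightarrow> 0 < \<Phi> R \<alpha>"
    and K: "1 < K" and C1: "1 \<le> C1" and p: "0 < p" and r: "0 < r"
  defines "m \<equiv> p * K / (K - 1)"
  defines "B \<equiv> (2 powr m * C1) powr (K / (K - 1))"
  shows "r / 2 \<le> R1 \<Longrightarrow> R1 < R2 \<Longrightarrow> R2 \<le> r \<Longrightarrow> 0 < \<alpha> \<Longrightarrow> \<alpha> * K ^ j \<le> amax \<Longrightarrow>
    \<Phi> R1 (\<alpha> * K ^ Suc j) powr (1 / K ^ Suc j) \<le> B * ((R2 - R1) / r) powr (- m) * \<Phi> R2 \<alpha>"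
proof (induction j arbitrary: R1 R2 \<alpha>)
  case (0 R1 R2 \<alpha>)
  define \<delta> where "\<delta> = (R2 - R1) / r"
  have de: "0 < \<delta>" "\<delta> \<le> 1" using 0 r by (auto simp: \<delta>_def field_simps)
  have ph: "0 < \<Phi> R2 \<alpha>" using pos 0 r by auto
  have pm: "p \<le> m" using K p by (simp add: m_def field_simps)
  have CB: "C1 \<le> B"
  proof -
    have m0: "0 \<le> m" using pm p by simp
    have g: "1 \<le> 2 powr m" using ge_one_powr_ge_zero[of 2 m] m0 by simp
    then have "C1 \<le> 2 powr m * C1" using C1 mult_right_mono[of 1 "2 powr m" C1] by simp
    also have "\<dots> = (2 powr m * C1) powr 1" using C1 by simp
    also have "\<dots> \<le> B" unfolding B_def
      by (rule powr_mono) (use K g C1 mult_mono[of 1 "2 powr m" 1 C1] in auto)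
    finally show ?thesis .
  qed
  have "\<Phi> R1 (\<alpha> * K) powr (1 / K) \<le> (C1 * (\<delta> powr (- p) * \<Phi> R2 \<alpha>) powr K) powr (1 / K)"
    unfolding \<delta>_def using step[of R1 R2 \<alpha>] 0 pos[of R1 "\<alpha> * K"] K r
    by (intro powr_mono2) auto
  also have "\<dots> = C1 powr (1 / K) * (\<delta> powr (- p) * \<Phi> R2 \<alpha>)"
    using C1 K ph de by (simp add: powr_mult powr_powr)
  also have "\<dots> \<le> B * (\<delta> powr (- m) * \<Phi> R2 \<alpha>)"
  proof (intro mult_mono)
    have "C1 powr (1 / K) \<le> C1 powr 1" by (rule powr_mono) (use K C1 in auto)
    then show "C1 powr (1 / K) \<le> B" using CB C1 by simp
    show "\<delta> powr (- p) \<le> \<delta> powr (- m)" by (rule powr_mono') (use de pm in auto)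
  qed (use ph B_def in auto)
  finally show ?case by (simp add: \<delta>_def mult.assoc)
next
  case (Suc j R1 R2 \<alpha>)
  define \<delta> where "\<delta> = (R2 - R1) / r"
  \<comment> \<open>The induction hypothesis covers the passage between \<open>R1\<close> and
    \<open>mid\<close>, a single step that between \<open>mid\<close> and \<open>R2\<close>. Halving
    the width costs \<open>2 powr m\<close>, which \<open>B\<close> absorbs.\<close>
  define mid where "mid = (R1 + R2) / 2"
  have mid: "R1 < mid" "mid < R2" "(mid - R1) / r = \<delta> / 2" "(R2 - mid) / r = \<delta> / 2"
    using Suc.prems by (auto simp: mid_def \<delta>_def field_simps)
  have de: "0 < \<delta>" "\<delta> \<le> 1" using Suc.prems r by (auto simp: \<delta>_def field_simps)
  have ph: "0 < \<Phi> R2 \<alpha>" "0 < \<Phi> mid (\<alpha> * K)" "0 < \<Phi> R1 (\<alpha> * K ^ Suc (Suc j))"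
    using pos Suc.prems mid r K by auto
  have al_le: "\<alpha> \<le> amax"
  proof -
    have "\<alpha> * 1 \<le> \<alpha> * K ^ Suc j" using K Suc.prems by (intro mult_left_mono one_le_power) auto
    from order_trans[OF this Suc.prems(5)] show ?thesis by simp
  qed
  have Km: "K * (m / K + p) = m * K" using K by (simp add: m_def field_simps)
  have mK: "m / K + p = m" using K by (simp add: m_def field_simps)
  have B1: "0 < B" using C1 by (simp add: B_def)
  have IH: "\<Phi> R1 (\<alpha> * K * K ^ Suc j) powr (1 / K ^ Suc j) \<le> B * (\<delta> / 2) powr (- m) * \<Phi> mid (\<alpha> * K)"
    using Suc.IH[of R1 mid "\<alpha> * K"] Suc.prems mid K by (simp add: mult.assoc)
  have st: "\<Phi> mid (\<alpha> * K) \<le> C1 * ((\<delta> / 2) powr (- p) * \<Phi> R2 \<alpha>) powr K"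
    using step[of mid R2 \<alpha>] Suc.prems mid al_le by simp
  have "\<Phi> R1 (\<alpha> * K ^ Suc (Suc j)) powr (1 / K ^ Suc (Suc j)) = (\<Phi> R1 (\<alpha> * K * K ^ Suc j) powr (1 / K ^ Suc j)) powr (1 / K)"
    using K by (simp add: powr_powr mult_ac)
  also have "\<dots> \<le> (B * (\<delta> / 2) powr (- m) * \<Phi> mid (\<alpha> * K)) powr (1 / K)"
    by (intro powr_mono2 IH) (use K in auto)
  also have "\<dots> \<le> (B * (\<delta> / 2) powr (- m) * (C1 * ((\<delta> / 2) powr (- p) * \<Phi> R2 \<alpha>) powr K)) powr (1 / K)"
    by (intro powr_mono2 mult_left_mono st) (use K B1 ph in auto)
  also have "\<dots> = (B powr (1 / K) * C1 powr (1 / K)) * ((\<delta> / 2) powr (- (m / K)) * (\<delta> / 2) powr (- p)) * \<Phi> R2 \<alpha>"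
    using K B1 C1 ph de by (simp add: powr_mult powr_powr)
  also have "(\<delta> / 2) powr (- (m / K)) * (\<delta> / 2) powr (- p) = (\<delta> / 2) powr (- m)"
  proof -
    have "- (m / K) + - p = - m" using mK by simp
    then show ?thesis by (simp only: powr_add[symmetric])
  qed
  also have "(\<delta> / 2) powr (- m) = 2 powr m * \<delta> powr (- m)"
    using de by (simp add: powr_divide powr_minus field_simps)
  also have "B powr (1 / K) * C1 powr (1 / K) * (2 powr m * \<delta> powr (- m)) * \<Phi> R2 \<alpha>
      = (B powr (1 / K) * C1 powr (1 / K) * 2 powr m) * (\<delta> powr (- m) * \<Phi> R2 \<alpha>)" by simp
  also have "\<dots> \<le> B * (\<delta> powr (- m) * \<Phi> R2 \<alpha>)"
  proof (intro mult_right_mono)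
    define b where "b = 2 powr m * C1"
    have b: "0 < b" using C1 by (simp add: b_def)
    have "C1 powr (1 / K) \<le> C1 powr 1" by (rule powr_mono) (use K C1 in auto)
    then have "B powr (1 / K) * C1 powr (1 / K) * 2 powr m \<le> B powr (1 / K) * C1 * 2 powr m"
      using C1 by (intro mult_right_mono mult_left_mono) auto
    also have "\<dots> = b powr (1 / (K - 1)) * b powr 1"
      using K b by (simp add: B_def b_def[symmetric] powr_powr) (simp add: b_def)
    also have "\<dots> = b powr (1 / (K - 1) + 1)" by (simp only: powr_add)
    also have "1 / (K - 1) + 1 = K / (K - 1)" using K by (simp add: field_simps)
    also have "b powr (K / (K - 1)) = B" by (simp add: B_def b_def)
    finally show "B powr (1 / K) * C1 powr (1 / K) * 2 powr m \<le> B" .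
  qed (use ph in auto)
  finally show ?case by (simp add: \<delta>_def mult.assoc)
qed

text \<open>Take the least \<open>n\<close> with \<open>q / K ^ n \<le> qb\<close>. The starting
  exponent \<open>\<alpha> = q / K ^ n\<close> is then at most \<open>qb\<close> but larger than
  \<open>qb / K\<close>, so Jensen's inequality is applicable and \<open>1 / \<alpha>\<close> stays
  below \<open>K / qb\<close>.\<close>

lemma exponent_bracket:
  fixes q qb K :: real
  assumes "0 < qb" "qb < q" "1 < K"
  obtains j where "q / K ^ Suc j \<le> qb" "qb < q / K ^ j"
proof -
  define P where "P n \<longleftrightarrow> q / K ^ n \<le> qb" for n
  obtain n0 where "q / qb < K ^ n0" using real_arch_pow[OF assms(3)] by blast
  then have "P n0" using assms by (simp add: P_def field_simps)
  then have P: "P (LEAST n. P n)" by (rule LeastI)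
  moreover have "\<not> P 0" using assms by (simp add: P_def)
  ultimately obtain j where j: "(LEAST n. P n) = Suc j" by (metis not0_implies_Suc)
  then have "\<not> P j" using not_less_Least[of j P] by simp
  then show thesis using P j that[of j] by (simp add: P_def not_le)
qed

context nonlocal_supersolution
begin

text \<open>Jensen's inequality from the tangent line of
  \<open>w \<mapsto> w powr (\<alpha> / \<beta>)\<close> at the average \<open>c\<close>: the affine
  majorant integrates to exactly \<open>c powr l\<close> times the volume.\<close>

lemma avg_jensen:
  assumes "0 < R" "0 < \<alpha>" "\<alpha> \<le> \<beta>"
  shows "avg R \<alpha> \<le> avg R \<beta> powr (\<alpha> / \<beta>)"
proof -
  define l where "l = \<alpha> / \<beta>"
  have l: "0 < l" "l \<le> 1" using assms by (auto simp: l_def)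
  have be: "0 < \<beta>" using assms by simp
  define c where "c = avg R \<beta>"
  have c: "0 < c" unfolding c_def by (rule slab_avg(2)[OF assms(1) be])
  define u v where "u = c powr l * (1 - l)" and "v = c powr l * l / c"
  have uv: "0 \<le> u" "0 \<le> v" using c l by (auto simp: u_def v_def)
  have pw: "U x t powr \<alpha> \<le> u + v * U x t powr \<beta>" for x t
  proof -
    define y where "y = U x t powr \<beta> / c"
    have "y powr l \<le> 1 + l * (y - 1)" by (rule powr_le_affine) (use c l less_imp_neq[OF U_pos[of x t]] in \<open>auto simp: y_def\<close>)
    then have "c powr l * y powr l \<le> c powr l * (1 + l * (y - 1))" by (rule mult_left_mono) auto
    moreover have "c powr l * y powr l = U x t powr \<alpha>"
      using c be by (simp add: y_def l_def powr_powr flip: powr_mult)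
    ultimately show ?thesis by (simp add: u_def v_def y_def algebra_simps)
  qed
  define Fu Fb where "Fu t = (\<integral>\<^sup>+x. ennreal (indicator (ball x0 R) x * u) \<partial>lborel)"
    and "Fb t = (\<integral>\<^sup>+x. ennreal (indicator (ball x0 R) x * U x t powr \<beta>) \<partial>lborel)" for t :: real
  have [measurable]: "Fb \<in> borel_measurable borel" "Fu \<in> borel_measurable borel"
    unfolding Fb_def Fu_def by (auto intro: slice_measurable)
  have "slab R \<alpha> \<le> (\<integral>\<^sup>+t. indicator {t0<..<t0 + R powr (s * p)} t * (Fu t + ennreal v * Fb t) \<partial>lborel)"
    unfolding slab_def
  proof (intro nn_integral_mono mult_left_mono)
    fix t
    have "(\<integral>\<^sup>+x. ennreal (indicator (ball x0 R) x * U x t powr \<alpha>) \<partial>lborel)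
      \<le> (\<integral>\<^sup>+x. ennreal (indicator (ball x0 R) x * u) + ennreal v * ennreal (indicator (ball x0 R) x * U x t powr \<beta>) \<partial>lborel)"
    proof (intro nn_integral_mono)
      fix x
      have "ennreal (indicator (ball x0 R) x * U x t powr \<alpha>) \<le> ennreal (indicator (ball x0 R) x * u + v * (indicator (ball x0 R) x * U x t powr \<beta>))"
        by (intro ennreal_leI) (use pw[of x t] in \<open>auto simp: indicator_def\<close>)
      then show "ennreal (indicator (ball x0 R) x * U x t powr \<alpha>) \<le> ennreal (indicator (ball x0 R) x * u) + ennreal v * ennreal (indicator (ball x0 R) x * U x t powr \<beta>)"
        using uv by (simp add: ennreal_plus ennreal_mult')
    qed
    also have "\<dots> = Fu t + ennreal v * Fb t"
    proof -
      have [measurable]: "ball x0 R \<in> sets borel" by simp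
      show ?thesis unfolding Fu_def Fb_def
        by (subst nn_integral_add) (auto simp: nn_integral_cmult)
    qed
    finally show "(\<integral>\<^sup>+x. ennreal (indicator (ball x0 R) x * U x t powr \<alpha>) \<partial>lborel) \<le> Fu t + ennreal v * Fb t" .
  qed auto
  also have "\<dots> = (\<integral>\<^sup>+t. indicator {t0<..<t0 + R powr (s * p)} t * Fu t + ennreal v * (indicator {t0<..<t0 + R powr (s * p)} t * Fb t) \<partial>lborel)"
    by (intro nn_integral_cong) (auto simp: indicator_def)
  also have "\<dots> = ennreal (u * vol R) + ennreal v * slab R \<beta>"
  proof -
    have "(\<integral>\<^sup>+t. indicator {t0<..<t0 + R powr (s * p)} t * Fu t \<partial>lborel) = ennreal (u * vol R)"
      unfolding Fu_def by (rule slab_const) (use uv assms in auto)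
    moreover have "(\<integral>\<^sup>+t. ennreal v * (indicator {t0<..<t0 + R powr (s * p)} t * Fb t) \<partial>lborel) = ennreal v * slab R \<beta>"
      by (subst nn_integral_cmult) (measurable, simp add: Fb_def slab_def)
    ultimately show ?thesis by (subst nn_integral_add) auto
  qed
  also have "\<dots> = ennreal (u * vol R + v * (c * vol R))"
    using uv c vol_pos[OF assms(1)] unfolding slab_avg(1)[OF assms(1) be] c_def
    by (simp add: ennreal_plus ennreal_mult')
  also have "u * vol R + v * (c * vol R) = c powr l * vol R"
    using c by (simp add: u_def v_def field_simps)
  finally have "avg R \<alpha> * vol R \<le> c powr l * vol R"
    unfolding slab_avg(1)[OF assms(1,2)] using vol_pos[OF assms(1)] by (subst (asm) ennreal_le_iff) auto
  then show ?thesis using vol_pos[OF assms(1)] by (simp add: c_def l_def)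
qed

text \<open>All exponents entering a step are at most \<open>q / K\<close>, so
  \<open>e0 = p - 1 - q / K\<close> serves every step. The iteration bound \<open>b\<close> is at
  least 1, which permits replacing its exponent \<open>1 / \<alpha>\<close> by
  \<open>K / qb\<close>; the resulting constant is independent of \<open>qb\<close>.\<close>

lemma reverse_hoelder:
  fixes \<theta> q qb :: real
  defines "K \<equiv> 1 + p * s / real CARD('n)"
  defines "m \<equiv> p * K / (K - 1)"
  defines "B \<equiv> (2 powr m * moser_const TYPE('n) s p \<Lambda> (p - 1 - q / K)) powr (K / (K - 1))"
  assumes r: "0 < r" and t1: "t1 = t0 + r powr (s * p)" and th: "1 / 2 \<le> \<theta>" "\<theta> < 1"
    and q: "0 < qb" "qb < q" "q < K * (p - 1)"
  shows "avg (\<theta> * r) q powr (1 / q) \<le> (B powr K * (1 - \<theta>) powr (- (m * K)) * avg r qb) powr (1 / qb)"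
proof -
  have K: "1 < K" using p s by (simp add: K_def)
  have m0: "0 < m" using K p by (simp add: m_def)
  obtain j where j: "q / K ^ Suc j \<le> qb" "qb < q / K ^ j" using exponent_bracket[OF q(1,2) K] .
  define \<alpha> where "\<alpha> = q / K ^ Suc j"
  have al: "0 < \<alpha>" "\<alpha> \<le> qb" "qb < K * \<alpha>" using q K j by (auto simp: \<alpha>_def)
  have aK: "\<alpha> * K ^ Suc j = q" "\<alpha> * K ^ j = q / K" using K by (auto simp: \<alpha>_def)
  have qK: "q / K < p - 1" using q K by (simp add: field_simps)
  define b where "b = B * (1 - \<theta>) powr (- m)"
  have B1: "1 \<le> B"
  proof -
    have "1 \<le> 2 powr m" using ge_one_powr_ge_zero[of 2 m] m0 by simp
    then have "1 \<le> 2 powr m * moser_const TYPE('n) s p \<Lambda> (p - 1 - q / K)"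
      using mult_mono[OF _ moser_const_ge_1[where 'n='n], of 1 "2 powr m" s p \<Lambda> "p - 1 - q / K"] by simp
    then show ?thesis unfolding B_def by (rule ge_one_powr_ge_zero) (use K in simp)
  qed
  have th1: "1 \<le> (1 - \<theta>) powr (- m)"
    using powr_mono'[of "- m" 0 "1 - \<theta>"] th m0 by simp
  have b1: "1 \<le> b" unfolding b_def using mult_mono[OF B1 th1 order_trans[OF zero_le_one B1]] by simp
  have "avg (\<theta> * r) (\<alpha> * K ^ Suc j) powr (1 / K ^ Suc j)
     \<le> (2 powr (p * K / (K - 1)) * moser_const TYPE('n) s p \<Lambda> (p - 1 - q / K)) powr (K / (K - 1)) * ((r - \<theta> * r) / r) powr (- (p * K / (K - 1))) * avg r \<alpha>"
  proof (rule iterate_reverse_hoelder[where amax = "q / K" and r = r])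
    fix r1 r2 \<alpha> assume "r / 2 \<le> r2" "r2 < r1" "r1 \<le> r" "0 < \<alpha>" "\<alpha> \<le> q / K"
    then show "avg r2 (\<alpha> * K) \<le> moser_const TYPE('n) s p \<Lambda> (p - 1 - q / K) * (((r1 - r2) / r) powr (- p) * avg r1 \<alpha>) powr K"
      unfolding K_def using qK by (intro moser_normalized r t1) (auto simp: K_def)
  next
    show "r / 2 \<le> \<theta> * r" "\<theta> * r < r" using th r by auto
  qed (use K p r al aK slab_avg(2) moser_const_ge_1 in auto)
  also have "(r - \<theta> * r) / r = 1 - \<theta>" using r by (simp add: field_simps)
  finally have it: "avg (\<theta> * r) q powr (1 / K ^ Suc j) \<le> b * avg r \<alpha>"
    by (simp only: aK b_def B_def m_def)
  have av: "0 < avg r \<alpha>" "0 < avg r qb" using slab_avg(2)[OF r] al q by auto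
  have "avg (\<theta> * r) q powr (1 / q) = (avg (\<theta> * r) q powr (1 / K ^ Suc j)) powr (1 / \<alpha>)"
    using K by (simp add: powr_powr \<alpha>_def)
  also have "\<dots> \<le> (b * avg r \<alpha>) powr (1 / \<alpha>)"
    by (intro powr_mono2 it) (use al in auto)
  also have "\<dots> \<le> (b * avg r qb powr (\<alpha> / qb)) powr (1 / \<alpha>)"
    by (intro powr_mono2 mult_left_mono avg_jensen r) (use al b1 av in auto)
  also have "\<dots> = b powr (1 / \<alpha>) * avg r qb powr (1 / qb)"
    using al b1 av by (simp add: powr_mult powr_powr)
  also have "\<dots> \<le> b powr (K / qb) * avg r qb powr (1 / qb)"
  proof (intro mult_right_mono powr_mono)
    show "1 / \<alpha> \<le> K / qb" using al q by (simp add: field_simps)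
  qed (use b1 in auto)
  also have "\<dots> = (b powr K * avg r qb) powr (1 / qb)"
    using b1 av by (simp add: powr_mult powr_powr)
  also have "b powr K = B powr K * (1 - \<theta>) powr (- (m * K))"
    using B1 th by (simp add: b_def powr_mult powr_powr)
  finally show ?thesis .
qed

end

section \<open>From weak supersolutions to Borel representatives\<close>

lemma AE_lborel_null_cover:
  fixes P :: "'a::euclidean_space \<Rightarrow> bool"
  assumes "AE x in lborel. P x"
  shows "\<exists>N\<in>null_sets lborel. \<forall>x. x \<notin> N \<longrightarrow> P x"
proof -
  obtain N where "{x \<in> space lborel. \<not> P x} \<subseteq> N" "emeasure lborel N = 0" "N \<in> sets lborel"
    by (rule AE_E[OF assms])
  then show ?thesis by (intro bexI[of _ N]) (auto simp: null_sets_def)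
qed

lemma AE_lborel_sections:
  fixes P :: "'a::euclidean_space \<times> 'b::euclidean_space \<Rightarrow> bool"
  assumes "AE z in lborel. P z"
  shows "AE x in lborel. AE y in lborel. P (x, y)" "AE y in lborel. AE x in lborel. P (x, y)"
proof -
  obtain N where N: "N \<in> null_sets lborel" "\<forall>x. x \<notin> N \<longrightarrow> P x"
    using AE_lborel_null_cover[OF assms] by (rule bexE)
  have Nb: "N \<in> sets borel" using N by (auto simp: null_sets_def)
  have ind: "(indicator N :: 'a \<times> 'b \<Rightarrow> ennreal) \<in> borel_measurable borel" using Nb by simp
  have ind': "(\<lambda>z. indicator N (snd z, fst z) :: ennreal) \<in> borel_measurable (borel :: ('b \<times> 'a) measure)"
  proof -
    have "(\<lambda>z. (snd z, fst z)) \<in> borel_measurable (borel :: ('b \<times> 'a) measure)" by measurable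
    from measurable_compose[OF this ind] show ?thesis .
  qed
  have "(\<integral>\<^sup>+z. indicator N z \<partial>lborel) = 0" using N(1) by (simp add: null_sets_def)
  then have z: "(\<integral>\<^sup>+x. \<integral>\<^sup>+y. indicator N (x, y) \<partial>lborel \<partial>lborel) = 0" "(\<integral>\<^sup>+y. \<integral>\<^sup>+x. indicator N (x, y) \<partial>lborel \<partial>lborel) = 0"
    using nn_integral_lborel_pair[OF ind] by simp_all
  have sec: "Measurable.pred borel (\<lambda>y. (x, y) \<in> N)" "Measurable.pred borel (\<lambda>x. (x, y) \<in> N)" for x y
    using measurable_sets[OF _ Nb, of "\<lambda>y. (x, y)" borel] measurable_sets[OF _ Nb, of "\<lambda>x. (x, y)" borel]
    by (auto simp: pred_def vimage_def)
  have "AE x in lborel. (\<integral>\<^sup>+y. indicator N (x, y) \<partial>lborel) = 0"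
    using z(1) borel_measurable_nn_lborel[OF ind] by (subst (asm) nn_integral_0_iff_AE) auto
  then show "AE x in lborel. AE y in lborel. P (x, y)"
  proof eventually_elim
    case (elim x)
    have "(\<lambda>y. indicator N (x, y) :: ennreal) \<in> borel_measurable lborel"
      using measurable_compose[OF _ ind, of "\<lambda>y. (x, y)" lborel] by simp
    with elim have "AE y in lborel. (indicator N (x, y) :: ennreal) = 0"
      by (subst (asm) nn_integral_0_iff_AE) auto
    then show ?case by eventually_elim (use N(2) in \<open>auto simp: indicator_def split: if_splits\<close>)
  qed
  have "AE y in lborel. (\<integral>\<^sup>+x. indicator N (x, y) \<partial>lborel) = 0"
    using z(2) borel_measurable_nn_lborel[OF ind'] by (subst (asm) nn_integral_0_iff_AE) auto
  then show "AE y in lborel. AE x in lborel. P (x, y)"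
  proof eventually_elim
    case (elim y)
    have "(\<lambda>x. indicator N (x, y) :: ennreal) \<in> borel_measurable lborel"
      using measurable_compose[OF _ ind, of "\<lambda>x. (x, y)" lborel] by simp
    with elim have "AE x in lborel. (indicator N (x, y) :: ennreal) = 0"
      by (subst (asm) nn_integral_0_iff_AE) auto
    then show ?case by eventually_elim (use N(2) in \<open>auto simp: indicator_def split: if_splits\<close>)
  qed
qed

lemma AE_lborel_snd:
  fixes P :: "'b::euclidean_space \<Rightarrow> bool"
  assumes "AE y in lborel. P y"
  shows "AE w in (lborel :: ('a::euclidean_space \<times> 'b) measure). P (snd w)"
proof -
  obtain N where N: "N \<in> null_sets lborel" "\<forall>x. x \<notin> N \<longrightarrow> P x"
    using AE_lborel_null_cover[OF assms] by (rule bexE)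
  have ind: "(\<lambda>w. indicator N (snd w) :: ennreal) \<in> borel_measurable (borel :: ('a \<times> 'b) measure)"
    using measurable_compose[OF borel_measurable_fst_snd(2), of "indicator N" borel] N by (auto simp: null_sets_def)
  have "(\<integral>\<^sup>+w. indicator N (snd w) \<partial>(lborel :: ('a \<times> 'b) measure)) = 0"
    using N(1) by (subst nn_integral_lborel_pair(1)[OF ind]) (simp add: null_sets_def)
  then have "AE w in (lborel :: ('a \<times> 'b) measure). (indicator N (snd w) :: ennreal) = 0"
    using ind by (subst (asm) nn_integral_0_iff_AE) auto
  then show ?thesis by eventually_elim (use N(2) in \<open>auto simp: indicator_def split: if_splits\<close>)
qed

lemma AE_lborel_fst:
  fixes P :: "'a::euclidean_space \<Rightarrow> bool"
  assumes "AE x in lborel. P x"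
  shows "AE w in (lborel :: ('a \<times> 'b::euclidean_space) measure). P (fst w)"
proof -
  obtain N where N: "N \<in> null_sets lborel" "\<forall>x. x \<notin> N \<longrightarrow> P x"
    using AE_lborel_null_cover[OF assms] by (rule bexE)
  have ind: "(\<lambda>w. indicator N (fst w) :: ennreal) \<in> borel_measurable (borel :: ('a \<times> 'b) measure)"
    using measurable_compose[OF borel_measurable_fst_snd(1), of "indicator N" borel] N by (auto simp: null_sets_def)
  have "(\<integral>\<^sup>+w. indicator N (fst w) \<partial>(lborel :: ('a \<times> 'b) measure)) = 0"
    using N(1) by (subst nn_integral_lborel_pair(2)[OF ind]) (simp add: null_sets_def)
  then have "AE w in (lborel :: ('a \<times> 'b) measure). (indicator N (fst w) :: ennreal) = 0"
    using ind by (subst (asm) nn_integral_0_iff_AE) auto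
  then show ?thesis by eventually_elim (use N(2) in \<open>auto simp: indicator_def split: if_splits\<close>)
qed

text \<open>The identity of \<open>u\<close> with its representative holds almost everywhere in
  \<open>(x, t)\<close>, while the nonlocal integral runs over \<open>(x, y, t)\<close>; the
  exceptional set has to be pulled back along the projection that omits \<open>y\<close>.\<close>

lemma AE_lborel_fst_third:
  fixes P :: "'a::euclidean_space \<times> 'c::euclidean_space \<Rightarrow> bool"
  assumes "AE z in lborel. P z"
  shows "AE w in (lborel :: ('a \<times> 'b::euclidean_space \<times> 'c) measure). P (fst w, snd (snd w))"
proof -
  obtain N where N: "N \<in> null_sets lborel" "\<forall>x. x \<notin> N \<longrightarrow> P x"
    using AE_lborel_null_cover[OF assms] by (rule bexE)
  have indN: "(indicator N :: 'a \<times> 'c \<Rightarrow> ennreal) \<in> borel_measurable borel" using N by (auto simp: null_sets_def)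
  have ind: "(\<lambda>w. indicator N (fst w, snd (snd w)) :: ennreal) \<in> borel_measurable (borel :: ('a \<times> 'b \<times> 'c) measure)"
  proof -
    have "(\<lambda>w. (fst w, snd (snd w))) \<in> borel_measurable (borel :: ('a \<times> 'b \<times> 'c) measure)"
      by (intro borel_measurable_Pair measurable_compose[OF borel_measurable_fst_snd(2) borel_measurable_fst_snd(2)]) measurable
    from measurable_compose[OF this indN] show ?thesis .
  qed
  have "(\<integral>\<^sup>+w. indicator N (fst w, snd (snd w)) \<partial>(lborel :: ('a \<times> 'b \<times> 'c) measure))
    = (\<integral>\<^sup>+x. \<integral>\<^sup>+v. indicator N (x, snd v) \<partial>(lborel :: ('b \<times> 'c) measure) \<partial>lborel)"
    by (subst nn_integral_lborel_pair(1)[OF ind]) simp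
  also have "\<dots> = (\<integral>\<^sup>+x. 0 \<partial>(lborel :: 'a measure))"
  proof (rule nn_integral_cong_AE)
    have "AE z in lborel. z \<notin> N" by (rule AE_not_in[OF N(1)])
    from AE_lborel_sections(1)[OF this]
    show "AE x in lborel. (\<integral>\<^sup>+v. indicator N (x, snd v) \<partial>(lborel :: ('b \<times> 'c) measure)) = 0"
    proof eventually_elim
      case (elim x)
      have v: "AE v in (lborel :: ('b \<times> 'c) measure). (x, snd v) \<notin> N" by (rule AE_lborel_snd[OF elim])
      have "(\<integral>\<^sup>+v. indicator N (x, snd v) \<partial>(lborel :: ('b \<times> 'c) measure)) = (\<integral>\<^sup>+v. 0 \<partial>(lborel :: ('b \<times> 'c) measure))"
      proof (rule nn_integral_cong_AE)
        show "AE v in (lborel :: ('b \<times> 'c) measure). (indicator N (x, snd v) :: ennreal) = 0"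
          using v by eventually_elim simp
      qed
      then show ?case by simp
    qed
  qed
  finally have "(\<integral>\<^sup>+w. indicator N (fst w, snd (snd w)) \<partial>(lborel :: ('a \<times> 'b \<times> 'c) measure)) = 0"
    by simp
  then have "AE w in (lborel :: ('a \<times> 'b \<times> 'c) measure). (indicator N (fst w, snd (snd w)) :: ennreal) = 0"
    using ind by (subst (asm) nn_integral_0_iff_AE) auto
  then show ?thesis by eventually_elim (use N(2) in \<open>auto simp: indicator_def split: if_splits\<close>)
qed

text \<open>The weak form integrates over \<open>(x, (y, t))\<close>, the energy estimates over
  \<open>((x, y), t)\<close>.\<close>

lemma lborel_assoc:
  "distr lborel borel (\<lambda>w. (fst (fst w), snd (fst w), snd w))
    = (lborel :: ('a::euclidean_space \<times> 'b::euclidean_space \<times> 'c::euclidean_space) measure)"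
proof (rule measure_eqI)
  fix A :: "('a \<times> 'b \<times> 'c) set"
  define f :: "('a \<times> 'b) \<times> 'c \<Rightarrow> 'a \<times> 'b \<times> 'c" where "f = (\<lambda>w. (fst (fst w), snd (fst w), snd w))"
  assume "A \<in> sets (distr lborel borel (\<lambda>w :: ('a \<times> 'b) \<times> 'c. (fst (fst w), snd (fst w), snd w)))"
  then have A: "A \<in> sets borel" by simp
  have f[measurable]: "f \<in> borel_measurable borel"
    unfolding f_def
    by (intro borel_measurable_Pair measurable_compose[OF borel_measurable_fst_snd(1)] borel_measurable_fst_snd)
  have iA: "(indicator A :: _ \<Rightarrow> ennreal) \<in> borel_measurable borel" using A by simp
  have ifA: "(\<lambda>w. indicator A (f w) :: ennreal) \<in> borel_measurable borel"
    by (rule measurable_compose[OF f iA])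
  have "emeasure (distr lborel borel f) A = (\<integral>\<^sup>+w. indicator A (f w) \<partial>lborel)"
  proof -
    have "emeasure (distr lborel borel f) A = (\<integral>\<^sup>+w. indicator A w \<partial>distr lborel borel f)"
      using A by (subst nn_integral_indicator) auto
    also have "\<dots> = (\<integral>\<^sup>+w. indicator A (f w) \<partial>lborel)"
      using f iA by (subst nn_integral_distr) auto
    finally show ?thesis .
  qed
  also have "\<dots> = (\<integral>\<^sup>+z. \<integral>\<^sup>+t. indicator A (f (z, t)) \<partial>lborel \<partial>lborel)"
    by (rule nn_integral_lborel_pair(1)[OF ifA])
  also have "\<dots> = (\<integral>\<^sup>+x. \<integral>\<^sup>+y. \<integral>\<^sup>+t. indicator A (f ((x, y), t)) \<partial>lborel \<partial>lborel \<partial>lborel)"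
    by (rule nn_integral_lborel_pair(1)[OF borel_measurable_nn_lborel[OF ifA]])
  also have "\<dots> = (\<integral>\<^sup>+x. \<integral>\<^sup>+v. indicator A (x, v) \<partial>lborel \<partial>lborel)"
  proof (rule nn_integral_cong)
    fix x
    have "(\<lambda>v. indicator A (x, v) :: ennreal) \<in> borel_measurable borel"
      using measurable_compose[OF _ iA, of "\<lambda>v. (x, v)" borel] by simp
    from nn_integral_lborel_pair(1)[OF this]
    show "(\<integral>\<^sup>+y. \<integral>\<^sup>+t. indicator A (f ((x, y), t)) \<partial>lborel \<partial>lborel) = (\<integral>\<^sup>+v. indicator A (x, v) \<partial>lborel)"
      by (simp add: f_def)
  qed
  also have "\<dots> = (\<integral>\<^sup>+w. indicator A w \<partial>lborel)"
    by (rule nn_integral_lborel_pair(1)[OF iA, symmetric])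
  finally show "emeasure (distr lborel borel (\<lambda>w. (fst (fst w), snd (fst w), snd w))) A = emeasure lborel A"
    using A by (simp add: f_def)
qed simp

lemma integral_lborel_assoc:
  fixes F :: "'a::euclidean_space \<times> 'b::euclidean_space \<times> 'c::euclidean_space \<Rightarrow> real"
  assumes "F \<in> borel_measurable borel"
  shows "(\<integral>w. F w \<partial>lborel) = (\<integral>w. F (fst (fst w), snd (fst w), snd w) \<partial>lborel)"
proof -
  have f: "(\<lambda>w. (fst (fst w), snd (fst w), snd w)) \<in> borel_measurable (borel :: (('a \<times> 'b) \<times> 'c) measure)"
    by (intro borel_measurable_Pair measurable_compose[OF borel_measurable_fst_snd(1)] borel_measurable_fst_snd)
  have "(\<integral>w. F w \<partial>lborel) = (\<integral>w. F w \<partial>distr lborel borel (\<lambda>w. (fst (fst w), snd (fst w), snd w)))"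
    by (simp add: lborel_assoc)
  also have "\<dots> = (\<integral>w. F (fst (fst w), snd (fst w), snd w) \<partial>lborel)"
    by (rule integral_distr) (use f assms in simp_all)
  finally show ?thesis .
qed

text \<open>Measurability of \<open>f\<close> follows from completeness of \<open>lebesgue\<close>
  and the identity with \<open>g\<close> almost everywhere.\<close>

lemma integral_lebesgue_transfer:
  fixes f g :: "'a::euclidean_space \<Rightarrow> real"
  assumes g: "g \<in> borel_measurable borel" and ae: "AE x in lborel. f x = g x"
  shows "integral\<^sup>L lebesgue f = integral\<^sup>L lborel g"
proof -
  have gl: "g \<in> borel_measurable lebesgue" using g by (simp add: measurable_completion)
  have ae': "AE x in lebesgue. f x = g x" by (rule AE_completion[OF ae])
  have "AE x in lebesgue. g x = f x" using ae' by eventually_elim simp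
  then have "f \<in> borel_measurable lebesgue" by (rule borel_measurable_AE[OF gl])
  then have "integral\<^sup>L lebesgue f = integral\<^sup>L lebesgue g" using gl ae' by (intro integral_cong_AE)
  also have "\<dots> = integral\<^sup>L lborel g" using g by (intro integral_completion) simp
  finally show ?thesis .
qed

lemma gagliardo_fker: "gagliardo s p f z = \<bar>f (fst z) - f (snd z)\<bar> powr p * fker s p (fst z - snd z)"
  by (simp add: gagliardo_def fker_def split_beta mult.commute)

lemma borel_version:
  fixes f :: "'a::euclidean_space \<Rightarrow> real"
  assumes "set_borel_measurable lebesgue S f"
  obtains g where "g \<in> borel_measurable borel" "AE x in lborel. x \<in> S \<longrightarrow> f x = g x"
proof -
  have m: "(\<lambda>x. indicator S x *\<^sub>R f x) \<in> borel_measurable lebesgue"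
    using assms by (simp only: set_borel_measurable_def)
  obtain g where g: "g \<in> borel_measurable lborel" "AE x in lborel. indicator S x *\<^sub>R f x = g x"
    using completion_ex_borel_measurable_real[OF m] by (rule bexE)
  show thesis
  proof (rule that)
    show "g \<in> borel_measurable borel" using g(1) by simp
    show "AE x in lborel. x \<in> S \<longrightarrow> f x = g x" using g(2) by eventually_elim (auto simp: indicator_def)
  qed
qed

text \<open>This makes 0 the weak time derivative of a function constant in time. The cutoff
  vanishes at 0 and \<open>T\<close> and has a continuous derivative, so the fundamental theorem of
  calculus applies.\<close>

lemma integral_deriv_time_cutoff:
  assumes eta: "\<eta> \<in> time_cutoff T" and T: "0 < T"
  shows "(LINT t:{0<..<T}|lebesgue. deriv \<eta> t) = 0"
proof -
  have smooth: "smooth_on UNIV \<eta>" and supp: "closure {t. \<eta> t \<noteq> 0} \<subseteq> {0<..<T}"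
    using eta by (simp_all add: time_cutoff_def)
  have sm: "Ck_on (Suc 0) UNIV \<eta>" using smooth unfolding smooth_on_def by (rule spec)
  have diff: "\<eta> differentiable (at t)" for t using sm by (auto simp: differentiable_on_def)
  have dd: "DERIV \<eta> t :> deriv \<eta> t" for t
    using diff[of t] by (simp add: DERIV_deriv_iff_real_differentiable)
  have "frechet_derivative \<eta> (at t) 1 = deriv \<eta> t" for t
  proof -
    have "(*) (deriv \<eta> t) = frechet_derivative \<eta> (at t)"
      by (rule frechet_derivative_at) (use dd[of t] in \<open>simp add: has_field_derivative_def\<close>)
    from fun_cong[OF this, of 1] show ?thesis by simp
  qed
  then have cont: "continuous_on UNIV (deriv \<eta>)" using sm by simp
  have z: "\<eta> t = 0" if "t \<notin> {0<..<T}" for t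
  proof (rule ccontr)
    assume "\<eta> t \<noteq> 0"
    then have "t \<in> closure {t. \<eta> t \<noteq> 0}" by (intro subsetD[OF closure_subset]) simp
    with supp that show False by blast
  qed
  have db: "deriv \<eta> \<in> borel_measurable borel" by (rule borel_measurable_continuous_onI[OF cont])
  have "(LINT t:{0<..<T}|lebesgue. deriv \<eta> t) = (\<integral>t. indicator {0..T} t * deriv \<eta> t \<partial>lborel)"
    unfolding set_lebesgue_integral_def
  proof (rule integral_lebesgue_transfer)
    have "AE t in lborel. t \<noteq> 0" "AE t in lborel. t \<noteq> T" by (rule AE_lborel_singleton)+
    then show "AE t in lborel. indicator {0<..<T} t *\<^sub>R deriv \<eta> t = indicator {0..T} t * deriv \<eta> t"
      by eventually_elim (auto simp: indicator_def)
  qed (use db in measurable)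
  also have "\<dots> = \<eta> T - \<eta> 0"
  proof -
    have "(\<integral>t. deriv \<eta> t * indicator {0..T} t \<partial>lborel) = \<eta> T - \<eta> 0"
      by (rule integral_FTC_Icc_real) (use T dd cont in \<open>auto simp: continuous_on_eq_continuous_at\<close>)
    then show ?thesis by (simp only: mult.commute)
  qed
  finally show ?thesis by (simp add: z)
qed

text \<open>At almost every time the local Gagliardo energy of the slice is at most the
  \<open>p\<close>-th power of its norm in \<open>Wsp\<close>, which is integrable over
  \<open>[t0, t1]\<close>. The endpoints are discarded because \<open>U\<close> agrees with
  \<open>u\<close> only on the open interval.\<close>

lemma energy_finite_transfer:
  fixes u U :: "real ^ 'n \<Rightarrow> real \<Rightarrow> real"
  assumes u: "u \<in> Lp_loc_time p T A (Wsp s p A) (Wsp_norm s p A)"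
    and p: "0 < p" and t: "0 < t0" "t0 < t1" "t1 < T"
    and U: "AE t in lborel. t \<in> {t0<..<t1} \<longrightarrow> (AE x in lborel. U x t = u x t)"
  shows "(\<integral>\<^sup>+t. \<integral>\<^sup>+z. ennreal (indicator {t0..t1} t * (indicator (A \<times> A) z * (\<bar>U (fst z) t - U (snd z) t\<bar> powr p
          * fker s p (fst z - snd z)))) \<partial>lborel \<partial>lborel) < \<infinity>"
proof -
  define Nm where "Nm = (\<lambda>t. Wsp_norm s p A (\<lambda>x. u x t) powr p)"
  have W: "AE t in lebesgue. t \<in> {t0..t1} \<longrightarrow> (\<lambda>x. u x t) \<in> Wsp s p A"
    and Ni: "set_integrable lebesgue {t0..t1} Nm"
    using u t by (auto simp: Lp_loc_time_def Nm_def)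
  have W': "AE t in lborel. t \<in> {t0..t1} \<longrightarrow> (\<lambda>x. u x t) \<in> Wsp s p A"
    using W by (simp add: AE_completion_iff)
  have ends: "AE t in lborel. t \<noteq> t0" "AE t in lborel. t \<noteq> t1" by (rule AE_lborel_singleton)+
  have "(\<integral>\<^sup>+t. \<integral>\<^sup>+z. ennreal (indicator {t0..t1} t * (indicator (A \<times> A) z * (\<bar>U (fst z) t - U (snd z) t\<bar> powr p
          * fker s p (fst z - snd z)))) \<partial>lborel \<partial>lborel) \<le> (\<integral>\<^sup>+t. ennreal (norm (indicator {t0..t1} t *\<^sub>R Nm t)) \<partial>lborel)"
  proof (rule nn_integral_mono_AE)
    show "AE t in lborel. (\<integral>\<^sup>+z. ennreal (indicator {t0..t1} t * (indicator (A \<times> A) z * (\<bar>U (fst z) t - U (snd z) t\<bar> powr p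
          * fker s p (fst z - snd z)))) \<partial>lborel) \<le> ennreal (norm (indicator {t0..t1} t *\<^sub>R Nm t))"
      using W' U ends
    proof eventually_elim
      case (elim t)
      show ?case
      proof (cases "t \<in> {t0<..<t1}")
        case True
        then have tI: "t \<in> {t0..t1}" by auto
        define g where "g = (\<lambda>x. u x t)"
        have gW: "g \<in> Wsp s p A" using elim(1) tI by (simp add: g_def)
        then have gi: "set_integrable lebesgue (A \<times> A) (gagliardo s p g)" by (simp add: Wsp_def)
        have eqx: "AE x in lborel. U x t = g x" using elim(2) True by (simp add: g_def)
        have eq1: "AE z in (lborel :: 'n points measure). U (fst z) t = g (fst z)"
          by (rule AE_lborel_fst[OF eqx])
        have eq2: "AE z in (lborel :: 'n points measure). U (snd z) t = g (snd z)"
          by (rule AE_lborel_snd[OF eqx])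
        have "(\<integral>\<^sup>+z. ennreal (indicator (A \<times> A) z * (\<bar>U (fst z) t - U (snd z) t\<bar> powr p * fker s p (fst z - snd z))) \<partial>lborel)
          = (\<integral>\<^sup>+z. ennreal (indicator (A \<times> A) z *\<^sub>R gagliardo s p g z) \<partial>lborel)"
        proof (rule nn_integral_cong_AE)
          show "AE z in lborel. ennreal (indicator (A \<times> A) z * (\<bar>U (fst z) t - U (snd z) t\<bar> powr p * fker s p (fst z - snd z)))
            = ennreal (indicator (A \<times> A) z *\<^sub>R gagliardo s p g z)"
            using eq1 eq2 by eventually_elim (simp add: gagliardo_fker)
        qed
        also have "\<dots> = (\<integral>\<^sup>+z. ennreal (indicator (A \<times> A) z *\<^sub>R gagliardo s p g z) \<partial>lebesgue)"
          by (rule nn_integral_completion[symmetric])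
        also have "\<dots> = ennreal (LINT z:A \<times> A|lebesgue. gagliardo s p g z)"
          unfolding set_lebesgue_integral_def
          by (rule nn_integral_eq_integral) (use gi in \<open>auto simp: set_integrable_def gagliardo_fker indicator_def\<close>)
        also have "\<dots> \<le> ennreal (Nm t)"
        proof (rule ennreal_leI)
          define G where "G = (LINT z:A \<times> A|lebesgue. gagliardo s p g z)"
          have G: "0 \<le> G" unfolding G_def set_lebesgue_integral_def
            by (intro integral_nonneg_AE) (auto simp: gagliardo_fker)
          have "Nm t = ((Lp_norm p A g powr p + G) powr (1 / p)) powr p"
            by (simp add: Nm_def Wsp_norm_def G_def g_def)
          also have "\<dots> = Lp_norm p A g powr p + G" using G p by (simp add: powr_powr)
          finally show "(LINT z:A \<times> A|lebesgue. gagliardo s p g z) \<le> Nm t" by (simp add: G_def)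
        qed
        finally show ?thesis using tI by (simp add: Nm_def)
      next
        case False
        then have "t \<notin> {t0..t1}" using elim by auto
        then show ?thesis by simp
      qed
    qed
  qed
  also have "\<dots> = (\<integral>\<^sup>+t. ennreal (norm (indicator {t0..t1} t *\<^sub>R Nm t)) \<partial>lebesgue)"
    by (rule nn_integral_completion[symmetric])
  also have "\<dots> < \<infinity>" using Ni by (simp add: set_integrable_def integrable_iff_bounded)
  finally show ?thesis .
qed

lemma set_borel_measurable_lebesgueI:
  fixes f :: "'a::euclidean_space \<Rightarrow> real"
  assumes "f \<in> borel_measurable borel" "S \<in> sets borel"
  shows "set_borel_measurable lebesgue S f"
proof -
  have "(\<lambda>x. indicator S x *\<^sub>R f x) \<in> borel_measurable lborel" using assms by measurable
  then show ?thesis unfolding set_borel_measurable_def by (rule measurable_completion)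
qed

lemma set_integrable_lebesgueI:
  fixes f :: "'a::euclidean_space \<Rightarrow> real"
  assumes "f \<in> borel_measurable borel" "S \<in> sets borel" "integrable lborel (\<lambda>x. indicator S x *\<^sub>R f x)"
  shows "set_integrable lebesgue S f"
  unfolding set_integrable_def using assms by (subst integrable_completion) auto

lemma integrable_bounded_support:
  fixes f :: "'a::euclidean_space \<Rightarrow> real"
  assumes [measurable]: "f \<in> borel_measurable borel" and b: "\<And>x. \<bar>f x\<bar> \<le> c" and z: "\<And>x. x \<notin> ball x0 R \<Longrightarrow> f x = 0"
  shows "integrable lborel f"
proof (rule Bochner_Integration.integrable_bound)
  have "integrable lborel (indicator (ball x0 R) :: 'a \<Rightarrow> real)"
    by (rule integrable_real_indicator) (use emeasure_bounded_finite[of "ball x0 R"] in auto)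
  then show "integrable lborel (\<lambda>x. c * indicator (ball x0 R) x)" by simp
  show "AE x in lborel. norm (f x) \<le> norm (c * indicator (ball x0 R) x)"
  proof (intro AE_I2)
    fix x show "norm (f x) \<le> norm (c * indicator (ball x0 R) x)"
      using b[of x] z[of x] by (cases "x \<in> ball x0 R") auto
  qed
qed simp

text \<open>All slices coincide, so the requirements reduce to those on the single function
  \<open>\<psi>\<close>, together with the zero derivative from
  \<open>integral_deriv_time_cutoff\<close>.\<close>

lemma time_constant_test:
  fixes \<psi> :: "real ^ 'n \<Rightarrow> real"
  assumes adm: "admissible_test s p r x0 \<psi>" and supp: "\<And>x. x \<notin> ball x0 R \<Longrightarrow> \<psi> x = 0"
    and p: "0 < p" and T: "0 < T"
  shows "W1p_loc_time_Lp p T (ball x0 R) (\<lambda>x t. \<psi> x) (\<lambda>x t. 0)"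
    "(\<lambda>x t. \<psi> x) \<in> Lp_loc_time p T UNIV (Wsp0 s p (ball x0 R)) (Wsp_norm s p UNIV)"
proof -
  have b: "\<psi> \<in> borel_measurable borel" and fin: "(\<integral>\<^sup>+z. \<bar>\<psi> (fst z) - \<psi> (snd z)\<bar> powr p * fker s p (fst z - snd z) \<partial>lborel) < \<infinity>"
    using adm by (auto simp: admissible_test_def)
  obtain c where c: "\<And>x. 0 \<le> \<psi> x" "\<And>x. \<psi> x \<le> c" using adm by (auto simp: admissible_test_def)
  have bp: "(\<lambda>x. \<bar>\<psi> x\<bar> powr p) \<in> borel_measurable borel" using b by measurable
  have ip: "integrable lborel (\<lambda>x. \<bar>\<psi> x\<bar> powr p)"
    by (rule integrable_bounded_support[where c = "c powr p" and R = R and ?x0.0 = x0])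
       (use bp c supp p in \<open>auto intro!: powr_mono2\<close>)
  have pt: "(\<lambda>z. \<psi> (fst z)) \<in> borel_measurable (borel :: ((real ^ 'n) \<times> real) measure)"
    by (rule measurable_compose[OF borel_measurable_fst_snd(1) b])
  have Lp1: "\<psi> \<in> Lp p (ball x0 R)"
    unfolding Lp_def using b bp ip
    by (auto intro!: set_borel_measurable_lebesgueI set_integrable_lebesgueI integrable_mult_indicator[of "ball x0 R"])
  have Lp0: "(\<lambda>x. 0) \<in> Lp p (ball x0 R)"
    using p by (auto simp: Lp_def set_integrable_def intro!: set_borel_measurable_lebesgueI)
  have LpU: "\<psi> \<in> Lp p UNIV"
    unfolding Lp_def using b bp ip by (auto intro!: set_borel_measurable_lebesgueI set_integrable_lebesgueI)
  have gb: "gagliardo s p \<psi> \<in> borel_measurable borel"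
  proof -
    have [measurable]: "(\<lambda>z. \<psi> (fst z)) \<in> borel_measurable (borel :: 'n points measure)"
      "(\<lambda>z. \<psi> (snd z)) \<in> borel_measurable (borel :: 'n points measure)"
      using measurable_compose[OF borel_measurable_fst_snd(1) b] measurable_compose[OF borel_measurable_fst_snd(2) b] by auto
    have "(\<lambda>z. \<bar>\<psi> (fst z) - \<psi> (snd z)\<bar> powr p * fker s p (fst z - snd z)) \<in> borel_measurable (borel :: 'n points measure)"
      by measurable
    then show ?thesis by (simp add: gagliardo_fker[abs_def])
  qed
  have "integrable lborel (gagliardo s p \<psi>)"
    by (rule integrableI_nonneg) (use gb fin in \<open>auto simp: gagliardo_fker\<close>)
  then have W: "\<psi> \<in> Wsp s p UNIV"
    using LpU gb by (auto simp: Wsp_def UNIV_Times_UNIV intro!: set_integrable_lebesgueI)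
  have W0: "\<psi> \<in> Wsp0 s p (ball x0 R)"
    using W supp by (auto simp: Wsp0_def)
  have ci: "set_integrable lebesgue {a..b} (\<lambda>t. y)" for a b y :: real
    by (rule set_integrable_lebesgueI) auto
  have sets1: "ball x0 R \<times> {0<..<T} \<in> sets borel" "UNIV \<times> {0<..<T} \<in> sets (borel :: ((real ^ 'n) \<times> real) measure)"
    by (auto simp: borel_prod[symmetric])
  have L1: "(\<lambda>x t. \<psi> x) \<in> Lp_loc_time p T (ball x0 R) (Lp p (ball x0 R)) (Lp_norm p (ball x0 R))"
    using Lp1 ci pt sets1 by (auto simp: Lp_loc_time_def split_beta' intro!: set_borel_measurable_lebesgueI)
  have L2: "(\<lambda>x t. 0) \<in> Lp_loc_time p T (ball x0 R) (Lp p (ball x0 R)) (Lp_norm p (ball x0 R))"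
    using Lp0 ci sets1 by (auto simp: Lp_loc_time_def split_beta' intro!: set_borel_measurable_lebesgueI)
  have L3: "(\<lambda>x t. \<psi> x) \<in> C_loc_time_Lp p T (ball x0 R)"
    using Lp1 by (auto simp: C_loc_time_Lp_def Lp_norm_def)
  have L4: "has_weak_time_derivative T (ball x0 R) (\<lambda>x t. \<psi> x) (\<lambda>x t. 0)"
    using integral_deriv_time_cutoff[OF _ T] by (auto simp: has_weak_time_derivative_def)
  show "W1p_loc_time_Lp p T (ball x0 R) (\<lambda>x t. \<psi> x) (\<lambda>x t. 0)"
    using L1 L2 L3 L4 by (simp add: W1p_loc_time_Lp_def)
  show "(\<lambda>x t. \<psi> x) \<in> Lp_loc_time p T UNIV (Wsp0 s p (ball x0 R)) (Wsp_norm s p UNIV)"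
    using W0 ci pt sets1 by (auto simp: Lp_loc_time_def split_beta' intro!: set_borel_measurable_lebesgueI)
qed

text \<open>Justifies Fubini for the tested flux, which the weak form gives as one integral over the
  product and the locale states as an iterated one. It stands outside the locale because it serves
  to establish the locale assumption; the bound is again \<open>flux_bound\<close>.\<close>

lemma integrable_tested_flux:
  fixes U :: "real ^ 'n \<Rightarrow> real \<Rightarrow> real" and k :: "real ^ 'n \<Rightarrow> real ^ 'n \<Rightarrow> real \<Rightarrow> real"
  assumes p: "1 \<le> p" and s: "0 < s" "s < 1" and Lam: "1 \<le> \<Lambda>" and rho: "0 < \<rho>"
    and U_borel: "(\<lambda>z. U (fst z) (snd z)) \<in> borel_measurable borel"
    and U_ge: "\<And>x t. \<rho> \<le> U x t" and U_le: "\<And>x t. U x t \<le> M"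
    and k_borel: "(\<lambda>z. k (fst z) (fst (snd z)) (snd (snd z))) \<in> borel_measurable borel"
    and k_bd: "\<And>x y t. 0 \<le> k x y t" "\<And>x y t. k x y t \<le> \<Lambda> * fker s p (x - y)"
    and energy: "\<And>R. R < r \<Longrightarrow> (\<integral>\<^sup>+t. \<integral>\<^sup>+z. ennreal (indicator {t0..t1} t *
        (indicator (ball x0 R \<times> ball x0 R) z * (\<bar>U (fst z) t - U (snd z) t\<bar> powr p
          * fker s p (fst z - snd z)))) \<partial>lborel \<partial>lborel) < \<infinity>"
    and adm: "admissible_test s p r x0 \<psi>" and bb: "t0 \<le> b" "b' \<le> t1"
  defines "F \<equiv> (\<lambda>w. indicator {b..b'} (snd w) * (cdn p (U (fst (fst w)) (snd w) - U (snd (fst w)) (snd w))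
      * k (fst (fst w)) (snd (fst w)) (snd w) * (\<psi> (fst (fst w)) - \<psi> (snd (fst w)))))"
  shows "F \<in> borel_measurable borel" "integrable lborel F"
proof -
  have psi_b: "\<psi> \<in> borel_measurable borel" and fin: "(\<integral>\<^sup>+z. \<bar>\<psi> (fst z) - \<psi> (snd z)\<bar> powr p * fker s p (fst z - snd z) \<partial>lborel) < \<infinity>"
    using adm by (auto simp: admissible_test_def)
  obtain c where c: "\<And>x. 0 \<le> \<psi> x" "\<And>x. \<psi> x \<le> c" using adm by (auto simp: admissible_test_def)
  obtain R where R: "R < r" "\<And>x. x \<notin> ball x0 R \<Longrightarrow> \<psi> x = 0" using adm by (auto simp: admissible_test_def)
  define d where "d = (r - R) / 2"
  have d: "0 < d" "R + d < r" using R by (auto simp: d_def field_simps)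
  have Um[measurable (raw)]: "(\<lambda>w. U (f w) (g w)) \<in> borel_measurable N"
    if "f \<in> borel_measurable N" "g \<in> borel_measurable N" for f g and N :: "'z measure"
    using measurable_compose[OF borel_measurable_Pair[OF that] U_borel] by simp
  have [measurable]: "cdn p \<in> borel_measurable borel" unfolding cdn_def by measurable
  have ff: "(\<lambda>w. fst (fst w)) \<in> borel_measurable (borel :: ('n points \<times> real) measure)"
    and sf: "(\<lambda>w. snd (fst w)) \<in> borel_measurable (borel :: ('n points \<times> real) measure)"
    by (rule measurable_compose[OF borel_measurable_fst_snd(1) borel_measurable_fst_snd(1)],
        rule measurable_compose[OF borel_measurable_fst_snd(1) borel_measurable_fst_snd(2)])
  note [measurable] = ff sf psi_b measurable_compose[OF ff psi_b] measurable_compose[OF sf psi_b]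
    measurable_compose[OF borel_measurable_Pair[OF ff borel_measurable_Pair[OF sf borel_measurable_fst_snd(2)]] k_borel, simplified]
    Um[OF ff borel_measurable_fst_snd(2)] Um[OF sf borel_measurable_fst_snd(2)]
  show F: "F \<in> borel_measurable borel" unfolding F_def by measurable
  define C where "C = M powr (p - 1) * c"
  have c0: "0 \<le> c" using c[of x0] by linarith
  have C: "0 \<le> C" using c0 by (simp add: C_def)
  define B where "B = ball x0 (R + d)"
  have [measurable]: "B \<in> sets borel" by (simp add: B_def)
  define e1 where "e1 z t = indicator (B \<times> B) z * (\<bar>U (fst z) t - U (snd z) t\<bar> powr p * fker s p (fst z - snd z))" for z t
  define e2 where "e2 z = \<bar>\<psi> (fst z) - \<psi> (snd z)\<bar> powr p * fker s p (fst z - snd z)" for z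
  define e3 where "e3 = tailker s p d B"
  have nn: "0 \<le> e1 z t" "0 \<le> e2 z" "0 \<le> e3 z" for z t by (auto simp: e1_def e2_def e3_def)
  have bound: "\<bar>F (z, t)\<bar> \<le> \<Lambda> * (indicator {t0..t1} t * e1 z t + indicator {b..b'} t * (e2 z + C * e3 z))" for z t
  proof (cases "t \<in> {b..b'}")
    case True
    obtain x y where z: "z = (x, y)" by fastforce
    have ud: "\<bar>U x t - U y t\<bar> \<le> M" using U_ge[of x t] U_ge[of y t] U_le[of x t] U_le[of y t] rho by linarith
    have "\<bar>F (z, t)\<bar> = \<bar>U x t - U y t\<bar> powr (p - 1) * k x y t * \<bar>\<psi> x - \<psi> y\<bar>"
      using True k_bd(1)[of x y t] by (simp add: F_def z abs_mult abs_cdn)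
    also have "\<dots> \<le> \<bar>U x t - U y t\<bar> powr (p - 1) * (\<Lambda> * fker s p (x - y)) * \<bar>\<psi> x - \<psi> y\<bar>"
      by (intro mult_right_mono mult_left_mono k_bd) auto
    also have "\<dots> = \<Lambda> * (\<bar>U x t - U y t\<bar> powr (p - 1) * \<bar>\<psi> x - \<psi> y\<bar> * fker s p (x - y))" by simp
    also have "\<dots> \<le> \<Lambda> * (e1 z t + e2 z + C * e3 z)"
      using flux_bound[where p=p and d=d and R=R and R'="R + d" and \<psi>=\<psi> and b=c and ?x0.0=x0 and c="U x t - U y t" and M=M and s=s and x=x and y=y]
        p d c R(2) ud Lam
      by (intro mult_left_mono) (auto simp: e1_def e2_def e3_def C_def z B_def mult.assoc)
    finally show ?thesis using True bb by (simp add: add.assoc)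
  next
    case False
    then show ?thesis using nn C Lam by (simp add: F_def)
  qed
  have m1: "(\<lambda>w. ennreal (indicator {t0..t1} (snd w) * e1 (fst w) (snd w))) \<in> borel_measurable (borel :: ('n points \<times> real) measure)"
  proof -
    have eq: "(\<lambda>w :: 'n points \<times> real. indicator (B \<times> B) (fst w) :: real)
        = (\<lambda>w. indicator B (fst (fst w)) * indicator B (snd (fst w)))"
      by (auto simp: indicator_def mem_Times_iff fun_eq_iff)
    have [measurable]: "(\<lambda>w. indicator (B \<times> B) (fst w) :: real) \<in> borel_measurable (borel :: ('n points \<times> real) measure)"
      unfolding eq by measurable
    show ?thesis unfolding e1_def by measurable
  qed
  have m2[measurable]: "e2 \<in> borel_measurable borel"
  proof -
    have [measurable]: "(\<lambda>z. \<psi> (fst z)) \<in> borel_measurable (borel :: 'n points measure)"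
      "(\<lambda>z. \<psi> (snd z)) \<in> borel_measurable (borel :: 'n points measure)"
      using measurable_compose[OF borel_measurable_fst_snd(1) psi_b] measurable_compose[OF borel_measurable_fst_snd(2) psi_b] by auto
    show ?thesis unfolding e2_def[abs_def] by measurable
  qed
  have m3[measurable]: "e3 \<in> borel_measurable borel" unfolding e3_def by measurable
  have m23: "(\<lambda>w. ennreal (indicator {b..b'} (snd w) * (e2 (fst w) + C * e3 (fst w)))) \<in> borel_measurable (borel :: ('n points \<times> real) measure)"
    by measurable
  have I1: "(\<integral>\<^sup>+w. ennreal (indicator {t0..t1} (snd w) * e1 (fst w) (snd w)) \<partial>lborel) < \<infinity>"
    using energy[OF d(2)] by (subst nn_integral_lborel_pair(2)[OF m1]) (simp add: e1_def B_def)
  have I2: "(\<integral>\<^sup>+w. ennreal (indicator {b..b'} (snd w) * (e2 (fst w) + C * e3 (fst w))) \<partial>lborel) < \<infinity>"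
  proof -
    have "(\<integral>\<^sup>+z. ennreal (e2 z + C * e3 z) \<partial>lborel) = (\<integral>\<^sup>+z. e2 z \<partial>lborel) + ennreal C * (\<integral>\<^sup>+z. e3 z \<partial>lborel)"
      using nn C by (simp add: ennreal_plus ennreal_mult' nn_integral_add nn_integral_cmult)
    also have "\<dots> < \<infinity>"
      using fin nn_integral_tailker_finite[OF s, of p d x0 "R + d"] p d
      by (simp add: e2_def e3_def B_def ennreal_mult_less_top)
    finally have fin23: "(\<integral>\<^sup>+z. ennreal (e2 z + C * e3 z) \<partial>lborel) < \<infinity>" .
    have "(\<integral>\<^sup>+w. ennreal (indicator {b..b'} (snd w) * (e2 (fst w) + C * e3 (fst w))) \<partial>lborel)
      = (\<integral>\<^sup>+t. (\<integral>\<^sup>+z. ennreal (e2 z + C * e3 z) \<partial>lborel) * indicator {b..b'} t \<partial>lborel)"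
      by (subst nn_integral_lborel_pair(2)[OF m23]) (auto intro!: nn_integral_cong simp: indicator_def)
    also have "\<dots> = (\<integral>\<^sup>+z. ennreal (e2 z + C * e3 z) \<partial>lborel) * emeasure lborel {b..b'}"
      by (rule nn_integral_cmult_indicator) auto
    also have "\<dots> < \<infinity>" using fin23 by (simp add: ennreal_mult_less_top emeasure_lborel_Icc_eq)
    finally show ?thesis .
  qed
  show "integrable lborel F"
  proof (rule integrableI_bounded)
    have "(\<integral>\<^sup>+w. ennreal (norm (F w)) \<partial>lborel) \<le> (\<integral>\<^sup>+w. ennreal \<Lambda> * (ennreal (indicator {t0..t1} (snd w) * e1 (fst w) (snd w))
        + ennreal (indicator {b..b'} (snd w) * (e2 (fst w) + C * e3 (fst w)))) \<partial>lborel)"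
    proof (rule nn_integral_mono)
      fix w :: "'n points \<times> real"
      have "ennreal (norm (F w)) \<le> ennreal (\<Lambda> * (indicator {t0..t1} (snd w) * e1 (fst w) (snd w) + indicator {b..b'} (snd w) * (e2 (fst w) + C * e3 (fst w))))"
        using bound[of "fst w" "snd w"] by (intro ennreal_leI) simp
      then show "ennreal (norm (F w)) \<le> ennreal \<Lambda> * (ennreal (indicator {t0..t1} (snd w) * e1 (fst w) (snd w))
        + ennreal (indicator {b..b'} (snd w) * (e2 (fst w) + C * e3 (fst w))))"
        using Lam nn C by (simp add: ennreal_mult' ennreal_plus)
    qed
    also have "\<dots> = ennreal \<Lambda> * ((\<integral>\<^sup>+w. ennreal (indicator {t0..t1} (snd w) * e1 (fst w) (snd w)) \<partial>lborel)
        + (\<integral>\<^sup>+w. ennreal (indicator {b..b'} (snd w) * (e2 (fst w) + C * e3 (fst w))) \<partial>lborel))"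
      using m1 m23 by (simp add: nn_integral_cmult nn_integral_add)
    also have "\<dots> < \<infinity>" using I1 I2 by (simp add: ennreal_mult_less_top)
    finally show "(\<integral>\<^sup>+w. ennreal (norm (F w)) \<partial>lborel) < \<infinity>" .
  qed (use F in simp)
qed

context nonlocal_supersolution
begin

text \<open>Tonelli turns the averages of the statement, taken with the completed measure, into the
  iterated form of \<open>slab\<close>.\<close>

lemma integral_average_eq_avg:
  assumes u: "AE z in lborel. snd z \<in> {t0<..<t1} \<longrightarrow> U (fst z) (snd z) = u (fst z) (snd z)"
    and R: "0 < R" "t0 + R powr (s * p) \<le> t1" and \<alpha>: "0 < \<alpha>"
  shows "integral_average (Uplus s p x0 t0 R) (\<lambda>(x, t). u x t powr \<alpha>) = avg R \<alpha>"
proof -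
  define S where "S = Uplus s p x0 t0 R"
  have S_eq: "S = ball x0 R \<times> {t0<..<t0 + R powr (s * p)}" by (simp add: S_def Uplus_def)
  have S[measurable]: "S \<in> sets borel" unfolding S_eq by (simp add: borel_prod[symmetric])
  have Um[measurable]: "(\<lambda>z. U (fst z) (snd z) powr \<alpha>) \<in> borel_measurable borel"
    using U_borel by measurable
  have pair: "(\<integral>\<^sup>+z. ennreal (indicator S z * h z) \<partial>lborel)
     = (\<integral>\<^sup>+t. indicator {t0<..<t0 + R powr (s * p)} t * (\<integral>\<^sup>+x. ennreal (indicator (ball x0 R) x * h (x, t)) \<partial>lborel) \<partial>lborel)"
    if [measurable]: "h \<in> borel_measurable borel" for h :: "(real ^ 'n) \<times> real \<Rightarrow> real"
  proof -
    have m: "(\<lambda>z. ennreal (indicator S z * h z)) \<in> borel_measurable borel" by measurable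
    show ?thesis
      unfolding nn_integral_lborel_pair(2)[OF m]
      by (intro nn_integral_cong) (auto simp: S_eq indicator_def intro!: nn_integral_cong)
  qed
  have "emeasure lborel S = (\<integral>\<^sup>+z. ennreal (indicator S z * 1) \<partial>lborel)"
    by (simp add: ennreal_indicator)
  also have "\<dots> = ennreal (1 * vol R)"
    using slab_const[OF R(1), of 1] by (subst pair) simp_all
  finally have "emeasure lborel S = ennreal (vol R)" by simp
  then have meas: "measure lebesgue S = vol R"
    using vol_pos[OF R(1)] by (simp add: measure_def)
  have "(LINT z:S|lebesgue. (case z of (x, t) \<Rightarrow> u x t powr \<alpha>)) = (\<integral>z. indicator S z * U (fst z) (snd z) powr \<alpha> \<partial>lborel)"
    unfolding set_lebesgue_integral_def
  proof (rule integral_lebesgue_transfer)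
    show "AE z in lborel. indicator S z *\<^sub>R (case z of (x, t) \<Rightarrow> u x t powr \<alpha>) = indicator S z * U (fst z) (snd z) powr \<alpha>"
      using u by eventually_elim (use R in \<open>auto simp: S_eq indicator_def split_beta\<close>)
  qed measurable
  also have "\<dots> = enn2real (\<integral>\<^sup>+z. ennreal (indicator S z * U (fst z) (snd z) powr \<alpha>) \<partial>lborel)"
    by (rule integral_eq_nn_integral) auto
  also have "\<dots> = enn2real (slab R \<alpha>)"
    by (subst pair) (auto simp: slab_def)
  finally show ?thesis by (simp add: integral_average_def avg_def meas flip: S_def)
qed

end

text \<open>A Borel representative is clamped to \<open>[\<rho>, M]\<close> on the time window,
  where this changes nothing almost everywhere, and set to \<open>\<rho>\<close> at all other times.
  \<open>M\<close> is at least \<open>\<rho>\<close> by construction, so both bounds hold at every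
  point.\<close>

lemma borel_truncation:
  fixes u :: "real ^ 'n \<Rightarrow> real \<Rightarrow> real"
  assumes m: "set_borel_measurable lebesgue (UNIV \<times> {0<..<T}) (\<lambda>(x, t). u x t)"
    and ub: "AE (x, t) in lebesgue. t \<in> {0<..<T} \<longrightarrow> \<bar>u x t\<bar> \<le> M0"
    and lb: "AE (x, t) in lebesgue. t \<in> {t0<..<t1} \<longrightarrow> \<rho> \<le> u x t"
    and t: "0 < t0" "t1 < T"
  obtains U M where "(\<lambda>z. U (fst z) (snd z)) \<in> borel_measurable borel"
    "\<And>x t. \<rho> \<le> U x t" "\<And>x t. U x t \<le> M"
    "AE z in lborel. snd z \<in> {t0<..<t1} \<longrightarrow> U (fst z) (snd z) = u (fst z) (snd z)"
proof -
  obtain g where g: "g \<in> borel_measurable borel" "AE z in lborel. z \<in> UNIV \<times> {0<..<T} \<longrightarrow> (case z of (x, t) \<Rightarrow> u x t) = g z"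
    by (rule borel_version[OF m])
  define M where "M = max \<rho> M0"
  define U where "U = (\<lambda>x t. if t0 < t \<and> t < t1 then max \<rho> (min M (g (x, t))) else \<rho>)"
  have ub': "AE z in lborel. (case z of (x, t) \<Rightarrow> t \<in> {0<..<T} \<longrightarrow> \<bar>u x t\<bar> \<le> M0)"
    and lb': "AE z in lborel. (case z of (x, t) \<Rightarrow> t \<in> {t0<..<t1} \<longrightarrow> \<rho> \<le> u x t)"
    using ub lb by (simp_all only: AE_completion_iff)
  show thesis
  proof (rule that[of U M])
    have [measurable]: "g \<in> borel_measurable borel" by (rule g)
    show "(\<lambda>z. U (fst z) (snd z)) \<in> borel_measurable borel" unfolding U_def prod.collapse by measurable
    show "\<rho> \<le> U x t" "U x t \<le> M" for x t by (auto simp: U_def M_def)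
    show "AE z in lborel. snd z \<in> {t0<..<t1} \<longrightarrow> U (fst z) (snd z) = u (fst z) (snd z)"
      using g(2) ub' lb'
    proof eventually_elim
      case (elim z)
      then show ?case using t by (cases z) (auto simp: U_def M_def)
    qed
  qed
qed

text \<open>A Borel representative is clamped between the two kernel bounds. On the diagonal both
  bounds are 0, so agreement with \<open>K\<close> is claimed only off it; the flux vanishes there
  in any case.\<close>

lemma borel_kernel:
  fixes K :: "real ^ 'n \<Rightarrow> real ^ 'n \<Rightarrow> real \<Rightarrow> real"
  assumes K: "admissible_kernel s p \<Lambda> T K" and Lam: "1 \<le> \<Lambda>"
  obtains k where "(\<lambda>z. k (fst z) (fst (snd z)) (snd (snd z))) \<in> borel_measurable borel"
    "\<And>x y t. fker s p (x - y) / \<Lambda> \<le> k x y t" "\<And>x y t. k x y t \<le> \<Lambda> * fker s p (x - y)"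
    "AE w in lborel. snd (snd w) \<in> {0<..<T} \<and> fst w \<noteq> fst (snd w) \<longrightarrow>
       k (fst w) (fst (snd w)) (snd (snd w)) = K (fst w) (fst (snd w)) (snd (snd w))"
proof -
  have "set_borel_measurable lebesgue (UNIV \<times> UNIV \<times> {0<..<T}) (\<lambda>(x, y, t). K x y t)"
    using K by (simp add: admissible_kernel_def)
  then obtain g where g: "g \<in> borel_measurable borel"
     "AE w in lborel. w \<in> UNIV \<times> UNIV \<times> {0<..<T} \<longrightarrow> (case w of (x, y, t) \<Rightarrow> K x y t) = g w"
    by (rule borel_version)
  define k where "k = (\<lambda>x y t. max (fker s p (x - y) / \<Lambda>) (min (\<Lambda> * fker s p (x - y)) (g (x, y, t))))"
  have ord: "w / \<Lambda> \<le> \<Lambda> * w" if "0 \<le> w" for w :: real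
  proof -
    have "w / \<Lambda> \<le> w / 1" by (rule divide_left_mono) (use that Lam in auto)
    also have "\<dots> \<le> \<Lambda> * w" using that Lam mult_right_mono[of 1 \<Lambda> w] by simp
    finally show ?thesis .
  qed
  show thesis
  proof (rule that[of k])
    have [measurable]: "g \<in> borel_measurable borel" by (rule g)
    have [measurable]: "(\<lambda>z. fst (snd z)) \<in> borel_measurable (borel :: ((real ^ 'n) \<times> (real ^ 'n) \<times> real) measure)"
      by (rule measurable_compose[OF borel_measurable_fst_snd(2) borel_measurable_fst_snd(1)])
    show "(\<lambda>z. k (fst z) (fst (snd z)) (snd (snd z))) \<in> borel_measurable borel"
      unfolding k_def prod.collapse by measurable
    show "fker s p (x - y) / \<Lambda> \<le> k x y t" "k x y t \<le> \<Lambda> * fker s p (x - y)" for x y t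
      using ord[of "fker s p (x - y)"] by (auto simp: k_def)
    show "AE w in lborel. snd (snd w) \<in> {0<..<T} \<and> fst w \<noteq> fst (snd w) \<longrightarrow>
       k (fst w) (fst (snd w)) (snd (snd w)) = K (fst w) (fst (snd w)) (snd (snd w))"
      using g(2)
    proof eventually_elim
      case (elim w)
      obtain x y t where w: "w = (x, y, t)" by (cases w) auto
      show ?case
      proof
        assume "snd (snd w) \<in> {0<..<T} \<and> fst w \<noteq> fst (snd w)"
        then have t: "t \<in> {0<..<T}" and xy: "x \<noteq> y" by (auto simp: w)
        have "fker s p (x - y) / \<Lambda> \<le> K x y t \<and> K x y t \<le> \<Lambda> * fker s p (x - y)"
          using K t xy by (auto simp: admissible_kernel_def fker_def inverse_eq_divide mult.commute[of \<Lambda>])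
        moreover have "K x y t = g w" using elim t by (simp add: w)
        ultimately show "k (fst w) (fst (snd w)) (snd (snd w)) = K (fst w) (fst (snd w)) (snd (snd w))"
          by (simp add: k_def w)
      qed
    qed
  qed
qed

text \<open>The weak form involves \<open>u\<close> at single times, where the representative
  \<open>U\<close> may be unrelated to \<open>u\<close>. Hence the exceptional times
  \<open>N\<close>: outside of them the slices agree almost everywhere, and the inequality for
  \<open>u\<close> becomes one for \<open>U\<close>. A test function supported in
  \<open>ball x0 R\<close> with \<open>R < r\<close> is allowed because this ball is compactly
  inside the domain.\<close>

lemma nonlocal_supersolution_of_weak:
  fixes u :: "real ^ 'n \<Rightarrow> real \<Rightarrow> real"
  assumes p: "2 < p" and s: "0 < s" "s < 1" and Lam: "1 \<le> \<Lambda>" and rho: "0 < \<rho>"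
    and K: "admissible_kernel s p \<Lambda> T K" and u: "weak_supersolution s p T \<Omega> K u"
    and ball: "ball x0 r \<subseteq> \<Omega>" and t: "0 < t0" "t0 < t1" "t1 < T"
    and lb: "AE (x, t) in lebesgue. t \<in> {t0<..<t1} \<longrightarrow> \<rho> \<le> u x t"
  obtains U M k where "nonlocal_supersolution s p \<Lambda> \<rho> M t0 t1 r x0 U k"
    "AE z in lborel. snd z \<in> {t0<..<t1} \<longrightarrow> U (fst z) (snd z) = u (fst z) (snd z)"
proof -
  have m: "set_borel_measurable lebesgue (UNIV \<times> {0<..<T}) (\<lambda>(x, t). u x t)"
    and Mex: "\<exists>M. AE (x, t) in lebesgue. t \<in> {0<..<T} \<longrightarrow> \<bar>u x t\<bar> \<le> M"
    and reg: "\<And>A. compactly_inside A \<Omega> \<Longrightarrow> u \<in> Lp_loc_time p T A (Wsp s p A) (Wsp_norm s p A)"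
    and weak: "\<And>A t1 t2 \<phi> \<psi>. compactly_inside A \<Omega> \<Longrightarrow> 0 < t1 \<Longrightarrow> t1 < t2 \<Longrightarrow> t2 < T \<Longrightarrow> W1p_loc_time_Lp p T A \<phi> \<psi> \<Longrightarrow>
        \<phi> \<in> Lp_loc_time p T UNIV (Wsp0 s p A) (Wsp_norm s p UNIV) \<Longrightarrow>
        (AE (x, t) in lebesgue. t \<in> {0<..<T} \<longrightarrow> 0 \<le> \<phi> x t) \<Longrightarrow> 0 \<le> weak_form p K A t1 t2 u \<phi> \<psi>"
    using u unfolding weak_supersolution_def by (simp_all only: simp_thms)
  obtain M0 where M0: "AE (x, t) in lebesgue. t \<in> {0<..<T} \<longrightarrow> \<bar>u x t\<bar> \<le> M0" using Mex by (rule exE)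
  obtain U M where U: "(\<lambda>z. U (fst z) (snd z)) \<in> borel_measurable borel"
    "\<And>x t. \<rho> \<le> U x t" "\<And>x t. U x t \<le> M"
    "AE z in lborel. snd z \<in> {t0<..<t1} \<longrightarrow> U (fst z) (snd z) = u (fst z) (snd z)"
    by (rule borel_truncation[OF m M0 lb t(1,3)]) (rule that, assumption+)
  obtain k where k: "(\<lambda>z. k (fst z) (fst (snd z)) (snd (snd z))) \<in> borel_measurable borel"
    "\<And>x y t. fker s p (x - y) / \<Lambda> \<le> k x y t" "\<And>x y t. k x y t \<le> \<Lambda> * fker s p (x - y)"
    "AE w in lborel. snd (snd w) \<in> {0<..<T} \<and> fst w \<noteq> fst (snd w) \<longrightarrow>
       k (fst w) (fst (snd w)) (snd (snd w)) = K (fst w) (fst (snd w)) (snd (snd w))"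
    by (rule borel_kernel[OF K Lam]) (rule that, assumption+)
  have k0: "0 \<le> k x y t" for x y t
  proof -
    have "0 \<le> fker s p (x - y) / \<Lambda>" using Lam by simp
    also have "\<dots> \<le> k x y t" by (rule k(2))
    finally show ?thesis .
  qed
  have inside: "compactly_inside (ball x0 R) \<Omega>" if "R < r" for R
  proof -
    have "closure (ball x0 R) \<subseteq> cball x0 R" by (rule closure_minimal) auto
    also have "\<dots> \<subseteq> ball x0 r" using that by auto
    finally show ?thesis using ball by (auto simp: compactly_inside_def)
  qed
  have slices: "AE t in lborel. t \<in> {t0<..<t1} \<longrightarrow> (AE x in lborel. U x t = u x t)"
    using AE_lborel_sections(2)[OF U(4)] by eventually_elim auto
  have energy: "(\<integral>\<^sup>+t. \<integral>\<^sup>+z. ennreal (indicator {t0..t1} t *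
        (indicator (ball x0 R \<times> ball x0 R) z * (\<bar>U (fst z) t - U (snd z) t\<bar> powr p
          * fker s p (fst z - snd z)))) \<partial>lborel \<partial>lborel) < \<infinity>" if "R < r" for R
    by (rule energy_finite_transfer[OF reg[OF inside[OF that]] _ t slices]) (use p in simp)
  obtain N where N: "N \<in> null_sets lborel" "\<forall>t. t \<notin> N \<longrightarrow> t \<in> {t0<..<t1} \<longrightarrow> (AE x in lborel. U x t = u x t)"
    using AE_lborel_null_cover[OF slices] by (rule bexE)
  have tested: "0 \<le> (\<integral>x. (U x b' powr (p - 1) - U x b powr (p - 1)) * \<psi> x \<partial>lborel)
           + (\<integral>z. (LINT \<tau>:{b..b'}|lborel. cdn p (U (fst z) \<tau> - U (snd z) \<tau>) * k (fst z) (snd z) \<tau>)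
                * (\<psi> (fst z) - \<psi> (snd z)) \<partial>lborel)"
    if b: "b \<notin> N" "b' \<notin> N" "t0 < b" "b < b'" "b' < t1" and adm: "admissible_test s p r x0 \<psi>" for b b' \<psi>
  proof -
    have pb[measurable]: "\<psi> \<in> borel_measurable borel" using adm by (simp add: admissible_test_def)
    obtain c where c: "\<And>x. 0 \<le> \<psi> x" "\<And>x. \<psi> x \<le> c" using adm by (auto simp: admissible_test_def)
    obtain R where R: "R < r" "\<And>x. x \<notin> ball x0 R \<Longrightarrow> \<psi> x = 0" using adm by (auto simp: admissible_test_def)
    have p0: "0 < p" "1 \<le> p" and T: "0 < T" using p t by auto
    have wf: "0 \<le> weak_form p K (ball x0 R) b b' u (\<lambda>x t. \<psi> x) (\<lambda>x t. 0)"
      by (rule weak[OF inside[OF R(1)] _ b(4) _ time_constant_test[OF adm R(2) p0(1) T]])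
         (use b t c in auto)
    have Us[measurable]: "(\<lambda>x. U x \<tau>) \<in> borel_measurable borel" for \<tau>
    proof -
      have "(\<lambda>x :: real ^ 'n. (x, \<tau>)) \<in> borel_measurable borel" by measurable
      from measurable_compose[OF this U(1)] show ?thesis by simp
    qed
    have slice: "(LINT x:ball x0 R|lebesgue. u x \<tau> powr (p - 1) * \<psi> x) = (\<integral>x. U x \<tau> powr (p - 1) * \<psi> x \<partial>lborel)"
      if "\<tau> \<notin> N" "\<tau> \<in> {t0<..<t1}" for \<tau>
      unfolding set_lebesgue_integral_def
    proof (rule integral_lebesgue_transfer)
      have "AE x in lborel. U x \<tau> = u x \<tau>" by (rule N(2)[rule_format, OF that])
      then show "AE x in lborel. indicator (ball x0 R) x *\<^sub>R (u x \<tau> powr (p - 1) * \<psi> x) = U x \<tau> powr (p - 1) * \<psi> x"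
        by eventually_elim (use R(2) in \<open>auto simp: indicator_def\<close>)
    qed measurable
    have sl_int: "integrable lborel (\<lambda>x. U x \<tau> powr (p - 1) * \<psi> x)" for \<tau>
    proof (rule integrable_bounded_support[where c = "M powr (p - 1) * c" and R = R and ?x0.0 = x0])
      fix x
      have "0 \<le> U x \<tau>" using U(2)[of x \<tau>] rho by linarith
      then show "\<bar>U x \<tau> powr (p - 1) * \<psi> x\<bar> \<le> M powr (p - 1) * c"
        using c[of x] U(3)[of x \<tau>] p by (auto simp: abs_mult intro!: mult_mono powr_mono2)
    qed (use R(2) in auto)
    define F where "F = (\<lambda>w. indicator {b..b'} (snd w) * (cdn p (U (fst (fst w)) (snd w) - U (snd (fst w)) (snd w))
      * k (fst (fst w)) (snd (fst w)) (snd w) * (\<psi> (fst (fst w)) - \<psi> (snd (fst w)))))"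
    have F: "F \<in> borel_measurable borel" "integrable lborel F"
      unfolding F_def
      using integrable_tested_flux[OF p0(2) s Lam rho U(1-3) k(1) k0 k(3) energy adm, of b b'] b by auto
    define G where "G = (\<lambda>w. F ((fst w, fst (snd w)), snd (snd w)))"
    have G: "G \<in> borel_measurable borel"
    proof -
      have "(\<lambda>w. ((fst w, fst (snd w)), snd (snd w))) \<in> borel_measurable (borel :: ((real ^ 'n) \<times> (real ^ 'n) \<times> real) measure)"
        by (intro borel_measurable_Pair borel_measurable_fst_snd
            measurable_compose[OF borel_measurable_fst_snd(2) borel_measurable_fst_snd(1)]
            measurable_compose[OF borel_measurable_fst_snd(2) borel_measurable_fst_snd(2)])
      from measurable_compose[OF this F(1)] show ?thesis by (simp add: G_def)
    qed
    have "(LINT (x, y, t):UNIV \<times> UNIV \<times> {b..b'}|lebesgue.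
          \<bar>u x t - u y t\<bar> powr (p - 2) * (u x t - u y t) * (\<psi> x - \<psi> y) * K x y t) = integral\<^sup>L lborel G"
      unfolding set_lebesgue_integral_def
    proof (rule integral_lebesgue_transfer[OF G])
      show "AE w in lborel. indicator (UNIV \<times> UNIV \<times> {b..b'}) w *\<^sub>R (case w of (x, y, t) \<Rightarrow>
          \<bar>u x t - u y t\<bar> powr (p - 2) * (u x t - u y t) * (\<psi> x - \<psi> y) * K x y t) = G w"
        using AE_lborel_fst_third[OF U(4), where 'b="real ^ 'n"] AE_lborel_snd[OF U(4), where 'a="real ^ 'n"] k(4)
      proof eventually_elim
        case (elim w)
        obtain x y \<tau> where w: "w = (x, y, \<tau>)" by (cases w) auto
        show ?case
        proof (cases "\<tau> \<in> {b..b'}")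
          case True
          then have "U x \<tau> = u x \<tau>" "U y \<tau> = u y \<tau>" "x \<noteq> y \<Longrightarrow> k x y \<tau> = K x y \<tau>"
            using elim b t by (auto simp: w)
          \<comment> \<open>On the diagonal \<open>k\<close> and \<open>K\<close> may differ, but
            both sides contain the factor \<open>u x \<tau> - u y \<tau> = 0\<close>.\<close>
          then show ?thesis using True by (cases "x = y") (auto simp: w G_def F_def cdn_def)
        qed (simp add: w G_def F_def)
      qed
    qed
    also have "\<dots> = integral\<^sup>L lborel F"
      using integral_lborel_assoc[OF G] by (simp add: G_def)
    also have "\<dots> = (\<integral>z. (LINT \<tau>:{b..b'}|lborel. cdn p (U (fst z) \<tau> - U (snd z) \<tau>) * k (fst z) (snd z) \<tau>)
                * (\<psi> (fst z) - \<psi> (snd z)) \<partial>lborel)"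
      unfolding integral_lborel_pair_swap(3)[OF F(2)]
      by (intro Bochner_Integration.integral_cong) (simp_all add: F_def set_lebesgue_integral_def mult.assoc[symmetric])
    finally have flux: "(LINT (x, y, t):UNIV \<times> UNIV \<times> {b..b'}|lebesgue.
          \<bar>u x t - u y t\<bar> powr (p - 2) * (u x t - u y t) * (\<psi> x - \<psi> y) * K x y t)
        = (\<integral>z. (LINT \<tau>:{b..b'}|lborel. cdn p (U (fst z) \<tau> - U (snd z) \<tau>) * k (fst z) (snd z) \<tau>)
                * (\<psi> (fst z) - \<psi> (snd z)) \<partial>lborel)" .
    have "(\<integral>x. (U x b' powr (p - 1) - U x b powr (p - 1)) * \<psi> x \<partial>lborel)
      = (\<integral>x. U x b' powr (p - 1) * \<psi> x \<partial>lborel) - (\<integral>x. U x b powr (p - 1) * \<psi> x \<partial>lborel)"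
      by (simp add: left_diff_distrib Bochner_Integration.integral_diff[OF sl_int sl_int])
    moreover have "(LINT (x, t):ball x0 R \<times> {b..b'}|lebesgue. u x t powr (p - 1) * 0) = 0"
      by (simp add: set_lebesgue_integral_def split_beta)
    ultimately show ?thesis
      using wf slice[OF b(1)] slice[OF b(2)] b(3-5) unfolding weak_form_def flux by simp
  qed
  show thesis
  proof (rule that[OF _ U(4)])
    show "nonlocal_supersolution s p \<Lambda> \<rho> M t0 t1 r x0 U k"
    proof (rule nonlocal_supersolution.intro[OF p s Lam rho t(2) U(1-3) k(1-3) energy])
      show "\<exists>N\<in>null_sets lborel. \<forall>b b' \<psi>. b \<notin> N \<and> b' \<notin> N \<and> t0 < b \<and> b < b' \<and> b' < t1 \<and>
         admissible_test s p r x0 \<psi> \<longrightarrow>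
         0 \<le> (\<integral>x. (U x b' powr (p - 1) - U x b powr (p - 1)) * \<psi> x \<partial>lborel)
           + (\<integral>z. (LINT \<tau>:{b..b'}|lborel. cdn p (U (fst z) \<tau> - U (snd z) \<tau>) * k (fst z) (snd z) \<tau>)
                * (\<psi> (fst z) - \<psi> (snd z)) \<partial>lborel)"
        by (rule bexI[OF _ N(1)], intro allI impI, elim conjE, rule tested)
    qed
  qed
qed

text \<open>
  If \<open>s * p \<ge> n\<close>, then \<open>\<kappa> = 3/2\<close> does not determine the gain \<open>K = 1 + p * s / n\<close> of one iteration step,
  but \<open>2 \<le> K \<le> 1 + p\<close>; the second summand covers this case.
\<close>

definition moser_exponent :: "real \<Rightarrow> real \<Rightarrow> real" where
  "moser_exponent \<kappa> p = \<bar>p * \<kappa> / (\<kappa> - 1) * \<kappa>\<bar> + \<bar>p\<bar> * (1 + \<bar>p\<bar>) ^ 2 + 1"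

text \<open>The constant of \<open>reverse_hoelder\<close>. Its dependence on \<open>q\<close> is
  through \<open>p - 1 - q / K\<close>, the distance that the exponents keep from the critical value
  \<open>p - 1\<close>.\<close>

definition hoelder_const :: "'n::finite itself \<Rightarrow> real \<Rightarrow> real \<Rightarrow> real \<Rightarrow> real \<Rightarrow> real" where
  "hoelder_const TYPEn p q s \<Lambda> =
    (let K = 1 + p * s / real CARD('n)
     in max 1 (((2 powr (p * K / (K - 1)) * moser_const TYPEn s p \<Lambda> (p - 1 - q / K)) powr (K / (K - 1))) powr K))"

text \<open>If \<open>s * p < n\<close>, then \<open>kappa\<close> is \<open>K\<close>. Otherwise
  \<open>kappa\<close> is \<open>3 / 2\<close> and \<open>2 \<le> K\<close>, so the admissible range
  of \<open>q\<close> lies inside that of \<open>reverse_hoelder\<close>, and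
  \<open>K - 1 \<ge> 1\<close> with \<open>K \<le> 1 + p\<close> bounds the exponent by a quantity
  depending on \<open>p\<close> alone.\<close>

lemma moser_exponent_ge:
  assumes "2 < p" "0 < s" "s < 1"
  defines "K \<equiv> 1 + p * s / real CARD('n::finite)"
  shows "p * K / (K - 1) * K \<le> moser_exponent (kappa CARD('n) s p) p" "kappa CARD('n) s p \<le> K"
proof -
  define n where "n = real CARD('n)"
  have n: "1 \<le> n" by (simp add: n_def)
  show "p * K / (K - 1) * K \<le> moser_exponent (kappa CARD('n) s p) p"
  proof (cases "s * p < n")
    case True
    then have kK: "kappa CARD('n) s p = K" using n by (simp add: kappa_def K_def n_def[symmetric] field_simps)
    moreover have "p * K / (K - 1) * K \<le> \<bar>p * K / (K - 1) * K\<bar>" by (rule abs_ge_self)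
    moreover have "0 \<le> \<bar>p\<bar> * (1 + \<bar>p\<bar>) ^ 2" by simp
    ultimately show ?thesis unfolding moser_exponent_def kK by linarith
  next
    case False
    have "1 \<le> p * s / n" using False n by (simp add: field_simps)
    then have K2: "1 \<le> K - 1" by (simp add: K_def n_def)
    have "p * s / n \<le> p * s / 1" by (rule divide_left_mono) (use n assms in auto)
    also have "\<dots> \<le> p" using assms mult_left_mono[of s 1 p] by simp
    finally have Kp: "K \<le> 1 + p" by (simp add: K_def n_def)
    have "p * K / (K - 1) \<le> p * K / 1" by (rule divide_left_mono) (use K2 assms in auto)
    then have "p * K / (K - 1) * K \<le> p * K * K" using K2 by (intro mult_right_mono) auto
    also have "\<dots> = p * K ^ 2" by (simp add: power2_eq_square)
    also have "\<dots> \<le> p * (1 + p) ^ 2" using Kp K2 assms by (intro mult_left_mono power_mono) auto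
    also have "\<dots> \<le> moser_exponent (kappa CARD('n) s p) p" using assms by (simp add: moser_exponent_def)
    finally show ?thesis .
  qed
  show "kappa CARD('n) s p \<le> K"
  proof (cases "s * p < n")
    case True
    then show ?thesis using n by (simp add: kappa_def K_def n_def[symmetric] field_simps)
  next
    case False
    then have "1 \<le> p * s / n" using n by (simp add: field_simps)
    then show ?thesis using False by (simp add: kappa_def K_def n_def)
  qed
qed

lemma reverse_hoelder_weak_supersolution:
  fixes u :: "real ^ 'n \<Rightarrow> real \<Rightarrow> real"
  assumes p: "2 < p" and s: "0 < s" "s < 1" and Lam: "1 \<le> \<Lambda>" and rho: "0 < \<rho>"
    and K: "admissible_kernel s p \<Lambda> T K" and u: "weak_supersolution s p T \<Omega> K u"
    and r: "0 < r" and ball: "ball x0 r \<subseteq> \<Omega>" and t: "0 < t0" "t0 < T - r powr (p * s)"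
    and lb: "AE (x, t) in lebesgue. t \<in> {t0<..<t0 + r powr (p * s)} \<longrightarrow> \<rho> \<le> u x t"
    and th: "1 / 2 \<le> \<theta>" "\<theta> < 1" and q: "0 < qb" "qb < q" "q < kappa CARD('n) s p * (p - 1)"
  shows "(integral_average (Uplus s p x0 t0 (\<theta> * r)) (\<lambda>(x, t). u x t powr q)) powr (1 / q)
       \<le> (hoelder_const TYPE('n) p q s \<Lambda> / (1 - \<theta>) powr moser_exponent (kappa CARD('n) s p) p
            * integral_average (Uplus s p x0 t0 r) (\<lambda>(x, t). u x t powr qb)) powr (1 / qb)"
proof -
  define t1 where "t1 = t0 + r powr (s * p)"
  define K' where "K' = 1 + p * s / real CARD('n)"
  define B where "B = ((2 powr (p * K' / (K' - 1)) * moser_const TYPE('n) s p \<Lambda> (p - 1 - q / K')) powr (K' / (K' - 1))) powr K'"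
  have t1: "t0 < t1" "t1 < T" using t r by (simp_all add: t1_def mult.commute)
  have lb': "AE (x, t) in lebesgue. t \<in> {t0<..<t1} \<longrightarrow> \<rho> \<le> u x t"
    using lb by (simp add: t1_def mult.commute)
  obtain U M k where ns: "nonlocal_supersolution s p \<Lambda> \<rho> M t0 t1 r x0 U k"
    and U: "AE z in lborel. snd z \<in> {t0<..<t1} \<longrightarrow> U (fst z) (snd z) = u (fst z) (snd z)"
    by (rule nonlocal_supersolution_of_weak[OF p s Lam rho K u ball t(1) t1 lb'])
  interpret nonlocal_supersolution s p \<Lambda> \<rho> M t0 t1 r x0 U k by (rule ns)
  have sp: "0 \<le> s * p" using s p by simp
  have qK: "q < K' * (p - 1)"
  proof -
    have "kappa CARD('n) s p * (p - 1) \<le> K' * (p - 1)"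
      unfolding K'_def by (rule mult_right_mono[OF moser_exponent_ge(2)[OF p s]]) (use p in simp)
    with q(3) show ?thesis by linarith
  qed
  have "avg (\<theta> * r) q powr (1 / q) \<le> (B * (1 - \<theta>) powr (- (p * K' / (K' - 1) * K')) * avg r qb) powr (1 / qb)"
    using reverse_hoelder[OF r t1_def th q(1,2)] qK by (simp add: K'_def B_def)
  also have "\<dots> \<le> (hoelder_const TYPE('n) p q s \<Lambda> * (1 - \<theta>) powr (- moser_exponent (kappa CARD('n) s p) p) * avg r qb) powr (1 / qb)"
  proof (intro powr_mono2 mult_right_mono mult_mono)
    show "B \<le> hoelder_const TYPE('n) p q s \<Lambda>"
      by (simp add: hoelder_const_def Let_def B_def K'_def)
    show "(1 - \<theta>) powr (- (p * K' / (K' - 1) * K')) \<le> (1 - \<theta>) powr (- moser_exponent (kappa CARD('n) s p) p)"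
      using moser_exponent_ge(1)[OF p s, where 'n='n] th unfolding K'_def by (intro powr_mono') auto
  qed (use slab_avg(2)[OF r q(1)] q(1) in \<open>auto simp: B_def hoelder_const_def Let_def\<close>)
  also have "hoelder_const TYPE('n) p q s \<Lambda> * (1 - \<theta>) powr (- moser_exponent (kappa CARD('n) s p) p)
      = hoelder_const TYPE('n) p q s \<Lambda> / (1 - \<theta>) powr moser_exponent (kappa CARD('n) s p) p"
    by (simp add: powr_minus_divide)
  also have "avg r qb = integral_average (Uplus s p x0 t0 r) (\<lambda>(x, t). u x t powr qb)"
    by (rule integral_average_eq_avg[OF U r _ q(1), symmetric]) (simp add: t1_def)
  also have "avg (\<theta> * r) q = integral_average (Uplus s p x0 t0 (\<theta> * r)) (\<lambda>(x, t). u x t powr q)"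
  proof (rule integral_average_eq_avg[OF U, symmetric])
    show "0 < \<theta> * r" "0 < q" using th r q by auto
    have "(\<theta> * r) powr (s * p) \<le> r powr (s * p)"
      by (rule powr_mono2) (use th r sp mult_right_mono[of \<theta> 1 r] in auto)
    then show "t0 + (\<theta> * r) powr (s * p) \<le> t1" by (simp add: t1_def)
  qed
  finally show ?thesis .
qed

theorem theorem2p16:
  shows "\<exists>(\<mu> :: real \<Rightarrow> real \<Rightarrow> real) (C :: real \<Rightarrow> real \<Rightarrow> real \<Rightarrow> real \<Rightarrow> real).
    (\<forall>\<kappa> p. 0 < \<mu> \<kappa> p) \<and> (\<forall>p q s \<Lambda>. 1 \<le> C p q s \<Lambda>) \<and>
    (\<forall>(p::real) (s::real) (\<Lambda>::real) (T::real) (\<Omega> :: (real ^ 'n::finite) set) K u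
       (\<rho>::real) (x0 :: real ^ 'n) (t0::real) (r::real) (\<theta>::real) (q::real) (qb::real).
       2 < p \<and> 0 < s \<and> s < 1 \<and> 1 \<le> \<Lambda> \<and> 0 < T \<and>
       bounded_smooth_domain \<Omega> \<and>
       admissible_kernel s p \<Lambda> T K \<and>
       weak_supersolution s p T \<Omega> K u \<and>
       0 < r \<and> ball x0 r \<subseteq> \<Omega> \<and> 0 < t0 \<and> t0 < T - r powr (p * s) \<and>
       0 < \<rho> \<and>
       (AE (x, t) in lebesgue. t \<in> {t0<..<t0 + r powr (p * s)} \<longrightarrow> \<rho> \<le> u x t) \<and>
       1 / 2 \<le> \<theta> \<and> \<theta> < 1 \<and>
       0 < qb \<and> qb < q \<and> q < kappa CARD('n) s p * (p - 1)
       \<longrightarrow>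
       (integral_average (Uplus s p x0 t0 (\<theta> * r)) (\<lambda>(x, t). u x t powr q)) powr (1 / q)
       \<le> (C p q s \<Lambda> / (1 - \<theta>) powr \<mu> (kappa CARD('n) s p) p
            * integral_average (Uplus s p x0 t0 r) (\<lambda>(x, t). u x t powr qb)) powr (1 / qb))"
\<comment> \<open>The sign conditions are demanded for all real arguments, which is the reason for
  the absolute values and the summand 1 in \<open>moser_exponent\<close> and for
  \<open>max 1\<close> in \<open>hoelder_const\<close>.\<close>
proof (intro exI[of _ moser_exponent] exI[of _ "hoelder_const TYPE('n)"] conjI allI impI)
  show "0 < moser_exponent \<kappa> p" for \<kappa> p
    unfolding moser_exponent_def by (intro add_nonneg_pos add_nonneg_nonneg) auto
  show "1 \<le> hoelder_const TYPE('n) p q s \<Lambda>" for p q s \<Lambda>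
    by (simp add: hoelder_const_def Let_def)
qed (elim conjE, rule reverse_hoelder_weak_supersolution, assumption+)

end
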